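(* Let $k\ge 2$, $\sigma^2>0$, $\theta>0$, $\rho=\theta/\sigma^2$, and $u\in\mathbb{R}^k$ with $\|u\|=1$. For each ARL level $\gamma$ (sufficiently large), let the Subspace-CUSUM procedure use the optimized window size $$w=w_\gamma^*=\sqrt{\log\gamma}\cdot\frac{\sqrt{2(k-1)}}{\rho-\log(1+\rho)}\,\bigl(1+o(1)\bigr)\quad(\gamma\to\infty),$$ a positive integer, and the optimized drift $$d=d_\gamma^*=\frac{\sigma^2(1+\rho)\left(1-\frac{k-1}{w_\gamma^*\rho}\right)}{(1+\rho)\left(1-\frac{k-1}{w_\gamma^*\rho}\right)-1}\,\log\left[(1+\rho)\left(1-\frac{k-1}{w_\gamma^*\rho}\right)\right],$$ and let the threshold of the Subspace-CUSUM stopping time $\mathcal{T}_{\rm C}$ and the threshold of the exact CUSUM stopping time $T_{\rm C}$ each be chosen so that $\mathbb{E}_\infty[\mathcal{T}_{\rm C}]=\gamma$ and $\mathbb{E}_\infty[T_{\rm C}]=\gamma$. Then the expected detection delay of Subspace-CUSUM, $\mathrm{EDD}(\mathcal{T}_{\rm C})=\mathbb{E}_0[\mathcal{T}_{\rm C}]+w_\gamma^*$ (the term $w_\gamma^*$ accounts for the use of future data), and that of the exact CUSUM satisfy $$\lim_{\gamma\to\infty}\frac{\mathrm{EDD}(\mathcal{T}_{\rm C})}{\mathbb{E}_0[T_{\rm C}]}=1.$$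
   Context: Emerging subspace model: observations $x_1,x_2,\ldots\in\mathbb{R}^k$ are independent, with $x_t\sim\mathcal{N}(0,\sigma^2I_k)$ for $t\le\tau$ and $x_t\sim\mathcal{N}(0,\sigma^2I_k+\theta uu^\intercal)$ for $t>\tau$. $\mathbb{P}_\infty,\mathbb{E}_\infty$ denote the regime in which there is never a change (all $x_t$ i.i.d. $\mathcal{N}(0,\sigma^2 I_k)$, density $f_\infty$). $\mathbb{P}_0,\mathbb{E}_0$ denote the regime with change at time $\tau=0$ (all $x_t$ i.i.d. $\mathcal{N}(0,\sigma^2I_k+\theta uu^\intercal)$, density $f_0$). Write $(x)^+=\max\{x,0\}$. Exact CUSUM (knows $f_0$ and $f_\infty$): $S_0=0$, $S_t=(S_{t-1})^++\log\frac{f_0(x_t)}{f_\infty(x_t)}$, $T_{\rm C}=\inf\{t>0:S_t\ge b\}$ for a constant threshold $b$. Subspace-CUSUM (does not know $u$) with window size $w$, drift $d$, and threshold $b'$: for each $t\ge 1$ let $\hat u_t$ be a unit-norm eigenvector corresponding to the largest eigenvalue of $\Sigma_t=\sum_{i=t+1}^{t+w}x_ix_i^\intercal$ (its sign is irrelevant). Set $\mathcal{S}_0=0$, $\mathcal{S}_t=(\mathcal{S}_{t-1})^++(\hat u_t^\intercal x_t)^2-d$, and $\mathcal{T}_{\rm C}=\inf\{t>0:\mathcal{S}_t\ge b'\}$. Because $\hat u_t$ uses data up to time $t+w$, stopping with $\mathcal{T}_{\rm C}=t$ means actually stopping at time $t+w$. The average run length (ARL) of a stopping time is its expectation under $\mathbb{E}_\infty$.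 The expected detection delay (EDD) of the exact CUSUM is $\mathbb{E}_0[T_{\rm C}]$. *)

theory Defs
  imports "HOL-Probability.Probability"
begin

definition outer :: "real^'n \<Rightarrow> real^'n \<Rightarrow> real^'n^'n"
  where "outer x y = (\<chi> i j. x $ i * y $ j)"

(* Density, with respect to Lebesgue measure, of the centred normal distribution with
   invertible covariance matrix S. *)
definition mvn_density :: "real^'n^'n \<Rightarrow> real^'n \<Rightarrow> real"
  where "mvn_density S y =
    exp (- (y \<bullet> (matrix_inv S *v y)) / 2) / sqrt ((2 * pi) ^ CARD('n) * det S)"

(* "mat c" is c times the identity matrix. *)
definition f_inf :: "real \<Rightarrow> real^'k \<Rightarrow> real"
  where "f_inf \<sigma> = mvn_density (mat (\<sigma>\<^sup>2))"

definition f_zero :: "real \<Rightarrow> real \<Rightarrow> real^'k \<Rightarrow> real^'k \<Rightarrow> real"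
  where "f_zero \<sigma> \<theta> u = mvn_density (mat (\<sigma>\<^sup>2) + \<theta> *\<^sub>R outer u u)"

(* Under the probability measure M the observations x 1, x 2, ... follow the model with
   change point \<tau>; \<tau> = \<infinity> means that there is never a change. The value x 0 plays no role. *)
definition emerging_subspace ::
    "real \<Rightarrow> real \<Rightarrow> real^'k \<Rightarrow> enat \<Rightarrow> 'a measure \<Rightarrow> (nat \<Rightarrow> 'a \<Rightarrow> real^'k) \<Rightarrow> bool"
  where "emerging_subspace \<sigma> \<theta> u \<tau> M x \<longleftrightarrow>
    prob_space M \<and>
    prob_space.indep_vars M (\<lambda>_. borel) x {1..} \<and>
    (\<forall>t\<ge>1. distributed M lborel (x t)
       (\<lambda>y. ennreal (if enat t \<le> \<tau> then f_inf \<sigma> y else f_zero \<sigma> \<theta> u y)))"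

primrec cusum :: "(nat \<Rightarrow> real) \<Rightarrow> nat \<Rightarrow> real"
  where
    "cusum l 0 = 0"
  | "cusum l (Suc t) = max (cusum l t) 0 + l (Suc t)"

(* The infimum of the empty set is \<infinity>. *)
definition cusum_time :: "(nat \<Rightarrow> real) \<Rightarrow> real \<Rightarrow> enat"
  where "cusum_time l b = Inf (enat ` {t. t > 0 \<and> cusum l t \<ge> b})"

definition exact_cusum_time ::
    "real \<Rightarrow> real \<Rightarrow> real^'k \<Rightarrow> (nat \<Rightarrow> 'a \<Rightarrow> real^'k) \<Rightarrow> real \<Rightarrow> 'a \<Rightarrow> enat"
  where "exact_cusum_time \<sigma> \<theta> u x b \<omega> =
    cusum_time (\<lambda>t. ln (f_zero \<sigma> \<theta> u (x t \<omega>) / f_inf \<sigma> (x t \<omega>))) b"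

definition window_cov :: "(nat \<Rightarrow> 'a \<Rightarrow> real^'k) \<Rightarrow> nat \<Rightarrow> nat \<Rightarrow> 'a \<Rightarrow> real^'k^'k"
  where "window_cov x w t \<omega> = (\<Sum>i = t+1..t+w. outer (x i \<omega>) (x i \<omega>))"

definition is_eigenvalue :: "real^'n^'n \<Rightarrow> real \<Rightarrow> bool"
  where "is_eigenvalue A c \<longleftrightarrow> (\<exists>v. v \<noteq> 0 \<and> A *v v = c *\<^sub>R v)"

definition unit_top_eigenvector :: "real^'n^'n \<Rightarrow> real^'n \<Rightarrow> bool"
  where "unit_top_eigenvector A v \<longleftrightarrow>
    norm v = 1 \<and>
    (\<exists>c. A *v v = c *\<^sub>R v \<and> (\<forall>\<mu>. is_eigenvalue A \<mu> \<longrightarrow> \<mu> \<le> c))"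

(* Any choice of the unit eigenvectors is admitted, including an arbitrary choice of sign,
   as long as it yields random vectors. *)
definition subspace_estimator ::
    "'a measure \<Rightarrow> (nat \<Rightarrow> 'a \<Rightarrow> real^'k) \<Rightarrow> nat \<Rightarrow> (nat \<Rightarrow> 'a \<Rightarrow> real^'k) \<Rightarrow> bool"
  where "subspace_estimator M x w uhat \<longleftrightarrow>
    (\<forall>t\<ge>1. uhat t \<in> borel_measurable M \<and>
       (\<forall>\<omega>\<in>space M. unit_top_eigenvector (window_cov x w t \<omega>) (uhat t \<omega>)))"

(* The procedure based on uhat with drift d and threshold b. *)
definition subspace_cusum_time ::
    "(nat \<Rightarrow> 'a \<Rightarrow> real^'k) \<Rightarrow> (nat \<Rightarrow> 'a \<Rightarrow> real^'k) \<Rightarrow> real \<Rightarrow> real \<Rightarrow> 'a \<Rightarrow> enat"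
  where "subspace_cusum_time x uhat d b \<omega> =
    cusum_time (\<lambda>t. (uhat t \<omega> \<bullet> x t \<omega>)\<^sup>2 - d) b"

definition expected_time :: "'a measure \<Rightarrow> ('a \<Rightarrow> enat) \<Rightarrow> ennreal"
  where "expected_time M T = (\<integral>\<^sup>+ \<omega>. ennreal_of_enat (T \<omega>) \<partial>M)"

(* The dimension k and the window size w enter as real numbers. *)
definition opt_drift :: "real \<Rightarrow> real \<Rightarrow> real \<Rightarrow> real \<Rightarrow> real"
  where "opt_drift \<sigma> \<rho> k w =
    \<sigma>\<^sup>2 * (1 + \<rho>) * (1 - (k - 1) / (w * \<rho>)) / ((1 + \<rho>) * (1 - (k - 1) / (w * \<rho>)) - 1)
      * ln ((1 + \<rho>) * (1 - (k - 1) / (w * \<rho>)))"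

end

theory Submission
  imports Defs "HOL-Real_Asymp.Real_Asymp"
begin

text \<open>
  Both delays are asymptotic to \<open>ln \<gamma> / I\<close>, where \<open>I = (\<rho> - ln (1 + \<rho>)) / 2\<close> is the Kullback-Leibler
  divergence of the law after the change from the law before it, and the window is only of order
  \<open>sqrt (ln \<gamma>)\<close>. Hence the ratio tends to one.

  Before the change the increments of the Subspace-CUSUM are exactly independent and identically
  distributed, although consecutive windows overlap. Read backwards in time, the direction used at time
  \<open>t\<close> is a function of later observations, and the projection of a spherical Gaussian vector has the same
  law in every direction (\<open>proj_stat_factor\<close>, \<open>indep_vars_proj_stat\<close>). This requires the direction to be a
  function of the window, that is, a simple top eigenvalue; adding one observation to a fixed matrix
  makes the top eigenvalue multiple only if the observation lies in a fixed hyperplane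
  (\<open>degenerate_rank_one_update\<close>, \<open>AE_not_degenerate\<close>). With the optimised drift the increments are, up to
  a scale factor, log-likelihood ratios of two centred normal laws with a variance ratio that tends to
  \<open>1 + \<rho>\<close>. The exact CUSUM has this form too, with the constant ratio \<open>1 + \<rho>\<close>, so both procedures are
  treated by the same lemmas.

  For such increments the threshold \<open>B\<close> is asymptotic to \<open>ln \<gamma>\<close> (\<open>arl_threshold_asymptotics\<close>). On the one
  hand a false alarm up to time \<open>n\<close> has probability at most \<open>n * exp (- B)\<close> (\<open>cusum_false_alarm\<close>). On the
  other hand, by an exponential tilt, a block of about \<open>B / I\<close> observations raises a false alarm with
  probability about \<open>exp (- B)\<close> (\<open>tail_lower_bound_by_tilting\<close>, \<open>arl_le\<close>); blocks that are separated by gaps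
  as long as the window are independent.

  After the change, sample covariance matrices concentrate, the estimated direction is consistent, and
  the increments are close in mean to those of the exact CUSUM (\<open>proj_stat_mean_error\<close>,
  \<open>subspace_llr_error\<close>). For the exact increments Chernoff bounds give a drift \<open>I\<close> per step from above and
  from below. Markov's inequality for the summed differences transfers these bounds, so that the alarm
  comes neither much later (\<open>delay_le\<close>) nor much earlier (\<open>delay_ge\<close>) than \<open>B / I\<close>
  (\<open>delay_asymptotics\<close>).
\<close>

section \<open>CUSUM recursions as maxima over segments\<close>

lemma cusum_ge_segment_sum:
  assumes "1 \<le> j" "j \<le> t"
  shows "(\<Sum>i=j..t. l i) \<le> cusum l t"
  using assms
proof (induction t)
  case (Suc t)
  show ?case
  proof (cases "j = Suc t")
    case True
    then show ?thesis by simp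
  next
    case False
    then have "(\<Sum>i=j..t. l i) \<le> cusum l t" using Suc by simp
    with Suc.prems show ?thesis by (simp add: sum.atLeast_Suc_atMost_Suc_shift)
  qed
qed simp

text \<open>The segment starts at the last restart of the recursion.\<close>

lemma cusum_eq_segment_sum:
  assumes "1 \<le> t"
  shows "\<exists>j. 1 \<le> j \<and> j \<le> t \<and> cusum l t = (\<Sum>i=j..t. l i)"
  using assms
proof (induction t)
  case (Suc t)
  show ?case
  proof (cases "t = 0 \<or> cusum l t \<le> 0")
    case True
    then show ?thesis by (intro exI[of _ "Suc t"]) auto
  next
    case False
    then obtain j where "1 \<le> j" "j \<le> t" "cusum l t = (\<Sum>i=j..t. l i)"
      using Suc by auto
    with False show ?thesis by (intro exI[of _ j]) auto
  qed
qed simp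

lemma cusum_cong:
  assumes "\<And>t. t \<ge> 1 \<Longrightarrow> l t = l' t"
  shows "cusum l = cusum l'"
proof
  fix t show "cusum l t = cusum l' t" by (induction t) (simp_all add: assms)
qed

lemma cusum_scale:
  assumes "(c::real) > 0"
  shows "cusum (\<lambda>t. c * l t) t = c * cusum l t"
proof (induction t)
  case (Suc t)
  have "max (c * cusum l t) 0 = c * max (cusum l t) 0"
    using assms by (auto simp: max_def zero_le_mult_iff mult_le_0_iff)
  with Suc show ?case by (simp add: distrib_left)
qed simp

lemma cusum_time_scale:
  assumes "(c::real) > 0"
  shows "cusum_time (\<lambda>t. c * l t) (c * b) = cusum_time l b"
  using assms by (simp add: cusum_time_def cusum_scale)

lemma cusum_time_cong:
  assumes "\<And>t. t \<ge> 1 \<Longrightarrow> l t = l' t"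
  shows "cusum_time l b = cusum_time l' b"
  using cusum_cong[OF assms] by (simp add: cusum_time_def)

lemma Inf_enat_le_iff: "Inf (enat ` A) \<le> enat n \<longleftrightarrow> (\<exists>t\<in>A. t \<le> n)"
proof
  assume *: "Inf (enat ` A) \<le> enat n"
  then have "A \<noteq> {}" by (auto simp: top_enat_def)
  then have "Inf (enat ` A) \<in> enat ` A"
    unfolding Inf_enat_def by (auto intro: LeastI)
  with * show "\<exists>t\<in>A. t \<le> n" by auto
next
  assume "\<exists>t\<in>A. t \<le> n"
  then obtain t where "t \<in> A" "t \<le> n" by auto
  then show "Inf (enat ` A) \<le> enat n"
    by (meson INF_lower2 enat_ord_simps(1))
qed

lemma cusum_time_le_iff:
  "cusum_time l b \<le> enat n \<longleftrightarrow> (\<exists>t. 1 \<le> t \<and> t \<le> n \<and> b \<le> cusum l t)"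
  unfolding cusum_time_def Inf_enat_le_iff by (auto simp: Suc_le_eq)

lemma cusum_time_le_iff_segment:
  "cusum_time l b \<le> enat n \<longleftrightarrow>
     (\<exists>j t. 1 \<le> j \<and> j \<le> t \<and> t \<le> n \<and> b \<le> (\<Sum>i=j..t. l i))"
proof
  assume "cusum_time l b \<le> enat n"
  then obtain t where "1 \<le> t" "t \<le> n" "b \<le> cusum l t" by (auto simp: cusum_time_le_iff)
  then show "\<exists>j t. 1 \<le> j \<and> j \<le> t \<and> t \<le> n \<and> b \<le> (\<Sum>i=j..t. l i)"
    using cusum_eq_segment_sum[of t l] by metis
next
  assume "\<exists>j t. 1 \<le> j \<and> j \<le> t \<and> t \<le> n \<and> b \<le> (\<Sum>i=j..t. l i)"
  then obtain j t where "1 \<le> j" "j \<le> t" "t \<le> n" "b \<le> (\<Sum>i=j..t. l i)" by auto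
  then show "cusum_time l b \<le> enat n"
    using cusum_ge_segment_sum[of j t l] by (auto simp: cusum_time_le_iff intro!: exI[of _ t])
qed

lemma cusum_time_mono:
  assumes "b \<le> b'"
  shows "cusum_time l b \<le> cusum_time l b'"
  unfolding cusum_time_def using assms by (intro Inf_superset_mono) (auto intro: image_mono)

lemma borel_measurable_cusum:
  assumes "\<And>t. t \<ge> 1 \<Longrightarrow> (\<lambda>\<omega>. l \<omega> t) \<in> borel_measurable M"
  shows "(\<lambda>\<omega>. cusum (l \<omega>) t) \<in> borel_measurable M"
proof (induction t)
  case (Suc t)
  have [measurable]: "(\<lambda>\<omega>. l \<omega> (Suc t)) \<in> borel_measurable M" by (rule assms) simp
  note Suc[measurable]
  show ?case by simp
qed simp

lemma measurable_cusum_time: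
  assumes "\<And>t. t \<ge> 1 \<Longrightarrow> (\<lambda>\<omega>. l \<omega> t) \<in> borel_measurable M"
  shows "(\<lambda>\<omega>. cusum_time (l \<omega>) b) \<in> measurable M (count_space UNIV)"
proof -
  note borel_measurable_cusum[OF assms, measurable]
  have *: "{\<omega>\<in>space M. cusum_time (l \<omega>) b \<le> enat n} \<in> sets M" for n
  proof -
    have "{\<omega>\<in>space M. cusum_time (l \<omega>) b \<le> enat n}
        = (\<Union>t\<in>{1..n}. {\<omega>\<in>space M. b \<le> cusum (l \<omega>) t})"
      by (auto simp: cusum_time_le_iff)
    also have "\<dots> \<in> sets M" by measurable
    finally show ?thesis .
  qed
  show ?thesis
  proof (rule measurable_count_space_eq2_countable[THEN iffD2], intro conjI ballI)
    fix a :: enat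
    have sing: "{\<omega>\<in>space M. cusum_time (l \<omega>) b = a} \<in> sets M"
    proof (cases a)
      case (enat n)
      show ?thesis
      proof (cases n)
        case 0
        then have "{\<omega>\<in>space M. cusum_time (l \<omega>) b = a} = {\<omega>\<in>space M. cusum_time (l \<omega>) b \<le> enat 0}"
          using enat by (auto simp: zero_enat_def[symmetric])
        then show ?thesis using * by simp
      next
        case (Suc k)
        then have "{\<omega>\<in>space M. cusum_time (l \<omega>) b = a} =
          {\<omega>\<in>space M. cusum_time (l \<omega>) b \<le> enat (Suc k)} - {\<omega>\<in>space M. cusum_time (l \<omega>) b \<le> enat k}"
          using enat by (auto simp: not_le intro: antisym) (metis Suc_ile_eq antisym)
        then show ?thesis using * by simp
      qed
    next
      case infinity
      then have "{\<omega>\<in>space M. cusum_time (l \<omega>) b = a} =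
          space M - (\<Union>n. {\<omega>\<in>space M. cusum_time (l \<omega>) b \<le> enat n})"
        by auto (metis enat_ord_simps(4) less_imp_le not_enat_eq order_refl)
      then show ?thesis using * by simp
    qed
    have "(\<lambda>\<omega>. cusum_time (l \<omega>) b) -` {a} \<inter> space M = {\<omega>\<in>space M. cusum_time (l \<omega>) b = a}" by auto
    with sing show "(\<lambda>\<omega>. cusum_time (l \<omega>) b) -` {a} \<inter> space M \<in> sets M" by simp
  qed auto
qed

section \<open>Expected stopping times\<close>

lemma expected_time_mono:
  assumes "\<And>\<omega>. \<omega> \<in> space M \<Longrightarrow> S \<omega> \<le> T \<omega>"
  shows "expected_time M S \<le> expected_time M T"
proof -
  have "ennreal_of_enat a \<le> ennreal_of_enat b" if "a \<le> b" for a b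
    using that by simp
  then show ?thesis unfolding expected_time_def by (intro nn_integral_mono) (simp add: assms)
qed

lemma expected_time_eq_suminf:
  assumes "T \<in> measurable M (count_space UNIV)"
  shows "expected_time M T = (\<Sum>n. emeasure M {\<omega>\<in>space M. enat n < T \<omega>})"
  unfolding expected_time_def using nn_integral_enat_function[OF assms] by simp

text \<open>The expectation is the sum of the tail probabilities; grouped into blocks of \<open>N\<close> terms, this sum
  is dominated by \<open>N\<close> times a geometric series.\<close>

lemma expected_time_geometric_le:
  assumes "finite_measure M"
    and T: "T \<in> measurable M (count_space UNIV)" and q: "0 \<le> q" "q < 1" and N: "N > 0"
    and tail: "\<And>j. measure M {\<omega>\<in>space M. enat (j * N) < T \<omega>} \<le> q ^ j"
  shows "expected_time M T \<le> ennreal (real N / (1 - q))"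
proof -
  interpret finite_measure M by fact
  have sets[measurable]: "{\<omega>\<in>space M. enat n < T \<omega>} \<in> sets M" for n
    using T by measurable
  have tm: "emeasure M {\<omega>\<in>space M. enat n < T \<omega>} \<le> ennreal (q ^ (n div N))" for n
  proof -
    have "measure M {\<omega>\<in>space M. enat n < T \<omega>} \<le> measure M {\<omega>\<in>space M. enat (n div N * N) < T \<omega>}"
      by (intro finite_measure_mono sets)
        (auto intro: le_less_trans[of _ "enat n"] simp: div_times_less_eq_dividend)
    also note tail
    finally show ?thesis by (simp add: emeasure_eq_measure ennreal_leI)
  qed
  have "(\<lambda>n. q ^ (n div N)) sums (real N / (1 - q))"
  proof -
    have "(\<lambda>j. \<Sum>n=j*N..<j*N+N. q ^ (n div N)) = (\<lambda>j. real N * q ^ j)"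
    proof
      fix j
      have "(\<Sum>n=j*N..<j*N+N. q ^ (n div N)) = (\<Sum>n=j*N..<j*N+N. q ^ j)"
      proof (intro sum.cong refl)
        fix n assume "n \<in> {j*N..<j*N+N}"
        then have "n div N = j" using N by (intro div_nat_eqI) (auto simp: mult.commute)
        then show "q ^ (n div N) = q ^ j" by simp
      qed
      then show "(\<Sum>n=j*N..<j*N+N. q ^ (n div N)) = real N * q ^ j" by simp
    qed
    moreover have "(\<lambda>j. real N * q ^ j) sums (real N * (1 / (1 - q)))"
      using q by (intro sums_mult geometric_sums) auto
    ultimately have blocks: "(\<lambda>j. \<Sum>n=j*N..<j*N+N. q ^ (n div N)) sums (real N / (1 - q))"
      by simp
    have summ: "summable (\<lambda>n. q ^ (n div N))"
    proof (rule bounded_imp_summable)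
      fix n
      show "0 \<le> q ^ (n div N)" using q by simp
      have "(\<Sum>k\<le>n. q ^ (k div N)) \<le> (\<Sum>k<N * Suc n. q ^ (k div N))"
      proof (intro sum_mono2)
        have "n < N * Suc n" using N by (cases N) auto
        then show "{..n} \<subseteq> {..<N * Suc n}" by auto
      qed (use q in auto)
      also have "\<dots> = (\<Sum>j<Suc n. \<Sum>k=j*N..<j*N+N. q ^ (k div N))"
        by (simp only: sum.nat_group mult.commute)
      also have "\<dots> \<le> real N / (1 - q)"
        using blocks q by (subst sums_unique[OF blocks], intro sum_le_suminf)
          (auto intro!: sum_nonneg simp: sums_iff)
      finally show "(\<Sum>k\<le>n. q ^ (k div N)) \<le> real N / (1 - q)" .
    qed
    have "(\<lambda>j. \<Sum>n=j*N..<j*N+N. q ^ (n div N)) sums (\<Sum>n. q ^ (n div N))"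
      using sums_group[OF summable_sums[OF summ], of N] N by simp
    with blocks have "(\<Sum>n. q ^ (n div N)) = real N / (1 - q)" using sums_unique2 by blast
    with summ show ?thesis by (simp add: sums_iff)
  qed
  then have "(\<Sum>n. ennreal (q ^ (n div N))) = ennreal (real N / (1 - q))"
    using q by (intro suminf_ennreal_eq) auto
  moreover have "expected_time M T \<le> (\<Sum>n. ennreal (q ^ (n div N)))"
    unfolding expected_time_eq_suminf[OF T] by (intro suminf_le tm) auto
  ultimately show ?thesis by simp
qed

lemma expected_time_ge:
  assumes "prob_space M"
    and T: "T \<in> measurable M (count_space UNIV)"
    and early: "measure M {\<omega>\<in>space M. T \<omega> \<le> enat n} \<le> r"
  shows "ennreal (real n * (1 - r)) \<le> expected_time M T"
proof -
  interpret prob_space M by fact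
  have [measurable]: "{\<omega>\<in>space M. T \<omega> \<le> enat n} \<in> sets M"
    using T by measurable
  have "ennreal (real n * (1 - r)) \<le> (\<Sum>k<n. emeasure M {\<omega>\<in>space M. enat k < T \<omega>})"
  proof -
    have *: "ennreal (1 - r) \<le> emeasure M {\<omega>\<in>space M. enat k < T \<omega>}" if "k < n" for k
    proof -
      have [measurable]: "{\<omega>\<in>space M. enat k < T \<omega>} \<in> sets M"
        using T by measurable
      have "1 - r \<le> prob (space M - {\<omega>\<in>space M. T \<omega> \<le> enat n})"
        using early by (subst prob_compl) auto
      also have "\<dots> \<le> prob {\<omega>\<in>space M. enat k < T \<omega>}"
        using that by (intro finite_measure_mono) (auto simp: not_le intro: less_trans[of "enat k" "enat n"])
      finally show ?thesis by (simp add: emeasure_eq_measure ennreal_leI)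
    qed
    have "ennreal (real n * (1 - r)) = of_nat n * ennreal (1 - r)"
      by (simp add: ennreal_mult' ennreal_of_nat_eq_real_of_nat)
    also have "\<dots> = (\<Sum>k<n. ennreal (1 - r))" by simp
    also have "\<dots> \<le> (\<Sum>k<n. emeasure M {\<omega>\<in>space M. enat k < T \<omega>})"
      by (intro sum_mono *) auto
    finally show ?thesis .
  qed
  also have "\<dots> \<le> expected_time M T"
    unfolding expected_time_eq_suminf[OF T] by (intro sum_le_suminf) auto
  finally show ?thesis .
qed

section \<open>Gaussian vectors\<close>

text \<open>Everything is reduced to one-dimensional integrals. The spherical Gaussian density is written as
  a product over the coordinates, so that the coordinates are independent and a linear functional is a
  sum of independent normal variables.\<close>

definition gauss :: "real \<Rightarrow> real^'k \<Rightarrow> real"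
  where "gauss s y = (\<Prod>b\<in>Basis. normal_density 0 s (y \<bullet> b))"

lemma gauss_nonneg: "gauss s y \<ge> 0"
  unfolding gauss_def by (intro prod_nonneg) (auto intro: normal_density_nonneg)

lemma borel_measurable_gauss[measurable]: "gauss s \<in> borel_measurable borel"
  unfolding gauss_def by measurable

lemma norm_sq_eq_sum_Basis: "(norm (y::'a::euclidean_space))\<^sup>2 = (\<Sum>b\<in>Basis. (y \<bullet> b)\<^sup>2)"
  unfolding power2_norm_eq_inner by (subst euclidean_inner) (simp add: power2_eq_square)

lemma gauss_eq_exp:
  fixes y :: "real^'k"
  assumes "s > 0"
  shows "gauss s y = exp (- (norm y)\<^sup>2 / (2 * s\<^sup>2)) / sqrt ((2 * pi * s\<^sup>2) ^ CARD('k))"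
proof -
  have "gauss s y = (\<Prod>b\<in>(Basis::(real^'k) set). 1 / sqrt (2 * pi * s\<^sup>2)) *
      (\<Prod>b\<in>Basis. exp (- (y \<bullet> b)\<^sup>2 / (2 * s\<^sup>2)))"
    unfolding gauss_def normal_density_def by (subst prod.distrib[symmetric]) simp
  also have "(\<Prod>b\<in>Basis. exp (- (y \<bullet> b)\<^sup>2 / (2 * s\<^sup>2))) = exp (- (norm y)\<^sup>2 / (2 * s\<^sup>2))"
    by (simp add: norm_sq_eq_sum_Basis exp_sum[symmetric] sum_divide_distrib sum_negf)
  also have "(\<Prod>b\<in>(Basis::(real^'k) set). 1 / sqrt (2 * pi * s\<^sup>2)) = 1 / sqrt ((2 * pi * s\<^sup>2) ^ CARD('k))"
    by (simp add: real_sqrt_power power_one_over)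
  finally show ?thesis by simp
qed

lemma nn_integral_gauss_prod:
  fixes g :: "real^'k \<Rightarrow> real \<Rightarrow> real"
  assumes "s > 0" and [measurable]: "\<And>b. b \<in> Basis \<Longrightarrow> g b \<in> borel_measurable borel"
    and nn: "\<And>b x. b \<in> Basis \<Longrightarrow> 0 \<le> g b x"
  shows "(\<integral>\<^sup>+y. ennreal (gauss s y) * ennreal (\<Prod>b\<in>Basis. g b (y \<bullet> b)) \<partial>lborel)
    = (\<Prod>b\<in>(Basis::(real^'k) set). \<integral>\<^sup>+z. ennreal (normal_density 0 s z) * ennreal (g b z) \<partial>lborel)"
proof -
  have "(\<integral>\<^sup>+y. ennreal (gauss s y) * ennreal (\<Prod>b\<in>Basis. g b (y \<bullet> b)) \<partial>lborel)
      = (\<integral>\<^sup>+y. (\<Prod>b\<in>(Basis::(real^'k) set). ennreal (normal_density 0 s (y \<bullet> b) * g b (y \<bullet> b))) \<partial>lborel)"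
    by (intro nn_integral_cong)
      (simp add: gauss_def ennreal_mult'[symmetric] prod_nonneg prod.distrib[symmetric] prod_ennreal nn)
  also have "\<dots> = (\<Prod>b\<in>(Basis::(real^'k) set). \<integral>\<^sup>+z. (normal_density 0 s z * g b z) \<partial>lborel)"
    by (subst nn_integral_lborel_prod[where f="\<lambda>b z. ennreal (normal_density 0 s z * g b z)"]) (auto simp: nn)
  finally show ?thesis by (simp add: ennreal_mult' nn)
qed

definition gauss_measure :: "real \<Rightarrow> (real^'k) measure"
  where "gauss_measure s = density lborel (\<lambda>y. ennreal (gauss s y))"

lemma sets_gauss_measure[simp, measurable_cong]: "sets (gauss_measure s) = sets borel"
  and space_gauss_measure[simp]: "space (gauss_measure s) = UNIV"
  by (auto simp: gauss_measure_def)

lemma nn_integral_gauss_measure: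
  "f \<in> borel_measurable borel \<Longrightarrow>
    (\<integral>\<^sup>+y. f y \<partial>gauss_measure s) = (\<integral>\<^sup>+y. ennreal (gauss s y) * f y \<partial>lborel)"
  unfolding gauss_measure_def by (subst nn_integral_density) auto

lemma emeasure_normal_UNIV:
  "s > 0 \<Longrightarrow> (\<integral>\<^sup>+z. ennreal (normal_density m s z) \<partial>lborel) = 1"
  using prob_space.emeasure_space_1[OF prob_space_normal_density[of s m]]
  by (simp add: emeasure_density)

lemma prob_space_gauss_measure:
  assumes "s > 0" shows "prob_space (gauss_measure s :: (real^'k) measure)"
proof
  have "emeasure (gauss_measure s :: (real^'k) measure) UNIV = (\<integral>\<^sup>+y. 1 \<partial>(gauss_measure s :: (real^'k) measure))"
    by simp
  also have "\<dots> = 1"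
    using nn_integral_gauss_prod[OF assms, of "\<lambda>_ _. 1"] emeasure_normal_UNIV[OF assms, of 0]
    by (subst nn_integral_gauss_measure) auto
  finally show "emeasure (gauss_measure s :: (real^'k) measure) (space (gauss_measure s)) = 1" by simp
qed

lemma distributed_gauss_coordinate:
  fixes b :: "real^'k"
  assumes "s > 0" "b \<in> Basis"
  shows "distributed (gauss_measure s) lborel (\<lambda>y. y \<bullet> b) (normal_density 0 s)"
  unfolding distributed_def
proof (intro conjI measure_eqI)
  fix A assume "A \<in> sets (distr (gauss_measure s) lborel (\<lambda>y. y \<bullet> b))"
  then have A[measurable]: "A \<in> sets borel" by simp
  have "emeasure (distr (gauss_measure s) lborel (\<lambda>y. y \<bullet> b)) A
     = (\<integral>\<^sup>+y. indicator A (y \<bullet> b) \<partial>gauss_measure s)"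
    by (simp add: nn_integral_distr flip: nn_integral_indicator)
  also have "\<dots> = (\<integral>\<^sup>+y. ennreal (gauss s y) * ennreal (\<Prod>c\<in>Basis. (if c = b then indicator A (y \<bullet> c) else 1)) \<partial>lborel)"
    using assms by (subst nn_integral_gauss_measure) (auto intro!: nn_integral_cong simp: prod.If_cases ennreal_indicator)
  also have "\<dots> = (\<Prod>c\<in>(Basis::(real^'k) set). \<integral>\<^sup>+z. ennreal (normal_density 0 s z) * ennreal (if c = b then indicator A z else 1) \<partial>lborel)"
    using assms by (subst nn_integral_gauss_prod) auto
  also have "\<dots> = (\<Prod>c\<in>(Basis::(real^'k) set). if c = b then \<integral>\<^sup>+z. ennreal (normal_density 0 s z) * indicator A z \<partial>lborel else 1)"
    using assms by (intro prod.cong) (auto simp: emeasure_normal_UNIV ennreal_indicator)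
  also have "\<dots> = emeasure (density lborel (normal_density 0 s)) A"
    using assms by (simp add: emeasure_density)
  finally show "emeasure (distr (gauss_measure s) lborel (\<lambda>y. y \<bullet> b)) A = emeasure (density lborel (normal_density 0 s)) A" .
qed auto

lemma indep_vars_gauss_coordinates:
  assumes s: "s > 0"
  shows "prob_space.indep_vars (gauss_measure s :: (real^'k) measure) (\<lambda>_. borel) (\<lambda>b y. y \<bullet> b) Basis"
proof -
  interpret prob_space "gauss_measure s :: (real^'k) measure" by (rule prob_space_gauss_measure[OF s])
  show ?thesis
  proof (subst indep_vars_finite[where E="\<lambda>_. sets borel"])
    show "\<forall>A\<in>(\<Pi> i\<in>(Basis::(real^'k) set). sets borel).
       prob (\<Inter>j\<in>(Basis::(real^'k) set). (\<lambda>y. y \<bullet> j) -` A j \<inter> space (gauss_measure s)) =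
       (\<Prod>j\<in>(Basis::(real^'k) set). prob ((\<lambda>y. y \<bullet> j) -` A j \<inter> space (gauss_measure s)))"
    proof
      fix A assume "A \<in> (\<Pi> i\<in>(Basis::(real^'k) set). sets (borel::real measure))"
      then have A[measurable]: "\<And>b. b \<in> Basis \<Longrightarrow> A b \<in> sets borel" by auto
      have marg: "emeasure (gauss_measure s) ((\<lambda>y. y \<bullet> b) -` A b)
          = (\<integral>\<^sup>+z. ennreal (normal_density 0 s z) * ennreal (indicator (A b) z) \<partial>lborel)" if "b \<in> Basis" for b :: "real^'k"
        using distributed_emeasure[OF distributed_gauss_coordinate[OF s that], of "A b"] that
        by (simp add: A ennreal_indicator)
      have "emeasure (gauss_measure s) (\<Inter>j\<in>(Basis::(real^'k) set). (\<lambda>y. y \<bullet> j) -` A j)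
        = (\<integral>\<^sup>+y. indicator (\<Inter>j\<in>(Basis::(real^'k) set). (\<lambda>y. y \<bullet> j) -` A j) y \<partial>gauss_measure s)"
        by (subst nn_integral_indicator) (auto intro!: sets.finite_INT measurable_sets_borel[OF _ A])
      also have "\<dots> = (\<integral>\<^sup>+y. ennreal (\<Prod>b\<in>(Basis::(real^'k) set). indicator (A b) (y \<bullet> b)) \<partial>gauss_measure s)"
        by (intro nn_integral_cong) (auto simp: indicator_def prod_ennreal[symmetric] split: if_splits)
      also have "\<dots> = (\<Prod>b\<in>(Basis::(real^'k) set). \<integral>\<^sup>+z. ennreal (normal_density 0 s z) * ennreal (indicator (A b) z) \<partial>lborel)"
        using s nn_integral_gauss_prod[OF s, of "\<lambda>b. indicator (A b)"]
        by (subst nn_integral_gauss_measure) auto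
      also have "\<dots> = (\<Prod>b\<in>(Basis::(real^'k) set). emeasure (gauss_measure s) ((\<lambda>y. y \<bullet> b) -` A b))"
        by (intro prod.cong refl) (simp add: marg)
      finally show "prob (\<Inter>j\<in>(Basis::(real^'k) set). (\<lambda>y. y \<bullet> j) -` A j \<inter> space (gauss_measure s)) =
         (\<Prod>j\<in>(Basis::(real^'k) set). prob ((\<lambda>y. y \<bullet> j) -` A j \<inter> space (gauss_measure s)))"
        by (simp add: emeasure_eq_measure prod_ennreal prod_nonneg)
    qed
  qed (auto simp: Int_stable_def sets.sigma_sets_eq[of borel, simplified] sets.space_closed)
qed

text \<open>Rotation invariance enters the whole proof only in this form: the law of a projection is the same
  for all unit vectors. Coordinates with coefficient zero are left out of the sum because a normal law
  has a positive standard deviation.\<close>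

lemma distributed_gauss_inner:
  fixes v :: "real^'k"
  assumes s: "s > 0" and v: "norm v = 1"
  shows "distributed (gauss_measure s) lborel (\<lambda>y. v \<bullet> y) (normal_density 0 s)"
proof -
  interpret prob_space "gauss_measure s :: (real^'k) measure" by (rule prob_space_gauss_measure[OF s])
  define J where "J = {b\<in>(Basis::(real^'k) set). v \<bullet> b \<noteq> 0}"
  have J: "finite J" "J \<subseteq> Basis" by (auto simp: J_def)
  have "J \<noteq> {}"
    using v euclidean_all_zero_iff[of v] by (auto simp: J_def)
  have inner: "v \<bullet> y = (\<Sum>b\<in>J. (v \<bullet> b) * (y \<bullet> b))" for y
    unfolding euclidean_inner[of v y] J_def by (intro sum.mono_neutral_right) auto
  have one: "(\<Sum>b\<in>J. (\<bar>v \<bullet> b\<bar> * s)\<^sup>2) = s\<^sup>2"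
  proof -
    have "(\<Sum>b\<in>J. (\<bar>v \<bullet> b\<bar> * s)\<^sup>2) = s\<^sup>2 * (\<Sum>b\<in>J. (v \<bullet> b)\<^sup>2)"
      by (simp add: power_mult_distrib sum_distrib_left mult.commute)
    also have "(\<Sum>b\<in>J. (v \<bullet> b)\<^sup>2) = 1"
      using inner[of v] v by (simp add: power2_eq_square norm_eq_1)
    finally show ?thesis by simp
  qed
  have "distributed (gauss_measure s) lborel (\<lambda>y. \<Sum>b\<in>J. (v \<bullet> b) * (y \<bullet> b))
     (normal_density (\<Sum>b\<in>J. 0) (sqrt (\<Sum>b\<in>J. (\<bar>v \<bullet> b\<bar> * s)\<^sup>2)))"
  proof (rule sum_indep_normal)
    show "indep_vars (\<lambda>_. borel) (\<lambda>b y. (v \<bullet> b) * (y \<bullet> b)) J"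
      by (rule indep_vars_compose2[OF indep_vars_subset[OF indep_vars_gauss_coordinates[OF s] J(2)]]) auto
    fix b assume b: "b \<in> J"
    then show "0 < \<bar>v \<bullet> b\<bar> * s" using s by (simp add: J_def)
    show "distributed (gauss_measure s) lborel (\<lambda>y. (v \<bullet> b) * (y \<bullet> b)) (normal_density 0 (\<bar>v \<bullet> b\<bar> * s))"
      using normal_density_affine[OF distributed_gauss_coordinate[OF s, of b] s, of "v \<bullet> b" 0] b J
      by (auto simp: J_def)
  qed (use J \<open>J \<noteq> {}\<close> in auto)
  then show ?thesis using s by (simp add: inner[symmetric] one)
qed

text \<open>The integrand is a multiple of the normal density with variance \<open>s\<^sup>2 / (1 - 2 * l * s\<^sup>2)\<close>.\<close>

lemma nn_integral_normal_exp_sq: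
  assumes s: "s > 0" and l: "2 * l * s\<^sup>2 < 1"
  shows "(\<integral>\<^sup>+z. ennreal (normal_density 0 s z) * ennreal (exp (l * z\<^sup>2)) \<partial>lborel)
    = ennreal (1 / sqrt (1 - 2 * l * s\<^sup>2))"
proof -
  define c where "c = 1 - 2 * l * s\<^sup>2"
  have c: "c > 0" using l by (simp add: c_def)
  define s' where "s' = s / sqrt c"
  have s': "s' > 0" using s c by (simp add: s'_def)
  have sq: "s'\<^sup>2 = s\<^sup>2 / c" using c by (simp add: s'_def power_divide)
  have "normal_density 0 s z * exp (l * z\<^sup>2) = 1 / sqrt c * normal_density 0 s' z" for z
  proof -
    have e: "- z\<^sup>2 / (2 * s\<^sup>2) + l * z\<^sup>2 = - z\<^sup>2 / (2 * s'\<^sup>2)"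
    proof -
      have "- z\<^sup>2 / (2 * s'\<^sup>2) = - z\<^sup>2 * c / (2 * s\<^sup>2)" unfolding sq by simp
      also have "\<dots> = - z\<^sup>2 / (2 * s\<^sup>2) + l * z\<^sup>2" using s by (simp add: c_def field_simps)
      finally show ?thesis by (rule sym)
    qed
    have "sqrt (2 * pi * s'\<^sup>2) = sqrt (2 * pi * s\<^sup>2) / sqrt c"
      unfolding sq by (simp add: real_sqrt_divide)
    then have "1 / sqrt c * normal_density 0 s' z = 1 / sqrt (2 * pi * s\<^sup>2) * exp (- z\<^sup>2 / (2 * s'\<^sup>2))"
      using c by (simp add: normal_density_def)
    also have "exp (- z\<^sup>2 / (2 * s'\<^sup>2)) = exp (- z\<^sup>2 / (2 * s\<^sup>2)) * exp (l * z\<^sup>2)"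
      by (subst e[symmetric]) (rule exp_add)
    finally show ?thesis by (simp add: normal_density_def)
  qed
  then have "(\<integral>\<^sup>+z. ennreal (normal_density 0 s z) * ennreal (exp (l * z\<^sup>2)) \<partial>lborel)
    = (\<integral>\<^sup>+z. ennreal (1 / sqrt c) * ennreal (normal_density 0 s' z) \<partial>lborel)"
    using c by (intro nn_integral_cong) (simp add: ennreal_mult'[symmetric])
  also have "\<dots> = ennreal (1 / sqrt c)"
    using emeasure_normal_UNIV[OF s', of 0] by (simp add: nn_integral_cmult)
  finally show ?thesis by (simp add: c_def)
qed

lemma nn_integral_gauss_inner:
  fixes v :: "real^'k"
  assumes "s > 0" "norm v = 1" and [measurable]: "g \<in> borel_measurable borel"
  shows "(\<integral>\<^sup>+y. g (v \<bullet> y) \<partial>gauss_measure s) = (\<integral>\<^sup>+z. ennreal (normal_density 0 s z) * g z \<partial>lborel)"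
  using distributed_nn_integral[OF distributed_gauss_inner[OF assms(1,2)], of g] by simp

section \<open>Densities before and after the change\<close>

lemma outer_mult_vec: "outer a b *v y = (b \<bullet> y) *\<^sub>R a"
  by (simp add: vec_eq_iff outer_def matrix_vector_mult_def inner_vec_def sum_distrib_right sum_distrib_left
      mult_ac)

lemma mat_mult_vec: "mat c *v y = (c::real) *\<^sub>R y"
  by (simp add: vec_eq_iff mat_def matrix_vector_mult_def if_distrib if_distribR sum.delta cong: if_cong)

text \<open>This is the Sherman-Morrison formula. Instead of multiplying matrices one solves the linear system
  for the rank-one perturbation explicitly, which also shows that it is injective and hence invertible.\<close>

lemma spiked_quadratic_form:
  fixes u y :: "real^'k"
  assumes c: "c > 0" and \<theta>: "\<theta> \<ge> 0" and u: "norm u = 1"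
  shows "y \<bullet> (matrix_inv (mat c + \<theta> *\<^sub>R outer u u) *v y)
    = (norm y)\<^sup>2 / c - \<theta> / (c * (c + \<theta>)) * (u \<bullet> y)\<^sup>2"
proof -
  define S where "S = mat c + \<theta> *\<^sub>R outer u u"
  have S: "S *v z = c *\<^sub>R z + (\<theta> * (u \<bullet> z)) *\<^sub>R u" for z
    by (simp add: S_def matrix_vector_mult_add_rdistrib mat_mult_vec outer_mult_vec
        scaleR_matrix_vector_assoc[symmetric])
  have uu: "u \<bullet> u = 1" using u by (simp add: norm_eq_1)
  have uS: "u \<bullet> (S *v z) = (c + \<theta>) * (u \<bullet> z)" for z
    by (simp add: S inner_add_right uu algebra_simps)
  have inv: "z = (1 / c) *\<^sub>R (y' - (\<theta> * (u \<bullet> y') / (c + \<theta>)) *\<^sub>R u)" if "S *v z = y'" for z y'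
  proof -
    have "u \<bullet> z = u \<bullet> y' / (c + \<theta>)" using uS[of z] that c \<theta> by (simp add: field_simps)
    then have "c *\<^sub>R z = y' - (\<theta> * (u \<bullet> y') / (c + \<theta>)) *\<^sub>R u"
      using S[of z] that by (simp add: algebra_simps)
    then have "(1 / c) *\<^sub>R (c *\<^sub>R z) = (1 / c) *\<^sub>R (y' - (\<theta> * (u \<bullet> y') / (c + \<theta>)) *\<^sub>R u)" by simp
    then show ?thesis using c by simp
  qed
  have "inj ((*v) S)" using inv by (metis injI)
  then have "invertible S"
    unfolding invertible_left_inverse matrix_left_invertible_injective by simp
  then have "S ** matrix_inv S = mat 1"
    unfolding invertible_def matrix_inv_def by (rule someI2_ex) simp
  then have "S *v (matrix_inv S *v y) = y" by (simp add: matrix_vector_mul_assoc)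
  from inv[OF this] have "y \<bullet> (matrix_inv S *v y) = (1 / c) * (y \<bullet> y - (\<theta> * (u \<bullet> y) / (c + \<theta>)) * (y \<bullet> u))"
    by (metis inner_diff_right inner_scaleR_right)
  also have "\<dots> = (norm y)\<^sup>2 / c - \<theta> / (c * (c + \<theta>)) * (u \<bullet> y)\<^sup>2"
    unfolding power2_norm_eq_inner inner_commute[of y u]
    using c \<theta> by (simp add: right_diff_distrib power2_eq_square)
  finally show ?thesis by (simp add: S_def)
qed

lemma f_inf_eq_gauss:
  fixes y :: "real^'k"
  assumes "s > 0" "s\<^sup>2 = \<sigma>\<^sup>2"
  shows "f_inf \<sigma> y = gauss s y"
proof -
  obtain e :: "real^'k" where e: "norm e = 1" using vector_choose_size[of 1] by auto
  have [simp]: "\<sigma> \<noteq> 0" using assms by auto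
  have "y \<bullet> (matrix_inv (mat (\<sigma>\<^sup>2)) *v y) = (norm y)\<^sup>2 / \<sigma>\<^sup>2"
    using spiked_quadratic_form[of "\<sigma>\<^sup>2" 0 e y] e by simp
  moreover have "det (mat (\<sigma>\<^sup>2) :: real^'k^'k) = (\<sigma>\<^sup>2) ^ CARD('k)"
    by (subst det_diagonal) (auto simp: mat_def)
  ultimately show ?thesis
    unfolding f_inf_def mvn_density_def gauss_eq_exp[OF assms(1)] assms(2)
    by (simp add: power_mult_distrib)
qed

text \<open>The constant collects the determinant of the covariance matrix and is left unspecified here; it is
  determined later by normalisation.\<close>

lemma f_zero_proportional:
  fixes y u :: "real^'k"
  assumes "s > 0" "s\<^sup>2 = \<sigma>\<^sup>2" "\<theta> > 0" "norm u = 1"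
  shows "\<exists>K. \<forall>y. f_zero \<sigma> \<theta> u y = K * (gauss s y * exp (\<theta> / (2 * s\<^sup>2 * (s\<^sup>2 + \<theta>)) * (u \<bullet> y)\<^sup>2))"
proof -
  define D where "D = sqrt ((2 * pi) ^ CARD('k) * det (mat (\<sigma>\<^sup>2) + \<theta> *\<^sub>R outer u u))"
  define G where "G = sqrt ((2 * pi * s\<^sup>2) ^ CARD('k))"
  have "s\<^sup>2 > 0" using assms(1) by simp
  then have G: "G > 0" unfolding G_def by (intro real_sqrt_gt_zero zero_less_power mult_pos_pos) (use assms(1) in auto)
  show ?thesis
  proof (intro exI[of _ "G / D"] allI)
    fix y :: "real^'k"
    have "f_zero \<sigma> \<theta> u y = exp (- ((norm y)\<^sup>2 / s\<^sup>2 - \<theta> / (s\<^sup>2 * (s\<^sup>2 + \<theta>)) * (u \<bullet> y)\<^sup>2) / 2) / D"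
      using spiked_quadratic_form[of "s\<^sup>2" \<theta> u y] assms(1,3,4)
      unfolding f_zero_def mvn_density_def D_def assms(2)[symmetric] by (simp only: zero_less_power less_imp_le)
    also have "\<dots> = G / D * (gauss s y * exp (\<theta> / (2 * s\<^sup>2 * (s\<^sup>2 + \<theta>)) * (u \<bullet> y)\<^sup>2))"
      using G unfolding gauss_eq_exp[OF assms(1)] G_def[symmetric]
      by (simp add: exp_add[symmetric] algebra_simps add_divide_distrib diff_divide_distrib)
    finally show "f_zero \<sigma> \<theta> u y = G / D * (gauss s y * exp (\<theta> / (2 * s\<^sup>2 * (s\<^sup>2 + \<theta>)) * (u \<bullet> y)\<^sup>2))" .
  qed
qed

text \<open>The density of the normal law with covariance matrix \<open>s\<^sup>2 * (I + \<rho> * u * u\<^sup>T)\<close>, written as an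
  exponential tilt of the spherical one so that the likelihood ratio can be read off.\<close>

definition spiked :: "real \<Rightarrow> real \<Rightarrow> real^'k \<Rightarrow> real^'k \<Rightarrow> real"
  where "spiked s \<rho> u y = gauss s y * (exp (\<rho> / (2 * s\<^sup>2 * (1 + \<rho>)) * (u \<bullet> y)\<^sup>2) / sqrt (1 + \<rho>))"

lemma spiked_nonneg: "\<rho> > 0 \<Longrightarrow> spiked s \<rho> u y \<ge> 0"
  unfolding spiked_def by (intro mult_nonneg_nonneg gauss_nonneg) auto

lemma borel_measurable_spiked[measurable]: "spiked s \<rho> u \<in> borel_measurable borel"
  unfolding spiked_def by measurable

lemma nn_integral_spiked:
  fixes u :: "real^'k"
  assumes s: "s > 0" and \<rho>: "\<rho> > 0" and u: "norm u = 1"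
  shows "(\<integral>\<^sup>+y. ennreal (spiked s \<rho> u y) \<partial>lborel) = 1"
proof -
  define l where "l = \<rho> / (2 * s\<^sup>2 * (1 + \<rho>))"
  have "1 + \<rho> \<noteq> 0" using \<rho> by simp
  then have "2 * l * s\<^sup>2 = \<rho> / (1 + \<rho>)" using s by (simp add: l_def)
  with \<open>1 + \<rho> \<noteq> 0\<close> have l: "1 - 2 * l * s\<^sup>2 = 1 / (1 + \<rho>)" by (simp add: field_simps)
  have "(\<integral>\<^sup>+y. ennreal (spiked s \<rho> u y) \<partial>lborel)
     = (\<integral>\<^sup>+y. ennreal (exp (l * (u \<bullet> y)\<^sup>2) / sqrt (1 + \<rho>)) \<partial>gauss_measure s)"
    using \<rho> by (subst nn_integral_gauss_measure)
      (auto simp: spiked_def l_def[symmetric] ennreal_mult' gauss_nonneg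
        simp del: times_divide_eq_right intro!: nn_integral_cong)
  also have "\<dots> = (\<integral>\<^sup>+z. ennreal (normal_density 0 s z) * ennreal (exp (l * z\<^sup>2) / sqrt (1 + \<rho>)) \<partial>lborel)"
    by (rule nn_integral_gauss_inner[OF s u]) measurable
  also have "\<dots> = (\<integral>\<^sup>+z. ennreal (1 / sqrt (1 + \<rho>)) * (ennreal (normal_density 0 s z) * ennreal (exp (l * z\<^sup>2))) \<partial>lborel)"
    using \<rho> by (intro nn_integral_cong) (simp add: ennreal_mult'[symmetric])
  also have "\<dots> = ennreal (1 / sqrt (1 + \<rho>)) * ennreal (1 / sqrt (1 / (1 + \<rho>)))"
  proof -
    have "2 * l * s\<^sup>2 < 1" using l \<rho> by (smt (verit) divide_pos_pos)
    from nn_integral_normal_exp_sq[OF s this] show ?thesis by (simp add: nn_integral_cmult l)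
  qed
  also have "\<dots> = 1"
    using \<rho> by (simp add: ennreal_mult'[symmetric] real_sqrt_divide)
  finally show ?thesis .
qed

text \<open>Both sides are multiples of the same function, and both have total mass one.\<close>

lemma f_zero_eq_spiked:
  fixes u :: "real^'k"
  assumes s: "s > 0" "s\<^sup>2 = \<sigma>\<^sup>2" and \<theta>: "\<theta> > 0" and u: "norm u = 1" and \<rho>: "\<rho> = \<theta> / \<sigma>\<^sup>2"
    and one: "(\<integral>\<^sup>+y. ennreal (f_zero \<sigma> \<theta> u y) \<partial>lborel) = 1"
  shows "f_zero \<sigma> \<theta> u = spiked s \<rho> u"
proof
  fix y
  have [simp]: "\<rho> > 0" using \<theta> s by (simp add: \<rho> flip: s(2))
  then have [simp]: "1 + \<rho> \<noteq> 0" by linarith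
  have l: "\<theta> / (2 * s\<^sup>2 * (s\<^sup>2 + \<theta>)) = \<rho> / (2 * s\<^sup>2 * (1 + \<rho>))"
    using s \<theta> unfolding \<rho> s(2)[symmetric] by (simp add: field_simps)
  obtain K where K: "\<And>y. f_zero \<sigma> \<theta> u y = K * (gauss s y * exp (\<theta> / (2 * s\<^sup>2 * (s\<^sup>2 + \<theta>)) * (u \<bullet> y)\<^sup>2))"
    using f_zero_proportional[OF s \<theta> u] by auto
  have K': "f_zero \<sigma> \<theta> u y = (K * sqrt (1 + \<rho>)) * spiked s \<rho> u y" for y
    by (simp add: K spiked_def l add_pos_pos)
  have "1 = (\<integral>\<^sup>+y. ennreal (K * sqrt (1 + \<rho>)) * ennreal (spiked s \<rho> u y) \<partial>lborel)"
    by (subst one[symmetric]) (simp add: K' ennreal_mult'' spiked_nonneg)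
  also have "\<dots> = ennreal (K * sqrt (1 + \<rho>))"
    using nn_integral_spiked[OF s(1) _ u, of \<rho>] by (simp add: nn_integral_cmult)
  finally have "K * sqrt (1 + \<rho>) = 1"
    by (metis ennreal_eq_1)
  then show "f_zero \<sigma> \<theta> u y = spiked s \<rho> u y" by (simp add: K')
qed

lemma gauss_pos: "s > 0 \<Longrightarrow> gauss s y > 0"
  unfolding gauss_def by (intro prod_pos) (auto intro: normal_density_pos)

lemma llr_eq:
  assumes "s > 0" "\<rho> > 0"
  shows "ln (spiked s \<rho> u y / gauss s y) = \<rho> / (2 * s\<^sup>2 * (1 + \<rho>)) * (u \<bullet> y)\<^sup>2 - ln (1 + \<rho>) / 2"
  using gauss_pos[OF assms(1), of y] assms
  by (simp add: spiked_def ln_div ln_sqrt)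

section \<open>Moments after the change\<close>

lemma integral_gauss_inner_moments:
  fixes p :: "real^'k"
  assumes s: "s > 0"
  shows "(\<integral>\<^sup>+y. ennreal ((p \<bullet> y + c)\<^sup>2) \<partial>gauss_measure s) = ennreal (s\<^sup>2 * (norm p)\<^sup>2 + c\<^sup>2)"
    and "(\<integral>\<^sup>+y. ennreal ((p \<bullet> y) ^ 4) \<partial>gauss_measure s) = ennreal (3 * s ^ 4 * norm p ^ 4)"
proof -
  interpret prob_space "gauss_measure s :: (real^'k) measure" by (rule prob_space_gauss_measure[OF s])
  have "(\<integral>\<^sup>+y. ennreal ((p \<bullet> y + c)\<^sup>2) \<partial>gauss_measure s) = ennreal (s\<^sup>2 * (norm p)\<^sup>2 + c\<^sup>2) \<and>
    (\<integral>\<^sup>+y. ennreal ((p \<bullet> y) ^ 4) \<partial>gauss_measure s) = ennreal (3 * s ^ 4 * norm p ^ 4)"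
  proof (cases "p = 0")
    case True
    then show ?thesis using emeasure_space_1 by simp
  next
    case False
    define v where "v = p /\<^sub>R norm p"
    define r where "r = norm p"
    have v: "norm v = 1" and p: "p = r *\<^sub>R v" using False by (auto simp: v_def r_def)
    note m2 = normal_moment_even[OF s, of 0 1] and m4 = normal_moment_even[OF s, of 0 2]
      and m0 = normal_moment_even[OF s, of 0 0] and m1 = normal_moment_odd[OF s, of 0 0]
    have "has_bochner_integral lborel (\<lambda>z. r\<^sup>2 * (normal_density 0 s z * (z - 0) ^ (2 * 1))
        + (2 * r * c) * (normal_density 0 s z * (z - 0) ^ (2 * 0 + 1))
        + c\<^sup>2 * (normal_density 0 s z * (z - 0) ^ (2 * 0)))
      (r\<^sup>2 * (fact (2 * 1) / ((2 / s\<^sup>2)^1 * fact 1)) + (2 * r * c) * 0 + c\<^sup>2 * (fact (2 * 0) / ((2 / s\<^sup>2)^0 * fact 0)))"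
      by (intro has_bochner_integral_add has_bochner_integral_mult_right m2 m0 m1)
    then have b: "has_bochner_integral lborel (\<lambda>z. normal_density 0 s z * (r * z + c)\<^sup>2) (s\<^sup>2 * r\<^sup>2 + c\<^sup>2)"
      by (rule has_bochner_integral_cong[THEN iffD1, rotated -1])
        (use s in \<open>auto simp: power2_eq_square algebra_simps\<close>)
    have "(\<integral>\<^sup>+y. ennreal ((p \<bullet> y + c)\<^sup>2) \<partial>gauss_measure s)
       = (\<integral>\<^sup>+y. ennreal ((r * (v \<bullet> y) + c)\<^sup>2) \<partial>gauss_measure s)"
      by (simp add: p)
    also have "\<dots> = (\<integral>\<^sup>+z. ennreal (normal_density 0 s z) * ennreal ((r * z + c)\<^sup>2) \<partial>lborel)"
      by (rule nn_integral_gauss_inner[OF s v]) measurable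
    also have "\<dots> = (\<integral>\<^sup>+z. ennreal (normal_density 0 s z * (r * z + c)\<^sup>2) \<partial>lborel)"
      by (simp add: ennreal_mult')
    also have "\<dots> = ennreal (s\<^sup>2 * r\<^sup>2 + c\<^sup>2)"
      using b
      by (subst nn_integral_eq_integral) (auto simp: has_bochner_integral_iff)
    finally have 1: "(\<integral>\<^sup>+y. ennreal ((p \<bullet> y + c)\<^sup>2) \<partial>gauss_measure s) = ennreal (s\<^sup>2 * r\<^sup>2 + c\<^sup>2)" .
    have "has_bochner_integral lborel (\<lambda>z. r ^ 4 * (normal_density 0 s z * (z - 0) ^ (2 * 2)))
      (r ^ 4 * (fact (2 * 2) / ((2 / s\<^sup>2)^2 * fact 2)))"
      by (intro has_bochner_integral_mult_right m4)
    then have b: "has_bochner_integral lborel (\<lambda>z. normal_density 0 s z * (r * z) ^ 4) (3 * s ^ 4 * r ^ 4)"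
      by (rule has_bochner_integral_cong[THEN iffD1, rotated -1])
        (use s in \<open>auto simp: fact_numeral power_divide power_mult_distrib field_simps\<close>)
    have "(\<integral>\<^sup>+y. ennreal ((p \<bullet> y) ^ 4) \<partial>gauss_measure s)
       = (\<integral>\<^sup>+y. ennreal ((r * (v \<bullet> y)) ^ 4) \<partial>gauss_measure s)"
      by (simp add: p)
    also have "\<dots> = (\<integral>\<^sup>+z. ennreal (normal_density 0 s z) * ennreal ((r * z) ^ 4) \<partial>lborel)"
      by (rule nn_integral_gauss_inner[OF s v]) measurable
    also have "\<dots> = (\<integral>\<^sup>+z. ennreal (normal_density 0 s z * (r * z) ^ 4) \<partial>lborel)"
      by (simp add: ennreal_mult')
    also have "\<dots> = ennreal (3 * s ^ 4 * r ^ 4)"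
      using b by (subst nn_integral_eq_integral) (auto simp: has_bochner_integral_iff)
    finally show ?thesis using 1 by (simp add: r_def)
  qed
  then show "(\<integral>\<^sup>+y. ennreal ((p \<bullet> y + c)\<^sup>2) \<partial>gauss_measure s) = ennreal (s\<^sup>2 * (norm p)\<^sup>2 + c\<^sup>2)"
    and "(\<integral>\<^sup>+y. ennreal ((p \<bullet> y) ^ 4) \<partial>gauss_measure s) = ennreal (3 * s ^ 4 * norm p ^ 4)"
    by blast+
qed

text \<open>Completing the square in the Gaussian coefficient \<open>g\<close> of the signal direction.\<close>

lemma spiked_mixture_pointwise:
  fixes u y :: "real^'k"
  assumes s: "s > 0" and \<rho>: "\<rho> > 0" and u: "norm u = 1"
  shows "gauss s (y - g *\<^sub>R u) * normal_density 0 (s * sqrt \<rho>) g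
    = spiked s \<rho> u y * normal_density (\<rho> / (1 + \<rho>) * (u \<bullet> y)) (s * sqrt (\<rho> / (1 + \<rho>))) g"
proof -
  define t where "t = u \<bullet> y"
  define N where "N = (norm y)\<^sup>2"
  have q: "1 + \<rho> \<noteq> 0" using \<rho> by simp
  have nrm: "(norm (y - g *\<^sub>R u))\<^sup>2 = N - 2 * g * t + g\<^sup>2"
    using u unfolding N_def t_def power2_norm_eq_inner norm_eq_1
    by (simp add: inner_diff_left inner_diff_right inner_commute[of y u] power2_eq_square algebra_simps)
  have e: "- (N - 2 * g * t + g\<^sup>2) / (2 * s\<^sup>2) + - g\<^sup>2 / (2 * (s\<^sup>2 * \<rho>))
    = - N / (2 * s\<^sup>2) + \<rho> / (2 * s\<^sup>2 * (1 + \<rho>)) * t\<^sup>2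
      + - (g - \<rho> / (1 + \<rho>) * t)\<^sup>2 / (2 * (s\<^sup>2 * (\<rho> / (1 + \<rho>))))"
  proof -
    define r where "r = 1 + \<rho>"
    have r: "r \<noteq> 0" "\<rho> \<noteq> 0" "s \<noteq> 0" "\<rho> = r - 1" using q s \<rho> by (auto simp: r_def)
    show ?thesis
      unfolding r_def[symmetric] using r(1-3)
      by (simp add: divide_simps) (unfold r(4), algebra)
  qed
  have c: "sqrt (2 * pi * (s\<^sup>2 * \<rho>)) = sqrt (1 + \<rho>) * sqrt (2 * pi * (s\<^sup>2 * (\<rho> / (1 + \<rho>))))"
    using q by (subst real_sqrt_mult[symmetric]) simp
  define G where "G = sqrt ((2 * pi * s\<^sup>2) ^ CARD('k))"
  have "gauss s (y - g *\<^sub>R u) * normal_density 0 (s * sqrt \<rho>) g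
     = exp (- (N - 2 * g * t + g\<^sup>2) / (2 * s\<^sup>2) + - g\<^sup>2 / (2 * (s\<^sup>2 * \<rho>))) / G / sqrt (2 * pi * (s\<^sup>2 * \<rho>))"
    using \<rho> unfolding gauss_eq_exp[OF s] nrm G_def[symmetric] exp_add
    by (simp add: normal_density_def power_mult_distrib)
  also have "\<dots> = exp (- N / (2 * s\<^sup>2)) * exp (\<rho> / (2 * s\<^sup>2 * (1 + \<rho>)) * t\<^sup>2)
      * exp (- (g - \<rho> / (1 + \<rho>) * t)\<^sup>2 / (2 * (s\<^sup>2 * (\<rho> / (1 + \<rho>)))))
      / G / (sqrt (1 + \<rho>) * sqrt (2 * pi * (s\<^sup>2 * (\<rho> / (1 + \<rho>)))))"
    unfolding e c exp_add ..
  also have "\<dots> = spiked s \<rho> u y * normal_density (\<rho> / (1 + \<rho>) * t) (s * sqrt (\<rho> / (1 + \<rho>))) g"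
    using \<rho> unfolding spiked_def gauss_eq_exp[OF s] normal_density_def N_def[symmetric] t_def[symmetric] G_def[symmetric]
    by (simp add: power_mult_distrib)
  finally show ?thesis by (simp add: t_def)
qed

text \<open>After the change an observation is a pure noise vector plus an independent Gaussian multiple of
  the signal direction. Moments of arbitrary projections after the change thus reduce to moments of
  projections of a spherical vector.\<close>

lemma nn_integral_spiked_mixture:
  fixes u :: "real^'k"
  assumes s: "s > 0" and \<rho>: "\<rho> > 0" and u: "norm u = 1"
    and [measurable]: "h \<in> borel_measurable borel"
  shows "(\<integral>\<^sup>+y. ennreal (spiked s \<rho> u y) * h y \<partial>lborel)
    = (\<integral>\<^sup>+g. ennreal (normal_density 0 (s * sqrt \<rho>) g) * (\<integral>\<^sup>+z. h (z + g *\<^sub>R u) \<partial>gauss_measure s) \<partial>lborel)"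
proof -
  have pos: "s * sqrt (\<rho> / (1 + \<rho>)) > 0" using s \<rho> by simp
  have "(\<integral>\<^sup>+y. ennreal (spiked s \<rho> u y) * h y \<partial>lborel)
    = (\<integral>\<^sup>+y. \<integral>\<^sup>+g. ennreal (spiked s \<rho> u y) * h y *
        ennreal (normal_density (\<rho> / (1 + \<rho>) * (u \<bullet> y)) (s * sqrt (\<rho> / (1 + \<rho>))) g) \<partial>lborel \<partial>lborel)"
    by (intro nn_integral_cong) (simp add: nn_integral_cmult emeasure_normal_UNIV[OF pos])
  also have "\<dots> = (\<integral>\<^sup>+y. \<integral>\<^sup>+g. ennreal (normal_density 0 (s * sqrt \<rho>) g) *
        (ennreal (gauss s (y - g *\<^sub>R u)) * h y) \<partial>lborel \<partial>lborel)"
  proof (intro nn_integral_cong)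
    fix y :: "real^'k" and g
    have "ennreal (spiked s \<rho> u y) * ennreal (normal_density (\<rho> / (1 + \<rho>) * (u \<bullet> y)) (s * sqrt (\<rho> / (1 + \<rho>))) g)
       = ennreal (gauss s (y - g *\<^sub>R u)) * ennreal (normal_density 0 (s * sqrt \<rho>) g)"
      using spiked_mixture_pointwise[OF s \<rho> u, of y g]
      by (simp add: ennreal_mult'[symmetric] spiked_nonneg[OF \<rho>] gauss_nonneg)
    then show "ennreal (spiked s \<rho> u y) * h y *
        ennreal (normal_density (\<rho> / (1 + \<rho>) * (u \<bullet> y)) (s * sqrt (\<rho> / (1 + \<rho>))) g)
      = ennreal (normal_density 0 (s * sqrt \<rho>) g) * (ennreal (gauss s (y - g *\<^sub>R u)) * h y)"
      by (metis mult.assoc mult.commute)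
  qed
  also have "\<dots> = (\<integral>\<^sup>+g. \<integral>\<^sup>+y. ennreal (normal_density 0 (s * sqrt \<rho>) g) *
        (ennreal (gauss s (y - g *\<^sub>R u)) * h y) \<partial>lborel \<partial>lborel)"
    by (rule lborel_pair.Fubini') measurable
  also have "\<dots> = (\<integral>\<^sup>+g. ennreal (normal_density 0 (s * sqrt \<rho>) g) * (\<integral>\<^sup>+z. h (z + g *\<^sub>R u) \<partial>gauss_measure s) \<partial>lborel)"
  proof (intro nn_integral_cong)
    fix g
    have "(\<integral>\<^sup>+y. ennreal (gauss s (y - g *\<^sub>R u)) * h y \<partial>lborel)
       = (\<integral>\<^sup>+y. ennreal (gauss s (y - g *\<^sub>R u)) * h y \<partial>distr lborel borel ((+) (g *\<^sub>R u)))"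
      by (simp only: lborel_distr_plus)
    also have "\<dots> = (\<integral>\<^sup>+z. ennreal (gauss s z) * h (z + g *\<^sub>R u) \<partial>lborel)"
      by (subst nn_integral_distr) (auto simp: add.commute)
    also have "\<dots> = (\<integral>\<^sup>+z. h (z + g *\<^sub>R u) \<partial>gauss_measure s)"
      by (subst nn_integral_gauss_measure) auto
    finally show "(\<integral>\<^sup>+y. ennreal (normal_density 0 (s * sqrt \<rho>) g) * (ennreal (gauss s (y - g *\<^sub>R u)) * h y) \<partial>lborel)
      = ennreal (normal_density 0 (s * sqrt \<rho>) g) * (\<integral>\<^sup>+z. h (z + g *\<^sub>R u) \<partial>gauss_measure s)"
      by (subst nn_integral_cmult) auto
  qed
  finally show ?thesis .
qed

lemma nn_integral_spiked_inner_moments: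
  fixes u p :: "real^'k"
  assumes s: "s > 0" and \<rho>: "\<rho> > 0" and u: "norm u = 1"
  shows "(\<integral>\<^sup>+y. ennreal (spiked s \<rho> u y) * ennreal ((p \<bullet> y)\<^sup>2) \<partial>lborel)
      = ennreal (s\<^sup>2 * ((norm p)\<^sup>2 + \<rho> * (p \<bullet> u)\<^sup>2))" (is ?second)
    and "(\<integral>\<^sup>+y. ennreal (spiked s \<rho> u y) * ennreal ((p \<bullet> y) ^ 4) \<partial>lborel) < \<infinity>" (is ?fourth)
proof -
  have s': "s * sqrt \<rho> > 0" using s \<rho> by simp
  note m2 = normal_moment_even[OF s', of 0 1] and m4 = normal_moment_even[OF s', of 0 2]
    and m0 = normal_moment_even[OF s', of 0 0]
  define A where "A = s\<^sup>2 * (norm p)\<^sup>2"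
  define B where "B = (p \<bullet> u)\<^sup>2"
  have AB: "A \<ge> 0" "B \<ge> 0" by (auto simp: A_def B_def)
  have "(\<integral>\<^sup>+y. ennreal (spiked s \<rho> u y) * ennreal ((p \<bullet> y)\<^sup>2) \<partial>lborel)
     = (\<integral>\<^sup>+g. ennreal (normal_density 0 (s * sqrt \<rho>) g) * ennreal (A + B * g\<^sup>2) \<partial>lborel)"
    using integral_gauss_inner_moments(1)[OF s, of p]
    by (subst nn_integral_spiked_mixture[OF s \<rho> u])
      (auto simp: inner_add_right A_def B_def power_mult_distrib mult.commute)
  also have "\<dots> = (\<integral>\<^sup>+g. ennreal (normal_density 0 (s * sqrt \<rho>) g * (A + B * g\<^sup>2)) \<partial>lborel)"
    by (intro nn_integral_cong) (simp add: ennreal_mult')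
  also have "\<dots> = ennreal (A + B * (s\<^sup>2 * \<rho>))"
  proof -
    have "has_bochner_integral lborel (\<lambda>z. A * (normal_density 0 (s * sqrt \<rho>) z * (z - 0) ^ (2 * 0))
        + B * (normal_density 0 (s * sqrt \<rho>) z * (z - 0) ^ (2 * 1)))
      (A * (fact (2 * 0) / ((2 / (s * sqrt \<rho>)\<^sup>2)^0 * fact 0)) + B * (fact (2 * 1) / ((2 / (s * sqrt \<rho>)\<^sup>2)^1 * fact 1)))"
      by (intro has_bochner_integral_add has_bochner_integral_mult_right m2 m0)
    then have "has_bochner_integral lborel (\<lambda>z. normal_density 0 (s * sqrt \<rho>) z * (A + B * z\<^sup>2)) (A + B * (s\<^sup>2 * \<rho>))"
      by (rule has_bochner_integral_cong[THEN iffD1, rotated -1])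
        (use \<rho> in \<open>auto simp: power2_eq_square algebra_simps\<close>)
    then show ?thesis using AB by (subst nn_integral_eq_integral) (auto simp: has_bochner_integral_iff)
  qed
  finally show ?second by (simp add: A_def B_def algebra_simps)
  define C where "C = 24 * s ^ 4 * norm p ^ 4"
  define D where "D = 8 * (p \<bullet> u) ^ 4"
  have CD: "C \<ge> 0" "D \<ge> 0" using s by (auto simp: C_def D_def)
  have four: "(a + b) ^ 4 \<le> 8 * a ^ 4 + 8 * b ^ 4" for a b :: real
  proof -
    have "8 * a ^ 4 + 8 * b ^ 4 - (a + b) ^ 4 = (a - b)\<^sup>2 * (7 * a\<^sup>2 + 10 * a * b + 7 * b\<^sup>2)"
      by algebra
    moreover have "7 * a\<^sup>2 + 10 * a * b + 7 * b\<^sup>2 = 5 * (a + b)\<^sup>2 + 2 * a\<^sup>2 + 2 * b\<^sup>2"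
      by algebra
    ultimately show ?thesis
      by (smt (verit) zero_le_power2 mult_nonneg_nonneg)
  qed
  have "(\<integral>\<^sup>+y. ennreal (spiked s \<rho> u y) * ennreal ((p \<bullet> y) ^ 4) \<partial>lborel)
     = (\<integral>\<^sup>+g. ennreal (normal_density 0 (s * sqrt \<rho>) g) * (\<integral>\<^sup>+z. ennreal ((p \<bullet> (z + g *\<^sub>R u)) ^ 4) \<partial>gauss_measure s) \<partial>lborel)"
    by (subst nn_integral_spiked_mixture[OF s \<rho> u]) auto
  also have "\<dots> \<le> (\<integral>\<^sup>+g. ennreal (normal_density 0 (s * sqrt \<rho>) g) * ennreal (C + D * g ^ 4) \<partial>lborel)"
  proof (intro nn_integral_mono mult_left_mono)
    fix g
    interpret prob_space "gauss_measure s :: (real^'k) measure" by (rule prob_space_gauss_measure[OF s])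
    have "(\<integral>\<^sup>+z. ennreal ((p \<bullet> (z + g *\<^sub>R u)) ^ 4) \<partial>gauss_measure s)
      \<le> (\<integral>\<^sup>+z. 8 * ennreal ((p \<bullet> z) ^ 4) + ennreal (D * g ^ 4) \<partial>gauss_measure s)"
    proof (intro nn_integral_mono)
      fix z
      have "(p \<bullet> (z + g *\<^sub>R u)) ^ 4 \<le> 8 * (p \<bullet> z) ^ 4 + D * g ^ 4"
        using four[of "p \<bullet> z" "g * (p \<bullet> u)"] by (simp add: inner_add_right D_def power_mult_distrib mult_ac)
      then show "ennreal ((p \<bullet> (z + g *\<^sub>R u)) ^ 4) \<le> 8 * ennreal ((p \<bullet> z) ^ 4) + ennreal (D * g ^ 4)"
        by (rule order_trans[OF ennreal_leI]) (use CD in \<open>simp add: ennreal_mult'\<close>)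
    qed
    also have "\<dots> = 8 * ennreal (3 * s ^ 4 * norm p ^ 4) + ennreal (D * g ^ 4)"
      using integral_gauss_inner_moments(2)[OF s, of p] emeasure_space_1
      by (simp add: nn_integral_add nn_integral_cmult)
    also have "\<dots> = ennreal (C + D * g ^ 4)"
    proof -
      have "8 * ennreal (3 * s ^ 4 * norm p ^ 4) = ennreal (8 * (3 * s ^ 4 * norm p ^ 4))"
        by (subst ennreal_mult') auto
      also have "8 * (3 * s ^ 4 * norm p ^ 4) = C" by (simp add: C_def)
      finally show ?thesis using CD by simp
    qed
    finally show "(\<integral>\<^sup>+z. ennreal ((p \<bullet> (z + g *\<^sub>R u)) ^ 4) \<partial>gauss_measure s) \<le> ennreal (C + D * g ^ 4)" .
  qed auto
  also have "\<dots> = (\<integral>\<^sup>+g. ennreal (normal_density 0 (s * sqrt \<rho>) g * (C + D * g ^ 4)) \<partial>lborel)"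
    by (intro nn_integral_cong) (simp add: ennreal_mult')
  also have "\<dots> < \<infinity>"
  proof -
    have "integrable lborel (\<lambda>z. C * (normal_density 0 (s * sqrt \<rho>) z * (z - 0) ^ (2 * 0))
        + D * (normal_density 0 (s * sqrt \<rho>) z * (z - 0) ^ (2 * 2)))"
      by (rule integrable.intros, (rule has_bochner_integral_add has_bochner_integral_mult_right m4 m0)+)
    then have "integrable lborel (\<lambda>z. normal_density 0 (s * sqrt \<rho>) z * (C + D * z ^ 4))"
      by (simp add: algebra_simps)
    then show ?thesis using CD by (subst nn_integral_eq_integral) auto
  qed
  finally show ?fourth .
qed

section \<open>Top eigenvectors\<close>

text \<open>Maximality over the unit sphere is stated in its homogeneous form. Unlike a statement about
  eigenvalues, this is a closed condition on the pair of the matrix and the vector.\<close>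

definition rayleigh_max :: "real^'n^'n \<Rightarrow> real^'n \<Rightarrow> bool"
  where "rayleigh_max A v \<longleftrightarrow> norm v = 1 \<and> (\<forall>y. y \<bullet> (A *v y) \<le> (v \<bullet> (A *v v)) * (y \<bullet> y))"

definition self_adj :: "real^'n^'n \<Rightarrow> bool"
  where "self_adj A \<longleftrightarrow> (\<forall>x y. x \<bullet> (A *v y) = y \<bullet> (A *v x))"

lemma continuous_on_matrix_vector_mult[continuous_intros]:
  fixes f :: "'a::topological_space \<Rightarrow> real^'n^'m"
  assumes "continuous_on S f" "continuous_on S g"
  shows "continuous_on S (\<lambda>p. f p *v g p)"
  unfolding matrix_vector_mult_def by (intro continuous_intros assms)

lemma rayleigh_max_exists: "\<exists>v. rayleigh_max (A::real^'n^'n) v"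
proof -
  have "sphere (0::real^'n) 1 \<noteq> {}" by simp
  moreover have "continuous_on (sphere 0 1) (\<lambda>v. v \<bullet> (A *v v))" by (intro continuous_intros)
  ultimately obtain v where "v \<in> sphere 0 1" "\<forall>y\<in>sphere 0 1. y \<bullet> (A *v y) \<le> v \<bullet> (A *v v)"
    using continuous_attains_sup[OF compact_sphere] by blast
  then have v: "norm v = 1" and max: "\<And>y. norm y = 1 \<Longrightarrow> y \<bullet> (A *v y) \<le> v \<bullet> (A *v v)"
    by auto
  have "y \<bullet> (A *v y) \<le> (v \<bullet> (A *v v)) * (y \<bullet> y)" for y
  proof (cases "y = 0")
    case False
    define z where "z = y /\<^sub>R norm y"
    have y: "y = norm y *\<^sub>R z" and z: "norm z = 1" using False by (auto simp: z_def)
    have "y \<bullet> (A *v y) = (norm y)\<^sup>2 * (z \<bullet> (A *v z))"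
      by (subst (1 2) y) (simp add: matrix_vector_mult_scaleR power2_eq_square)
    also have "\<dots> \<le> (norm y)\<^sup>2 * (v \<bullet> (A *v v))" using max[OF z] by (intro mult_left_mono) auto
    finally show ?thesis by (simp add: power2_norm_eq_inner mult.commute)
  qed simp
  with v show ?thesis by (auto simp: rayleigh_max_def)
qed

text \<open>First-order condition: moving a maximiser of the Rayleigh quotient in any direction does not
  increase the quotient, so the linear term of the resulting quadratic polynomial vanishes.\<close>

lemma rayleigh_max_eigenvector:
  assumes A: "self_adj A" and v: "rayleigh_max A v"
  shows "A *v v = (v \<bullet> (A *v v)) *\<^sub>R v"
proof -
  define c where "c = v \<bullet> (A *v v)"
  have vv: "v \<bullet> v = 1" using v by (simp add: rayleigh_max_def norm_eq_1)
  define z where "z = A *v v - c *\<^sub>R v"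
  define b where "b = z \<bullet> (A *v z) - c * (z \<bullet> z)"
  have *: "2 * t * (z \<bullet> z) + t\<^sup>2 * b \<le> 0" for t
  proof -
    have "(v + t *\<^sub>R z) \<bullet> (A *v (v + t *\<^sub>R z)) \<le> c * ((v + t *\<^sub>R z) \<bullet> (v + t *\<^sub>R z))"
      using v by (simp add: rayleigh_max_def c_def)
    moreover have "v \<bullet> (A *v z) = z \<bullet> (A *v v)" using A by (simp add: self_adj_def)
    ultimately have "c + 2 * t * (z \<bullet> (A *v v)) + t\<^sup>2 * (z \<bullet> (A *v z)) \<le> c * (1 + 2 * t * (z \<bullet> v) + t\<^sup>2 * (z \<bullet> z))"
      by (simp add: matrix_vector_right_distrib matrix_vector_mult_scaleR inner_add_left inner_add_right
          vv c_def[symmetric] inner_commute[of v z] power2_eq_square algebra_simps)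
    moreover have zAv: "z \<bullet> (A *v v) = z \<bullet> z + c * (z \<bullet> v)"
      by (subst (3) z_def) (simp add: inner_diff_right)
    ultimately show ?thesis unfolding zAv by (simp add: b_def algebra_simps)
  qed
  have "z \<bullet> z = 0"
  proof (rule ccontr)
    assume "z \<bullet> z \<noteq> 0"
    then have pos: "z \<bullet> z > 0" using inner_ge_zero[of z] by linarith
    define t where "t = (z \<bullet> z) / (1 + \<bar>b\<bar>)"
    have t: "t > 0" using pos by (simp add: t_def add_pos_nonneg)
    have "t * \<bar>b\<bar> \<le> z \<bullet> z" using pos by (simp add: t_def divide_simps)
    then have "- (t * b) \<le> z \<bullet> z" using t by (smt (verit) mult_left_mono abs_ge_minus_self mult_minus_right)
    moreover have "2 * (z \<bullet> z) + t * b \<le> 0"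
      using *[of t] t by (simp add: power2_eq_square mult_le_0_iff distrib_left[symmetric] mult.assoc
          mult.left_commute[of 2 t])
    ultimately show False using pos by linarith
  qed
  then show ?thesis by (simp add: z_def c_def)
qed

lemma unit_top_eigenvector_imp_rayleigh_max:
  assumes A: "self_adj A" and v: "unit_top_eigenvector A v"
  shows "rayleigh_max A v"
proof -
  obtain c where c: "norm v = 1" "A *v v = c *\<^sub>R v" "\<And>\<mu>. is_eigenvalue A \<mu> \<Longrightarrow> \<mu> \<le> c"
    using v by (auto simp: unit_top_eigenvector_def)
  obtain v0 where v0: "rayleigh_max A v0" using rayleigh_max_exists by blast
  then have "v0 \<noteq> 0" by (auto simp: rayleigh_max_def)
  with rayleigh_max_eigenvector[OF A v0] have "is_eigenvalue A (v0 \<bullet> (A *v v0))"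
    by (auto simp: is_eigenvalue_def)
  then have "v0 \<bullet> (A *v v0) \<le> c" by (rule c(3))
  moreover have "v \<bullet> (A *v v) = c" using c by (simp add: norm_eq_1)
  ultimately show ?thesis using v0 c(1)
    unfolding rayleigh_max_def by (meson inner_ge_zero mult_right_mono order_trans)
qed

lemma rayleigh_max_value_eq:
  assumes "rayleigh_max A v" "rayleigh_max A v'"
  shows "v \<bullet> (A *v v) = v' \<bullet> (A *v v')"
  using assms unfolding rayleigh_max_def norm_eq_1 by (metis antisym mult.right_neutral)

text \<open>The squared projection on the top eigenspace. Taking a supremum over all maximisers makes it
  upper semicontinuous, hence measurable, without choosing an eigenvector.\<close>

definition top_proj_sq :: "real^'n^'n \<Rightarrow> real^'n \<Rightarrow> real"
  where "top_proj_sq A x = (SUP v\<in>{v. rayleigh_max A v}. (v \<bullet> x)\<^sup>2)"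

lemma compact_rayleigh_max: "compact {v. rayleigh_max A v}"
proof -
  have "closed {v. rayleigh_max A v}"
    unfolding rayleigh_max_def
    by (intro closed_Collect_conj closed_Collect_eq closed_Collect_all closed_Collect_le continuous_intros)
  moreover have "bounded {v. rayleigh_max A v}"
    by (rule boundedI[of _ 1]) (auto simp: rayleigh_max_def)
  ultimately show ?thesis by (simp add: compact_eq_bounded_closed)
qed

lemma top_proj_sq_attained: "\<exists>v. rayleigh_max A v \<and> top_proj_sq A x = (v \<bullet> x)\<^sup>2"
  and top_proj_sq_ge: "rayleigh_max A v \<Longrightarrow> (v \<bullet> x)\<^sup>2 \<le> top_proj_sq A x"
proof -
  have ne: "{v. rayleigh_max A v} \<noteq> {}" using rayleigh_max_exists by auto
  have "continuous_on {v. rayleigh_max A v} (\<lambda>v. (v \<bullet> x)\<^sup>2)" by (intro continuous_intros)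
  from continuous_attains_sup[OF compact_rayleigh_max[of A] ne this]
  obtain v where v: "rayleigh_max A v" and max: "\<And>v'. rayleigh_max A v' \<Longrightarrow> (v' \<bullet> x)\<^sup>2 \<le> (v \<bullet> x)\<^sup>2"
    by auto
  have eq: "top_proj_sq A x = (v \<bullet> x)\<^sup>2"
    unfolding top_proj_sq_def using v max by (intro cSup_eq_maximum) auto
  then show "\<exists>v. rayleigh_max A v \<and> top_proj_sq A x = (v \<bullet> x)\<^sup>2" using v by auto
  show "rayleigh_max A v \<Longrightarrow> (v \<bullet> x)\<^sup>2 \<le> top_proj_sq A x" for v using eq max by simp
qed

lemma top_proj_sq_ge_iff: "r \<le> top_proj_sq A x \<longleftrightarrow> (\<exists>v. rayleigh_max A v \<and> r \<le> (v \<bullet> x)\<^sup>2)"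
  by (metis order_trans top_proj_sq_attained top_proj_sq_ge)

lemma measurable_top_proj_sq:
  "(\<lambda>p. top_proj_sq (fst p) (snd p :: real^'n)) \<in> borel_measurable (borel \<Otimes>\<^sub>M borel)"
  unfolding borel_prod
proof (rule borel_measurableI_ge)
  fix r
  define T where "T = {p :: (real^'n) \<times> ((real^'n^'n) \<times> (real^'n)).
      rayleigh_max (fst (snd p)) (fst p) \<and> r \<le> (fst p \<bullet> snd (snd p))\<^sup>2}"
  have "closed T"
    unfolding T_def rayleigh_max_def
    by (intro closed_Collect_conj closed_Collect_eq closed_Collect_all closed_Collect_le continuous_intros)
  from closed_compact_projection[OF compact_sphere[of 0 1] this]
  have "{y. \<exists>x. x \<in> sphere 0 1 \<and> (x, y) \<in> T} \<in> sets borel" by (rule borel_closed)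
  also have "{y. \<exists>x. x \<in> sphere 0 1 \<and> (x, y) \<in> T} = {p. r \<le> top_proj_sq (fst p) (snd p)}"
    by (auto simp: T_def top_proj_sq_ge_iff rayleigh_max_def)
  finally show "{p\<in>space borel. r \<le> top_proj_sq (fst p) (snd p :: real^'n)} \<in> sets borel" by simp
qed

text \<open>A multiple top eigenvalue, again expressed by a condition that stays closed after projecting out the
  two vectors, which range over compact spheres.\<close>

definition degenerate_top :: "real^'n^'n \<Rightarrow> bool"
  where "degenerate_top A \<longleftrightarrow> (\<exists>v v'. rayleigh_max A v \<and> rayleigh_max A v' \<and> v \<bullet> v' = 0)"

lemma closed_degenerate_top: "closed {A :: real^'n^'n. degenerate_top A}"
proof -
  define T where "T = {p :: ((real^'n) \<times> (real^'n)) \<times> (real^'n^'n).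
      rayleigh_max (snd p) (fst (fst p)) \<and> rayleigh_max (snd p) (snd (fst p)) \<and> fst (fst p) \<bullet> snd (fst p) = 0}"
  have "closed T"
    unfolding T_def rayleigh_max_def
    by (intro closed_Collect_conj closed_Collect_eq closed_Collect_all closed_Collect_le continuous_intros)
  from closed_compact_projection[OF compact_Times[OF compact_sphere[of 0 1] compact_sphere[of 0 1]] this]
  have "closed {y. \<exists>x. x \<in> sphere 0 1 \<times> sphere 0 1 \<and> (x, y) \<in> T}" .
  moreover have "{A :: real^'n^'n. degenerate_top A} = {y. \<exists>x. x \<in> sphere 0 1 \<times> sphere 0 1 \<and> (x, y) \<in> T}"
    by (auto simp: T_def degenerate_top_def rayleigh_max_def)
  ultimately show ?thesis by simp
qed

text \<open>The component of a second maximiser orthogonal to the first one would again be a maximiser.\<close>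

lemma rayleigh_max_unique:
  assumes A: "self_adj A" and nd: "\<not> degenerate_top A" and v: "rayleigh_max A v" and v': "rayleigh_max A v'"
  shows "v' = v \<or> v' = - v"
proof (rule ccontr)
  assume *: "\<not> (v' = v \<or> v' = - v)"
  define c where "c = v \<bullet> (A *v v)"
  have vv: "v \<bullet> v = 1" "v' \<bullet> v' = 1" using v v' by (auto simp: rayleigh_max_def norm_eq_1)
  define z where "z = v' - (v \<bullet> v') *\<^sub>R v"
  have "z \<noteq> 0"
  proof
    assume "z = 0"
    then have eq: "v' = (v \<bullet> v') *\<^sub>R v" by (simp add: z_def)
    then have "v' \<bullet> v' = (v \<bullet> v') * (v \<bullet> v')" by (metis inner_scaleR_left)
    then have "(v \<bullet> v')\<^sup>2 = 1" using vv by (simp add: power2_eq_square)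
    then have "v \<bullet> v' = 1 \<or> v \<bullet> v' = -1" by (simp add: power2_eq_1_iff)
    with eq * show False by (metis scaleR_one scaleR_minus1_left)
  qed
  have "A *v v = c *\<^sub>R v" "A *v v' = c *\<^sub>R v'"
    using rayleigh_max_eigenvector[OF A v] rayleigh_max_eigenvector[OF A v'] rayleigh_max_value_eq[OF v v']
    unfolding c_def by metis+
  then have Az: "A *v z = c *\<^sub>R z"
    by (simp add: z_def matrix_vector_mult_diff_distrib matrix_vector_mult_scaleR algebra_simps)
  define e where "e = z /\<^sub>R norm z"
  have e: "norm e = 1" "v \<bullet> e = 0"
    using \<open>z \<noteq> 0\<close> by (auto simp: e_def z_def inner_diff_right vv)
  have "A *v e = c *\<^sub>R e" using Az by (simp add: e_def matrix_vector_mult_scaleR)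
  then have "e \<bullet> (A *v e) = c" using e by (simp add: norm_eq_1)
  with v e have "rayleigh_max A e" by (simp add: rayleigh_max_def c_def)
  with v e nd show False by (auto simp: degenerate_top_def)
qed

lemma rayleigh_max_inner_sq:
  assumes A: "self_adj A" and nd: "\<not> degenerate_top A" and v: "rayleigh_max A v"
  shows "top_proj_sq A x = (v \<bullet> x)\<^sup>2"
proof -
  obtain v' where "rayleigh_max A v'" "top_proj_sq A x = (v' \<bullet> x)\<^sup>2" using top_proj_sq_attained by blast
  with rayleigh_max_unique[OF A nd v] show ?thesis by fastforce
qed

lemma outer_self_quadratic: "y \<bullet> (outer x x *v z) = (x \<bullet> y) * (x \<bullet> (z::real^'n))"
  by (simp add: outer_mult_vec inner_commute)

text \<open>If a rank-one update has a degenerate top eigenvalue then, by interlacing, this eigenvalue was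
  already the top eigenvalue before the update, and the update is orthogonal to its eigenspace. So for
  a fixed matrix all degenerate updates lie in one hyperplane.\<close>

lemma degenerate_rank_one_update:
  fixes A :: "real^'n^'n"
  assumes A: "self_adj A"
  shows "\<exists>v0. norm v0 = 1 \<and> (\<forall>x. degenerate_top (A + outer x x) \<longrightarrow> v0 \<bullet> x = 0)"
proof -
  obtain v0 where v0: "rayleigh_max A v0" using rayleigh_max_exists by blast
  have "v0 \<bullet> x = 0" if deg: "degenerate_top (A + outer x x)" for x
  proof -
    define B where "B = A + outer x x"
    have B: "y \<bullet> (B *v z) = y \<bullet> (A *v z) + (x \<bullet> y) * (x \<bullet> z)" for y z
      by (simp add: B_def matrix_vector_mult_add_rdistrib inner_add_right outer_self_quadratic)
    have sB: "self_adj B" using A by (simp add: self_adj_def B mult.commute)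
    obtain v v' where v: "rayleigh_max B v" "rayleigh_max B v'" "v \<bullet> v' = 0"
      using deg by (auto simp: degenerate_top_def B_def)
    define c where "c = v \<bullet> (B *v v)"
    have ev: "B *v v = c *\<^sub>R v" "B *v v' = c *\<^sub>R v'"
      using rayleigh_max_eigenvector[OF sB v(1)] rayleigh_max_eigenvector[OF sB v(2)]
        rayleigh_max_value_eq[OF v(1,2)] unfolding c_def by metis+
    have vv: "v \<bullet> v = 1" "v' \<bullet> v' = 1" using v by (auto simp: rayleigh_max_def norm_eq_1)
    \<comment> \<open>a vector of the degenerate eigenspace orthogonal to the update\<close>
    obtain z where z: "z \<noteq> 0" "x \<bullet> z = 0" "B *v z = c *\<^sub>R z"
    proof (cases "x \<bullet> v = 0")
      case True
      moreover have "v \<noteq> 0" using vv by auto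
      ultimately show ?thesis using that[of v] ev by blast
    next
      case False
      define z where "z = (x \<bullet> v') *\<^sub>R v - (x \<bullet> v) *\<^sub>R v'"
      have "z \<bullet> v' = - (x \<bullet> v)" using vv v(3) by (simp add: z_def inner_diff_left)
      then have "z \<noteq> 0" using False by auto
      moreover have "x \<bullet> z = 0" by (simp add: z_def inner_diff_right)
      moreover have "B *v z = c *\<^sub>R z"
        using ev by (simp add: z_def matrix_vector_mult_diff_distrib matrix_vector_mult_scaleR algebra_simps)
      ultimately show ?thesis by (rule that)
    qed
    have "c * (z \<bullet> z) = z \<bullet> (A *v z)" using B[of z z] z by simp
    also have "\<dots> \<le> (v0 \<bullet> (A *v v0)) * (z \<bullet> z)" using v0 by (simp add: rayleigh_max_def)
    finally have "c \<le> v0 \<bullet> (A *v v0)" using z by (simp add: mult_le_cancel_right)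
    moreover have "v0 \<bullet> (B *v v0) \<le> c * (v0 \<bullet> v0)" using v(1) by (simp add: rayleigh_max_def c_def)
    moreover have "v0 \<bullet> v0 = 1" using v0 by (simp add: rayleigh_max_def norm_eq_1)
    ultimately have "(x \<bullet> v0) * (x \<bullet> v0) \<le> 0" using B[of v0 v0] by simp
    then have "x \<bullet> v0 = 0" by (simp add: mult_le_0_iff) linarith
    then show ?thesis by (simp add: inner_commute)
  qed
  with v0 show ?thesis by (auto simp: rayleigh_max_def)
qed

section \<open>Independence and exponential moments\<close>

text \<open>Fubini's theorem for the joint law: to average over two independent variables one may freeze the
  second one and average over the first.\<close>

lemma (in prob_space) nn_integral_indep_var:
  assumes ind: "indep_var S X T Y" and h[measurable]: "h \<in> borel_measurable (S \<Otimes>\<^sub>M T)"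
  shows "(\<integral>\<^sup>+\<omega>. h (X \<omega>, Y \<omega>) \<partial>M) = (\<integral>\<^sup>+\<omega>. (\<integral>\<^sup>+\<omega>'. h (X \<omega>', Y \<omega>) \<partial>M) \<partial>M)"
proof -
  have X[measurable]: "X \<in> measurable M S" and Y[measurable]: "Y \<in> measurable M T"
    and eq: "distr M S X \<Otimes>\<^sub>M distr M T Y = distr M (S \<Otimes>\<^sub>M T) (\<lambda>\<omega>. (X \<omega>, Y \<omega>))"
    using ind unfolding indep_var_distribution_eq by auto
  interpret X: prob_space "distr M S X" by (rule prob_space_distr) fact
  interpret Y: prob_space "distr M T Y" by (rule prob_space_distr) fact
  interpret XY: pair_sigma_finite "distr M S X" "distr M T Y" ..
  have "(\<integral>\<^sup>+\<omega>. h (X \<omega>, Y \<omega>) \<partial>M) = (\<integral>\<^sup>+p. h p \<partial>distr M (S \<Otimes>\<^sub>M T) (\<lambda>\<omega>. (X \<omega>, Y \<omega>)))"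
    by (simp add: nn_integral_distr)
  also have "\<dots> = (\<integral>\<^sup>+p. h p \<partial>(distr M S X \<Otimes>\<^sub>M distr M T Y))" by (simp only: eq)
  also have "\<dots> = (\<integral>\<^sup>+y. \<integral>\<^sup>+x. h (x, y) \<partial>distr M S X \<partial>distr M T Y)"
    by (subst XY.nn_integral_snd[symmetric]) (auto simp: measurable_cong_sets[OF sets_pair_measure_cong[OF sets_distr sets_distr]])
  also have "\<dots> = (\<integral>\<^sup>+\<omega>. (\<integral>\<^sup>+\<omega>'. h (X \<omega>', Y \<omega>) \<partial>M) \<partial>M)"
  proof -
    have m: "(\<lambda>y. \<integral>\<^sup>+x. h (x, y) \<partial>distr M S X) \<in> borel_measurable T"
    proof (rule X.borel_measurable_nn_integral)
      have "(\<lambda>(y, x). h (x, y)) \<in> borel_measurable (T \<Otimes>\<^sub>M S)" by measurable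
      then show "(\<lambda>(y, x). h (x, y)) \<in> borel_measurable (T \<Otimes>\<^sub>M distr M S X)"
        by (simp add: measurable_cong_sets[OF sets_pair_measure_cong[OF refl sets_distr]])
    qed
    have "(\<integral>\<^sup>+y. \<integral>\<^sup>+x. h (x, y) \<partial>distr M S X \<partial>distr M T Y) = (\<integral>\<^sup>+\<omega>. \<integral>\<^sup>+x. h (x, Y \<omega>) \<partial>distr M S X \<partial>M)"
      by (rule nn_integral_distr[OF Y]) (simp add: m)
    also have "\<dots> = (\<integral>\<^sup>+\<omega>. (\<integral>\<^sup>+\<omega>'. h (X \<omega>', Y \<omega>) \<partial>M) \<partial>M)"
    proof (intro nn_integral_cong)
      fix \<omega> assume "\<omega> \<in> space M"
      then have [simp]: "Y \<omega> \<in> space T" by (rule measurable_space[OF Y])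
      show "(\<integral>\<^sup>+x. h (x, Y \<omega>) \<partial>distr M S X) = (\<integral>\<^sup>+\<omega>'. h (X \<omega>', Y \<omega>) \<partial>M)"
        by (subst nn_integral_distr) (auto intro: measurable_Pair1' measurable_compose[OF _ h])
    qed
    finally show ?thesis .
  qed
  finally show ?thesis .
qed

lemma (in prob_space) nn_integral_indep_var_mult:
  assumes ind: "indep_var S X T Y" and [measurable]: "f \<in> borel_measurable S" "g \<in> borel_measurable T"
  shows "(\<integral>\<^sup>+\<omega>. f (X \<omega>) * g (Y \<omega>) \<partial>M) = (\<integral>\<^sup>+\<omega>. f (X \<omega>) \<partial>M) * (\<integral>\<^sup>+\<omega>. g (Y \<omega>) \<partial>M)"
proof -
  have [measurable]: "X \<in> measurable M S" "Y \<in> measurable M T"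
    using ind unfolding indep_var_distribution_eq by auto
  have "(\<integral>\<^sup>+\<omega>. f (X \<omega>) * g (Y \<omega>) \<partial>M) = (\<integral>\<^sup>+\<omega>. (\<integral>\<^sup>+\<omega>'. f (X \<omega>') * g (Y \<omega>) \<partial>M) \<partial>M)"
    using nn_integral_indep_var[OF ind, of "\<lambda>p. f (fst p) * g (snd p)"] by simp
  also have "\<dots> = (\<integral>\<^sup>+\<omega>. f (X \<omega>) \<partial>M) * (\<integral>\<^sup>+\<omega>. g (Y \<omega>) \<partial>M)"
    by (simp add: nn_integral_multc nn_integral_cmult)
  finally show ?thesis .
qed

lemma (in prob_space) nn_integral_exp_sum_indep:
  fixes L :: "'i \<Rightarrow> 'a \<Rightarrow> real"
  assumes ind: "indep_vars (\<lambda>_. borel) L I" and K: "finite K" "K \<subseteq> I"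
    and m: "\<And>i. i \<in> K \<Longrightarrow> (\<integral>\<^sup>+\<omega>. ennreal (exp (c * L i \<omega>)) \<partial>M) = ennreal \<phi>" and "\<phi> \<ge> 0"
  shows "(\<integral>\<^sup>+\<omega>. ennreal (exp (c * (\<Sum>i\<in>K. L i \<omega>))) \<partial>M) = ennreal (\<phi> ^ card K)"
proof -
  have "indep_vars (\<lambda>_. borel) (\<lambda>i \<omega>. exp (c * L i \<omega>)) K"
    by (rule indep_vars_compose2[OF indep_vars_subset[OF ind K(2)]]) auto
  then have "indep_vars (\<lambda>_. borel) (\<lambda>i \<omega>. ennreal (exp (c * L i \<omega>))) K"
    by (rule indep_vars_compose2) auto
  from indep_vars_nn_integral[OF K(1) this]
  have "(\<integral>\<^sup>+\<omega>. (\<Prod>i\<in>K. ennreal (exp (c * L i \<omega>))) \<partial>M) = (\<Prod>i\<in>K. \<integral>\<^sup>+\<omega>. ennreal (exp (c * L i \<omega>)) \<partial>M)"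
    by simp
  also have "\<dots> = ennreal (\<phi> ^ card K)" using m \<open>\<phi> \<ge> 0\<close> by (simp add: ennreal_power)
  finally show ?thesis
    using K(1) by (simp add: sum_distrib_left exp_sum prod_ennreal)
qed

lemma (in prob_space) chernoff_upper:
  assumes [measurable]: "S \<in> borel_measurable M"
    and m: "(\<integral>\<^sup>+\<omega>. ennreal (exp (c * S \<omega>)) \<partial>M) \<le> ennreal C" and "C \<ge> 0" "c > 0"
  shows "prob {\<omega>\<in>space M. a \<le> S \<omega>} \<le> C * exp (- c * a)"
proof -
  have "emeasure M {\<omega>\<in>space M. a \<le> S \<omega>} = (\<integral>\<^sup>+\<omega>. indicator {\<omega>\<in>space M. a \<le> S \<omega>} \<omega> \<partial>M)"
    by (subst nn_integral_indicator) auto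
  also have "\<dots> \<le> (\<integral>\<^sup>+\<omega>. ennreal (exp (- c * a)) * ennreal (exp (c * S \<omega>)) \<partial>M)"
  proof (intro nn_integral_mono)
    fix \<omega>
    have "1 \<le> exp (- c * a + c * S \<omega>)" if "a \<le> S \<omega>"
      using that \<open>c > 0\<close> by (simp add: mult_left_mono)
    then show "indicator {\<omega>\<in>space M. a \<le> S \<omega>} \<omega> \<le> ennreal (exp (- c * a)) * ennreal (exp (c * S \<omega>))"
      by (auto simp: indicator_def ennreal_mult'[symmetric] exp_add[symmetric])
  qed
  also have "\<dots> = ennreal (exp (- c * a)) * (\<integral>\<^sup>+\<omega>. ennreal (exp (c * S \<omega>)) \<partial>M)"
    by (rule nn_integral_cmult) measurable
  also have "\<dots> \<le> ennreal (exp (- c * a)) * ennreal C" by (intro mult_left_mono m) auto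
  also have "\<dots> = ennreal (C * exp (- c * a))" using \<open>C \<ge> 0\<close> by (simp add: ennreal_mult mult.commute)
  finally show ?thesis
    using \<open>C \<ge> 0\<close> by (simp add: emeasure_eq_measure ennreal_le_iff)
qed

text \<open>A lower bound for a tail probability by tilting: under the tilted law with density \<open>exp S\<close> the
  variable \<open>S\<close> lies between \<open>a\<close> and \<open>b\<close> up to the two Chernoff errors, and there the
  density is at most \<open>exp b\<close>.\<close>

lemma (in prob_space) tail_lower_bound_by_tilting:
  assumes S[measurable]: "S \<in> borel_measurable M"
    and one: "(\<integral>\<^sup>+\<omega>. ennreal (exp (S \<omega>)) \<partial>M) = 1"
    and up: "(\<integral>\<^sup>+\<omega>. ennreal (exp ((1 + s) * S \<omega>)) \<partial>M) \<le> ennreal C1"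
    and lo: "(\<integral>\<^sup>+\<omega>. ennreal (exp ((1 - s) * S \<omega>)) \<partial>M) \<le> ennreal C2"
    and "C1 \<ge> 0" "C2 \<ge> 0" "s > 0"
  shows "exp (- b) * (1 - C1 * exp (- s * b) - C2 * exp (s * a)) \<le> prob {\<omega>\<in>space M. a \<le> S \<omega>}"
proof -
  have pw: "ennreal (exp (S \<omega>)) \<le> ennreal (exp b) * indicator {\<omega>\<in>space M. a \<le> S \<omega>} \<omega>
      + (ennreal (exp (- s * b)) * ennreal (exp ((1 + s) * S \<omega>))
      + ennreal (exp (s * a)) * ennreal (exp ((1 - s) * S \<omega>)))" if "\<omega> \<in> space M" for \<omega>
  proof -
    consider "S \<omega> < a" | "S \<omega> > b" | "a \<le> S \<omega>" "S \<omega> \<le> b" by linarith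
    then show ?thesis
    proof cases
      case 1
      then have "S \<omega> \<le> s * a + (1 - s) * S \<omega>" using \<open>s > 0\<close> by (simp add: algebra_simps)
      then have "ennreal (exp (S \<omega>)) \<le> ennreal (exp (s * a)) * ennreal (exp ((1 - s) * S \<omega>))"
        by (simp add: ennreal_mult'[symmetric] exp_add[symmetric])
      then show ?thesis by (intro add_increasing) auto
    next
      case 2
      then have "S \<omega> \<le> - s * b + (1 + s) * S \<omega>" using \<open>s > 0\<close> by (simp add: algebra_simps)
      then have "ennreal (exp (S \<omega>)) \<le> ennreal (exp (- s * b)) * ennreal (exp ((1 + s) * S \<omega>))"
        by (simp add: ennreal_mult'[symmetric] exp_add[symmetric])
      then show ?thesis by (intro add_increasing add_increasing2) auto
    next
      case 3
      then have "ennreal (exp (S \<omega>)) \<le> ennreal (exp b) * indicator {\<omega>\<in>space M. a \<le> S \<omega>} \<omega>"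
        using that by simp
      then show ?thesis by (intro add_increasing2) auto
    qed
  qed
  have "1 \<le> (\<integral>\<^sup>+\<omega>. ennreal (exp b) * indicator {\<omega>\<in>space M. a \<le> S \<omega>} \<omega>
      + (ennreal (exp (- s * b)) * ennreal (exp ((1 + s) * S \<omega>))
      + ennreal (exp (s * a)) * ennreal (exp ((1 - s) * S \<omega>))) \<partial>M)"
    unfolding one[symmetric] by (intro nn_integral_mono pw)
  also have "\<dots> = ennreal (exp b) * emeasure M {\<omega>\<in>space M. a \<le> S \<omega>}
      + (ennreal (exp (- s * b)) * (\<integral>\<^sup>+\<omega>. ennreal (exp ((1 + s) * S \<omega>)) \<partial>M)
      + ennreal (exp (s * a)) * (\<integral>\<^sup>+\<omega>. ennreal (exp ((1 - s) * S \<omega>)) \<partial>M))"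
    by (simp add: nn_integral_add nn_integral_cmult)
  also have "\<dots> \<le> ennreal (exp b) * ennreal (prob {\<omega>\<in>space M. a \<le> S \<omega>})
      + (ennreal (exp (- s * b)) * ennreal C1 + ennreal (exp (s * a)) * ennreal C2)"
    by (intro add_mono mult_left_mono up lo) (auto simp: emeasure_eq_measure)
  also have "\<dots> = ennreal (exp b * prob {\<omega>\<in>space M. a \<le> S \<omega>} + (exp (- s * b) * C1 + exp (s * a) * C2))"
    using \<open>C1 \<ge> 0\<close> \<open>C2 \<ge> 0\<close> by (simp add: ennreal_mult')
  finally have "1 \<le> exp b * prob {\<omega>\<in>space M. a \<le> S \<omega>} + (exp (- s * b) * C1 + exp (s * a) * C2)"
    by simp
  then have "exp (- b) * (1 - C1 * exp (- s * b) - C2 * exp (s * a)) \<le> exp (- b) * (exp b * prob {\<omega>\<in>space M. a \<le> S \<omega>})"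
    by (intro mult_left_mono) (auto simp: algebra_simps)
  also have "\<dots> = prob {\<omega>\<in>space M. a \<le> S \<omega>}" by (simp add: exp_minus)
  finally show ?thesis .
qed

section \<open>False alarms\<close>

lemma cusum_cong_upto:
  assumes "\<And>i. 1 \<le> i \<Longrightarrow> i \<le> t \<Longrightarrow> l i = l' i"
  shows "cusum l t = cusum l' t"
  using assms by (induction t) auto

text \<open>Summing over the first passage time \<open>t\<close> and the starting point \<open>j\<close> of the segment that causes
  the alarm: the likelihood ratio of the segment is at least \<open>exp B\<close> there, and prolonging it from
  \<open>t\<close> to \<open>n\<close> does not change its mean because the later factors are independent with mean one. For
  fixed \<open>j\<close> the passage events are disjoint, so each \<open>j\<close> contributes at most \<open>exp (- B)\<close>.\<close>

lemma (in prob_space) cusum_false_alarm: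
  assumes ind: "indep_vars (\<lambda>_. borel) L {1..}"
    and one: "\<And>t. t \<ge> 1 \<Longrightarrow> (\<integral>\<^sup>+\<omega>. ennreal (exp (L t \<omega>)) \<partial>M) = 1"
  shows "prob {\<omega>\<in>space M. cusum_time (\<lambda>t. L t \<omega>) B \<le> enat n} \<le> real n * exp (- B)"
proof -
  have rv: "L t \<in> borel_measurable M" if "t \<ge> 1" for t
    using ind that by (auto simp: indep_vars_def)
  note borel_measurable_cusum[of "\<lambda>\<omega> t. L t \<omega>" M, OF rv, measurable]
  define A where "A t = {l :: nat \<Rightarrow> real. B \<le> cusum l t \<and> (\<forall>s\<in>{1..<t}. \<not> B \<le> cusum l s)}" for t
  define ev where "ev t = {\<omega>\<in>space M. (\<lambda>t. L t \<omega>) \<in> A t}" for t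
  have ev[measurable]: "ev t \<in> events" for t
    unfolding ev_def A_def by simp
  have sumrv: "(\<lambda>\<omega>. \<Sum>i=j..t. L i \<omega>) \<in> borel_measurable M" if "j \<ge> 1" for j t
    using that by (intro borel_measurable_sum rv) auto
  have disj: "disjoint_family_on ev {1..n}"
  proof -
    have "s = t" if "\<omega> \<in> ev s" "\<omega> \<in> ev t" "1 \<le> s" "1 \<le> t" for s t \<omega>
      using that unfolding ev_def A_def by (cases s t rule: linorder_cases) auto
    then show ?thesis by (auto simp: disjoint_family_on_def)
  qed
  have "{\<omega>\<in>space M. cusum_time (\<lambda>t. L t \<omega>) B \<le> enat n} \<subseteq> (\<Union>t\<in>{1..n}. ev t)"
  proof
    fix \<omega> assume *: "\<omega> \<in> {\<omega>\<in>space M. cusum_time (\<lambda>t. L t \<omega>) B \<le> enat n}"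
    define P where "P t \<longleftrightarrow> 1 \<le> t \<and> t \<le> n \<and> B \<le> cusum (\<lambda>t. L t \<omega>) t" for t
    have "\<exists>t. P t" using * by (auto simp: cusum_time_le_iff P_def)
    then have "P (LEAST t. P t)" "\<And>s. s < (LEAST t. P t) \<Longrightarrow> \<not> P s"
      by (auto intro: LeastI dest: not_less_Least)
    then have "\<omega> \<in> ev (LEAST t. P t)" "(LEAST t. P t) \<in> {1..n}"
      using * by (auto simp: ev_def A_def P_def)
    then show "\<omega> \<in> (\<Union>t\<in>{1..n}. ev t)" by blast
  qed
  then have "emeasure M {\<omega>\<in>space M. cusum_time (\<lambda>t. L t \<omega>) B \<le> enat n} \<le> emeasure M (\<Union>t\<in>{1..n}. ev t)"
    by (intro emeasure_mono) auto
  also have "\<dots> = (\<Sum>t=1..n. emeasure M (ev t))"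
    using disj by (intro sum_emeasure[symmetric]) auto
  also have "\<dots> \<le> (\<Sum>t=1..n. \<Sum>j=1..n. ennreal (exp (- B)) * (\<integral>\<^sup>+\<omega>. indicator (ev t) \<omega> * ennreal (exp (\<Sum>i=j..n. L i \<omega>)) \<partial>M))"
  proof (intro sum_mono)
    fix t assume t: "t \<in> {1..n}"
    have prolong: "(\<integral>\<^sup>+\<omega>. indicator (ev t) \<omega> * ennreal (exp (\<Sum>i=j..t. L i \<omega>)) \<partial>M)
        = (\<integral>\<^sup>+\<omega>. indicator (ev t) \<omega> * ennreal (exp (\<Sum>i=j..n. L i \<omega>)) \<partial>M)" if j: "j \<in> {1..t}" for j
    proof -
      let ?X = "\<lambda>\<omega>. restrict (\<lambda>i. L i \<omega>) {1..t}" and ?Y = "\<lambda>\<omega>. restrict (\<lambda>i. L i \<omega>) {t+1..n}"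
      let ?S = "PiM {1..t} (\<lambda>_. borel :: real measure)" and ?T = "PiM {t+1..n} (\<lambda>_. borel :: real measure)"
      have ind2: "indep_var ?S ?X ?T ?Y"
        by (rule indep_var_restrict[OF ind]) auto
      define f where "f l = indicator (A t) l * ennreal (exp (\<Sum>i=j..t. l i))" for l
      define g where "g l = ennreal (exp (\<Sum>i=t+1..n. l i))" for l :: "nat \<Rightarrow> real"
      have cu: "(\<lambda>l. cusum l s) \<in> borel_measurable ?S" if "s \<le> t" for s
        using that
      proof (induction s)
        case (Suc s)
        have [measurable]: "(\<lambda>l. l (Suc s)) \<in> borel_measurable ?S"
          using Suc.prems by (intro measurable_component_singleton) auto
        have [measurable]: "(\<lambda>l. cusum l s) \<in> borel_measurable ?S" using Suc by simp
        show ?case unfolding cusum.simps by measurable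
      qed simp
      have [measurable]: "{l\<in>space ?S. l \<in> A t} \<in> sets ?S"
      proof -
        have a: "{l\<in>space ?S. B \<le> cusum l t} \<in> sets ?S"
          using cu[OF order_refl] by measurable
        have b: "{l\<in>space ?S. \<not> B \<le> cusum l s} \<in> sets ?S" if "s \<in> {1..<t}" for s
        proof -
          have "s \<le> t" using that by simp
          from cu[OF this] show ?thesis by measurable
        qed
        have "{l\<in>space ?S. \<forall>s\<in>{1..<t}. \<not> B \<le> cusum l s} \<in> sets ?S"
          by (rule sets.sets_Collect_finite_All) (use b in auto)
        from sets.sets_Collect_conj[OF this a]
        have "{l\<in>space ?S. B \<le> cusum l t \<and> (\<forall>s\<in>{1..<t}. \<not> B \<le> cusum l s)} \<in> sets ?S" .
        then show ?thesis by (simp only: A_def mem_Collect_eq)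
      qed
      have indA: "(\<lambda>l. indicator (A t) l :: ennreal) \<in> borel_measurable ?S"
        by (rule borel_measurable_indicator') measurable
      have sumS: "(\<lambda>l. \<Sum>i=j..t. l i) \<in> borel_measurable ?S"
        using j by (intro borel_measurable_sum measurable_component_singleton) auto
      have sumT: "(\<lambda>l. \<Sum>i=t+1..n. l i) \<in> borel_measurable ?T"
        by (intro borel_measurable_sum measurable_component_singleton) auto
      note indA[measurable] sumS[measurable] sumT[measurable]
      have f[measurable]: "f \<in> borel_measurable ?S" and g[measurable]: "g \<in> borel_measurable ?T"
        unfolding f_def g_def by measurable
      have fX: "f (?X \<omega>) = indicator (ev t) \<omega> * ennreal (exp (\<Sum>i=j..t. L i \<omega>))" if "\<omega> \<in> space M" for \<omega>
      proof -
        have "cusum (?X \<omega>) s = cusum (\<lambda>i. L i \<omega>) s" if "s \<le> t" for s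
          using that by (intro cusum_cong_upto) auto
        then have "?X \<omega> \<in> A t \<longleftrightarrow> (\<lambda>i. L i \<omega>) \<in> A t" by (auto simp: A_def)
        moreover have "(\<Sum>i=j..t. ?X \<omega> i) = (\<Sum>i=j..t. L i \<omega>)" using j by (intro sum.cong) auto
        ultimately show ?thesis using that by (simp add: f_def ev_def indicator_def)
      qed
      have gY: "g (?Y \<omega>) = ennreal (exp (\<Sum>i=t+1..n. L i \<omega>))" for \<omega>
        unfolding g_def by (intro arg_cong[where f="\<lambda>r. ennreal (exp r)"] sum.cong) auto
      have "(\<integral>\<^sup>+\<omega>. ennreal (exp (1 * (\<Sum>i\<in>{t+1..n}. L i \<omega>))) \<partial>M) = ennreal (1 ^ card {t+1..n})"
        by (rule nn_integral_exp_sum_indep[OF ind]) (auto simp: one)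
      then have gint: "(\<integral>\<^sup>+\<omega>. g (?Y \<omega>) \<partial>M) = 1" by (simp only: gY mult_1_left power_one ennreal_1)
      have "(\<integral>\<^sup>+\<omega>. indicator (ev t) \<omega> * ennreal (exp (\<Sum>i=j..t. L i \<omega>)) \<partial>M)
          = (\<integral>\<^sup>+\<omega>. f (?X \<omega>) \<partial>M)"
        by (intro nn_integral_cong fX[symmetric])
      also have "\<dots> = (\<integral>\<^sup>+\<omega>. f (?X \<omega>) \<partial>M) * (\<integral>\<^sup>+\<omega>. g (?Y \<omega>) \<partial>M)"
        by (simp only: gint mult_1_right)
      also have "\<dots> = (\<integral>\<^sup>+\<omega>. f (?X \<omega>) * g (?Y \<omega>) \<partial>M)"
        by (rule nn_integral_indep_var_mult[OF ind2 f g, symmetric])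
      also have "\<dots> = (\<integral>\<^sup>+\<omega>. indicator (ev t) \<omega> * ennreal (exp (\<Sum>i=j..n. L i \<omega>)) \<partial>M)"
      proof (intro nn_integral_cong)
        fix \<omega> assume "\<omega> \<in> space M"
        have "{j..n} = {j..t} \<union> {t+1..n}" using t j by auto
        then have "(\<Sum>i=j..n. L i \<omega>) = (\<Sum>i=j..t. L i \<omega>) + (\<Sum>i=t+1..n. L i \<omega>)"
          by (simp add: sum.union_disjoint)
        then show "f (?X \<omega>) * g (?Y \<omega>) = indicator (ev t) \<omega> * ennreal (exp (\<Sum>i=j..n. L i \<omega>))"
          using fX[OF \<open>\<omega> \<in> space M\<close>] gY by (simp add: exp_add ennreal_mult' mult.assoc)
      qed
      finally show ?thesis .
    qed
    have "emeasure M (ev t) = (\<integral>\<^sup>+\<omega>. indicator (ev t) \<omega> \<partial>M)" by simp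
    also have "\<dots> \<le> (\<integral>\<^sup>+\<omega>. (\<Sum>j=1..t. ennreal (exp (- B)) * (indicator (ev t) \<omega> * ennreal (exp (\<Sum>i=j..t. L i \<omega>)))) \<partial>M)"
    proof (intro nn_integral_mono)
      fix \<omega> assume "\<omega> \<in> space M"
      show "indicator (ev t) \<omega> \<le> (\<Sum>j=1..t. ennreal (exp (- B)) * (indicator (ev t) \<omega> * ennreal (exp (\<Sum>i=j..t. L i \<omega>))))"
      proof (cases "\<omega> \<in> ev t")
        case True
        then have "B \<le> cusum (\<lambda>t. L t \<omega>) t" by (simp add: ev_def A_def)
        with cusum_eq_segment_sum[of t "\<lambda>t. L t \<omega>"] t obtain j
          where j: "j \<in> {1..t}" "B \<le> (\<Sum>i=j..t. L i \<omega>)" by auto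
        then have "1 \<le> ennreal (exp (- B)) * (indicator (ev t) \<omega> * ennreal (exp (\<Sum>i=j..t. L i \<omega>)))"
          using True by (simp add: ennreal_mult'[symmetric] exp_add[symmetric])
        also have "\<dots> \<le> (\<Sum>j=1..t. ennreal (exp (- B)) * (indicator (ev t) \<omega> * ennreal (exp (\<Sum>i=j..t. L i \<omega>))))"
          using j by (intro member_le_sum) auto
        finally show ?thesis using True by simp
      qed simp
    qed
    also have "\<dots> = (\<Sum>j=1..t. ennreal (exp (- B)) * (\<integral>\<^sup>+\<omega>. indicator (ev t) \<omega> * ennreal (exp (\<Sum>i=j..t. L i \<omega>)) \<partial>M))"
    proof (subst nn_integral_sum)
      fix j assume "j \<in> {1..t}"
      then have [measurable]: "(\<lambda>\<omega>. \<Sum>i=j..t. L i \<omega>) \<in> borel_measurable M" by (intro sumrv) auto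
      show "(\<lambda>\<omega>. ennreal (exp (- B)) * (indicator (ev t) \<omega> * ennreal (exp (\<Sum>i=j..t. L i \<omega>)))) \<in> borel_measurable M"
        by measurable
    qed (intro sum.cong refl nn_integral_cmult, use sumrv in \<open>auto intro!: borel_measurable_times_ennreal\<close>)
    also have "\<dots> = (\<Sum>j=1..t. ennreal (exp (- B)) * (\<integral>\<^sup>+\<omega>. indicator (ev t) \<omega> * ennreal (exp (\<Sum>i=j..n. L i \<omega>)) \<partial>M))"
      by (intro sum.cong refl) (simp only: prolong)
    also have "\<dots> \<le> (\<Sum>j=1..n. ennreal (exp (- B)) * (\<integral>\<^sup>+\<omega>. indicator (ev t) \<omega> * ennreal (exp (\<Sum>i=j..n. L i \<omega>)) \<partial>M))"
      using t by (intro sum_mono2) auto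
    finally show "emeasure M (ev t) \<le> (\<Sum>j=1..n. ennreal (exp (- B)) * (\<integral>\<^sup>+\<omega>. indicator (ev t) \<omega> * ennreal (exp (\<Sum>i=j..n. L i \<omega>)) \<partial>M))" .
  qed
  also have "\<dots> = (\<Sum>j=1..n. \<Sum>t=1..n. ennreal (exp (- B)) * (\<integral>\<^sup>+\<omega>. indicator (ev t) \<omega> * ennreal (exp (\<Sum>i=j..n. L i \<omega>)) \<partial>M))"
    by (rule sum.swap)
  also have "\<dots> \<le> (\<Sum>j=1..n. ennreal (exp (- B)))"
  proof (intro sum_mono)
    fix j assume j: "j \<in> {1..n}"
    then have [measurable]: "(\<lambda>\<omega>. \<Sum>i=j..n. L i \<omega>) \<in> borel_measurable M" by (intro sumrv) auto
    have "(\<Sum>t=1..n. (\<integral>\<^sup>+\<omega>. indicator (ev t) \<omega> * ennreal (exp (\<Sum>i=j..n. L i \<omega>)) \<partial>M))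
        = (\<integral>\<^sup>+\<omega>. (\<Sum>t=1..n. indicator (ev t) \<omega>) * ennreal (exp (\<Sum>i=j..n. L i \<omega>)) \<partial>M)"
      by (subst nn_integral_sum[symmetric]) (auto simp: sum_distrib_right)
    also have "\<dots> \<le> (\<integral>\<^sup>+\<omega>. 1 * ennreal (exp (\<Sum>i=j..n. L i \<omega>)) \<partial>M)"
    proof (intro nn_integral_mono mult_right_mono)
      fix \<omega>
      have "(\<Sum>t=1..n. indicator (ev t) \<omega> :: ennreal) = indicator (\<Union>t\<in>{1..n}. ev t) \<omega>"
        using disj by (intro indicator_UN_disjoint[symmetric]) auto
      then show "(\<Sum>t=1..n. indicator (ev t) \<omega> :: ennreal) \<le> 1" by (simp add: indicator_def)
    qed auto
    also have "\<dots> = 1"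
      using nn_integral_exp_sum_indep[OF ind, of "{j..n}" 1 1] j by (auto simp: one)
    finally have "ennreal (exp (- B)) * (\<Sum>t=1..n. (\<integral>\<^sup>+\<omega>. indicator (ev t) \<omega> * ennreal (exp (\<Sum>i=j..n. L i \<omega>)) \<partial>M))
        \<le> ennreal (exp (- B)) * 1" by (intro mult_left_mono) auto
    then show "(\<Sum>t=1..n. ennreal (exp (- B)) * (\<integral>\<^sup>+\<omega>. indicator (ev t) \<omega> * ennreal (exp (\<Sum>i=j..n. L i \<omega>)) \<partial>M))
        \<le> ennreal (exp (- B))" by (simp add: sum_distrib_left)
  qed
  also have "\<dots> = ennreal (real n * exp (- B))" by (simp add: ennreal_mult' ennreal_of_nat_eq_real_of_nat)
  finally show ?thesis by (simp add: emeasure_eq_measure)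
qed

section \<open>Alarms in independent blocks\<close>

lemma expected_time_blocks_le:
  fixes x :: "nat \<Rightarrow> 'a \<Rightarrow> 'b"
  assumes "prob_space M" and ind: "prob_space.indep_vars M (\<lambda>_. S) x {1..}"
    and T: "T \<in> measurable M (count_space UNIV)" and N: "N > 0" and q: "0 \<le> q" "q < 1"
    and meas: "\<And>j. Measurable.pred (PiM {j*N+1..j*N+N} (\<lambda>_. S)) (W j)"
    and miss: "\<And>j. measure M {\<omega>\<in>space M. \<not> W j (restrict (\<lambda>i. x i \<omega>) {j*N+1..j*N+N})} \<le> q"
    and stop: "\<And>j \<omega>. \<omega> \<in> space M \<Longrightarrow> W j (restrict (\<lambda>i. x i \<omega>) {j*N+1..j*N+N}) \<Longrightarrow> T \<omega> \<le> enat (j*N+N)"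
  shows "expected_time M T \<le> ennreal (real N / (1 - q))"
proof (rule expected_time_geometric_le[OF _ T q N])
  interpret prob_space M by fact
  show "finite_measure M" by unfold_locales
  let ?K = "\<lambda>j. {j*N+1..j*N+N}"
  let ?E = "\<lambda>j. {\<omega>\<in>space M. \<not> W j (restrict (\<lambda>i. x i \<omega>) (?K j))}"
  have "disjoint_family_on ?K UNIV"
  proof -
    have "i = j" if "k \<in> ?K i" "k \<in> ?K j" for i j k
    proof -
      have "(k - 1) div N = i" "(k - 1) div N = j"
        using that N by (auto intro!: div_nat_eqI simp: mult.commute)
      then show ?thesis by simp
    qed
    then show ?thesis unfolding disjoint_family_on_def by blast
  qed
  then have "indep_vars (\<lambda>j. PiM (?K j) (\<lambda>_. S)) (\<lambda>j \<omega>. restrict (\<lambda>i. x i \<omega>) (?K j)) UNIV"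
    by (intro indep_vars_restrict[OF ind]) auto
  from indep_eventsI_indep_vars[OF this, of "\<lambda>j f. \<not> W j f"]
  have ie: "indep_events ?E UNIV"
    using meas by (auto simp: pred_def intro: sets.sets_Collect_neg)
  show "measure M {\<omega>\<in>space M. enat (j * N) < T \<omega>} \<le> q ^ j" for j
  proof (cases "j = 0")
    case False
    have "{\<omega>\<in>space M. enat (j * N) < T \<omega>} \<subseteq> (\<Inter>i\<in>{..<j}. ?E i)"
    proof safe
      fix \<omega> i assume \<omega>: "\<omega> \<in> space M" "enat (j * N) < T \<omega>" "i < j" "W i (restrict (\<lambda>i. x i \<omega>) (?K i))"
      have "T \<omega> \<le> enat (i * N + N)" using stop \<omega> by blast
      also have "i * N + N \<le> j * N" using \<omega>(3) by (metis add.commute mult_Suc mult_le_mono1 Suc_leI)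
      finally show False using \<omega>(2) by simp
    qed
    then have "prob {\<omega>\<in>space M. enat (j * N) < T \<omega>} \<le> prob (\<Inter>i\<in>{..<j}. ?E i)"
      using ie False by (intro finite_measure_mono sets.finite_INT) (auto simp: indep_events_def)
    also have "\<dots> = (\<Prod>i<j. prob (?E i))"
    proof -
      have "\<forall>J\<subseteq>UNIV. J \<noteq> {} \<longrightarrow> finite J \<longrightarrow> prob (\<Inter>i\<in>J. ?E i) = (\<Prod>i\<in>J. prob (?E i))"
        using ie unfolding indep_events_def by (rule conjunct2)
      from this[rule_format, of "{..<j}"] show ?thesis using False by (simp only: lessThan_empty_iff) simp
    qed
    also have "\<dots> \<le> (\<Prod>i<j. q)" by (intro prod_mono conjI measure_nonneg miss)
    finally show ?thesis by simp
  qed simp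
qed

section \<open>Projections on the estimated direction\<close>

definition iid_density :: "'a measure \<Rightarrow> (nat \<Rightarrow> 'a \<Rightarrow> real^'k) \<Rightarrow> (real^'k \<Rightarrow> real) \<Rightarrow> bool"
  where "iid_density M x f \<longleftrightarrow> prob_space M \<and> prob_space.indep_vars M (\<lambda>_. borel) x {1..} \<and>
    (\<forall>t\<ge>1. distributed M lborel (x t) (\<lambda>y. ennreal (f y)))"

definition scatter :: "(nat \<Rightarrow> real^'k) \<Rightarrow> nat \<Rightarrow> nat \<Rightarrow> real^'k^'k"
  where "scatter z m n = (\<Sum>i=m..n. outer (z i) (z i))"

text \<open>The squared projection of the observation at time \<open>t\<close> on the direction estimated from the \<open>w\<close> later
  observations, as a function of the sequence of observations alone. It agrees almost surely with the
  projection on any measurable choice of top eigenvectors.\<close>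

definition proj_stat :: "nat \<Rightarrow> (nat \<Rightarrow> real^'k) \<Rightarrow> nat \<Rightarrow> real"
  where "proj_stat w z t = top_proj_sq (scatter z (t+1) (t+w)) (z t)"

lemma window_cov_eq_scatter: "window_cov x w t \<omega> = scatter (\<lambda>i. x i \<omega>) (t+1) (t+w)"
  by (simp add: window_cov_def scatter_def)

lemma inner_scatter_mult:
  "y \<bullet> (scatter z m n *v y') = (\<Sum>i=m..n. (z i \<bullet> y) * (z i \<bullet> y'))"
proof -
  have "y \<bullet> ((\<Sum>i\<in>I. outer (z i) (z i)) *v y') = (\<Sum>i\<in>I. (z i \<bullet> y) * (z i \<bullet> y'))" if "finite I" for I
    using that
    by (induction I) (auto simp: matrix_vector_mult_add_rdistrib inner_add_right outer_self_quadratic)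
  then show ?thesis by (simp add: scatter_def)
qed

lemma self_adj_scatter: "self_adj (scatter z m n)"
  by (simp add: self_adj_def inner_scatter_mult mult.commute)

lemma scatter_cong: "(\<And>i. m \<le> i \<Longrightarrow> i \<le> n \<Longrightarrow> z i = z' i) \<Longrightarrow> scatter z m n = scatter z' m n"
  unfolding scatter_def by (intro sum.cong) auto

lemma proj_stat_cong:
  "(\<And>i. t \<le> i \<Longrightarrow> i \<le> t + w \<Longrightarrow> z i = z' i) \<Longrightarrow> proj_stat w z t = proj_stat w z' t"
  unfolding proj_stat_def by (intro arg_cong2[where f=top_proj_sq] scatter_cong) auto

lemma borel_measurable_outer[measurable]:
  fixes f g :: "'a \<Rightarrow> real^'k"
  assumes [measurable]: "f \<in> borel_measurable M"
  shows "(\<lambda>\<omega>. outer (f \<omega>) (f \<omega>)) \<in> borel_measurable M"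
proof -
  have "continuous_on UNIV (\<lambda>y::real^'k. outer y y)"
    unfolding outer_def by (intro continuous_intros)
  then have [measurable]: "(\<lambda>y::real^'k. outer y y) \<in> borel_measurable borel"
    by (rule borel_measurable_continuous_onI)
  show ?thesis by measurable
qed

lemma borel_measurable_scatter:
  assumes "\<And>i. m \<le> i \<Longrightarrow> i \<le> n \<Longrightarrow> (\<lambda>\<omega>. x \<omega> i) \<in> borel_measurable M"
  shows "(\<lambda>\<omega>. scatter (x \<omega>) m n) \<in> borel_measurable M"
  unfolding scatter_def using assms by (intro borel_measurable_sum borel_measurable_outer) auto

lemma borel_measurable_top_proj_sq:
  assumes [measurable]: "A \<in> borel_measurable M" "y \<in> borel_measurable M"
  shows "(\<lambda>\<omega>. top_proj_sq (A \<omega>) (y \<omega>)) \<in> borel_measurable M"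
  using measurable_compose[OF measurable_Pair[OF assms] measurable_top_proj_sq] by simp

lemma borel_measurable_proj_stat:
  assumes "\<And>i. t \<le> i \<Longrightarrow> i \<le> t + w \<Longrightarrow> (\<lambda>\<omega>. x \<omega> i) \<in> borel_measurable M"
  shows "(\<lambda>\<omega>. proj_stat w (x \<omega>) t) \<in> borel_measurable M"
  unfolding proj_stat_def using assms
  by (intro borel_measurable_top_proj_sq borel_measurable_scatter) auto

context
  fixes M :: "'a measure" and x :: "nat \<Rightarrow> 'a \<Rightarrow> real^'k" and f :: "real^'k \<Rightarrow> real"
  assumes iid: "iid_density M x f"
begin

lemma iid_prob_space: "prob_space M"
  and iid_indep: "prob_space.indep_vars M (\<lambda>_. borel) x {1..}"
  and iid_distributed: "t \<ge> 1 \<Longrightarrow> distributed M lborel (x t) (\<lambda>y. ennreal (f y))"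
  using iid by (auto simp: iid_density_def)

lemma iid_measurable: "t \<ge> 1 \<Longrightarrow> x t \<in> borel_measurable M"
  using distributed_measurable[OF iid_distributed] by simp

lemma iid_nn_integral:
  "t \<ge> 1 \<Longrightarrow> g \<in> borel_measurable borel \<Longrightarrow>
    (\<integral>\<^sup>+\<omega>. g (x t \<omega>) \<partial>M) = (\<integral>\<^sup>+y. ennreal (f y) * g y \<partial>lborel)"
  using distributed_nn_integral[OF iid_distributed, of t g] by simp

lemma iid_present_future:
  fixes t m :: nat
  defines "Y \<equiv> (\<lambda>\<omega>. restrict (\<lambda>i. x i \<omega>) {t+1..m})"
  assumes t: "t \<ge> 1" and h[measurable]: "h \<in> borel_measurable (borel \<Otimes>\<^sub>M PiM {t+1..m} (\<lambda>_. borel))"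
  shows "(\<integral>\<^sup>+\<omega>. h (x t \<omega>, Y \<omega>) \<partial>M) = (\<integral>\<^sup>+\<omega>. (\<integral>\<^sup>+\<omega>'. h (x t \<omega>', Y \<omega>) \<partial>M) \<partial>M)"
proof -
  interpret prob_space M by (rule iid_prob_space)
  have "indep_var (PiM {t} (\<lambda>_. borel)) (\<lambda>\<omega>. restrict (\<lambda>i. x i \<omega>) {t}) (PiM {t+1..m} (\<lambda>_. borel)) Y"
    unfolding Y_def using t by (intro indep_var_restrict[OF iid_indep]) auto
  moreover have "(\<lambda>p. h (fst p t, snd p)) \<in> borel_measurable (PiM {t} (\<lambda>_. borel) \<Otimes>\<^sub>M PiM {t+1..m} (\<lambda>_. borel))"
    by (rule measurable_compose[OF _ h])
      (intro measurable_Pair measurable_compose[OF measurable_fst measurable_component_singleton] measurable_snd, simp)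
  ultimately show ?thesis
    using nn_integral_indep_var[of "PiM {t} (\<lambda>_. borel)" "\<lambda>\<omega>. restrict (\<lambda>i. x i \<omega>) {t}"
        "PiM {t+1..m} (\<lambda>_. borel)" Y "\<lambda>p. h (fst p t, snd p)"] by simp
qed

lemma iid_hyperplane_null:
  assumes "t \<ge> 1" "v \<noteq> 0"
  shows "(\<integral>\<^sup>+\<omega>. indicator {y. v \<bullet> y = 0} (x t \<omega>) \<partial>M) = 0"
proof -
  have cl: "closed {y::real^'k. v \<bullet> y = 0}" by (rule closed_hyperplane)
  have "negligible {y::real^'k. v \<bullet> y = 0}" using assms by (intro negligible_hyperplane) auto
  then have "{y::real^'k. v \<bullet> y = 0} \<in> null_sets lborel"
    using cl by (simp add: negligible_iff_null_sets null_sets_completion_iff)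
  then have "AE y in lborel. \<not> v \<bullet> (y::real^'k) = 0" by (auto dest: AE_not_in)
  then have "(\<integral>\<^sup>+y. ennreal (f y) * indicator {y. v \<bullet> y = 0} y \<partial>lborel) = (\<integral>\<^sup>+y. 0 \<partial>(lborel :: (real^'k) measure))"
    by (intro nn_integral_cong_AE) auto
  then show ?thesis
    using assms cl by (subst iid_nn_integral) auto
qed

text \<open>Fubini: given the later observations in the window, the first one lies almost surely off the
  hyperplane that contains all degenerate rank-one updates.\<close>

lemma AE_not_degenerate:
  assumes "w > 0"
  shows "AE \<omega> in M. \<not> degenerate_top (scatter (\<lambda>i. x i \<omega>) (t+1) (t+w))"
proof -
  interpret prob_space M by (rule iid_prob_space)
  let ?T = "PiM {t+1+1..t+w} (\<lambda>_. borel :: (real^'k) measure)"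
  let ?Y = "\<lambda>\<omega>. restrict (\<lambda>i. x i \<omega>) {t+1+1..t+w}"
  define D where "D = {A :: real^'k^'k. degenerate_top A}"
  have D[measurable]: "D \<in> sets borel" unfolding D_def by (intro borel_closed closed_degenerate_top)
  have [measurable]: "(\<lambda>z. scatter z (t+1+1) (t+w)) \<in> borel_measurable ?T"
    by (intro borel_measurable_scatter measurable_component_singleton) auto
  define h where "h p = (indicator D (scatter (snd p) (t+1+1) (t+w) + outer (fst p) (fst p)) :: ennreal)"
    for p :: "(real^'k) \<times> (nat \<Rightarrow> real^'k)"
  have h: "h \<in> borel_measurable (borel \<Otimes>\<^sub>M ?T)" unfolding h_def by measurable
  have split: "scatter (\<lambda>i. x i \<omega>) (t+1) (t+w)
     = scatter (?Y \<omega>) (t+1+1) (t+w) + outer (x (t+1) \<omega>) (x (t+1) \<omega>)" for \<omega>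
  proof -
    have "scatter (?Y \<omega>) (t+1+1) (t+w) = scatter (\<lambda>i. x i \<omega>) (t+1+1) (t+w)"
      by (rule scatter_cong) auto
    moreover have "scatter (\<lambda>i. x i \<omega>) (t+1) (t+w)
        = outer (x (t+1) \<omega>) (x (t+1) \<omega>) + scatter (\<lambda>i. x i \<omega>) (t+1+1) (t+w)"
      unfolding scatter_def using assms by (subst sum.atLeast_Suc_atMost) auto
    ultimately show ?thesis by simp
  qed
  have [measurable]: "(\<lambda>\<omega>. scatter (\<lambda>i. x i \<omega>) (t+1) (t+w)) \<in> borel_measurable M"
    by (intro borel_measurable_scatter iid_measurable) auto
  have ind: "(\<lambda>\<omega>. indicator D (scatter (\<lambda>i. x i \<omega>) (t+1) (t+w)) :: ennreal) \<in> borel_measurable M"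
    by measurable
  have "(\<integral>\<^sup>+\<omega>. indicator D (scatter (\<lambda>i. x i \<omega>) (t+1) (t+w)) \<partial>M) = (\<integral>\<^sup>+\<omega>. h (x (t+1) \<omega>, ?Y \<omega>) \<partial>M)"
    by (simp only: split h_def fst_conv snd_conv)
  also have "\<dots> = (\<integral>\<^sup>+\<omega>. (\<integral>\<^sup>+\<omega>'. h (x (t+1) \<omega>', ?Y \<omega>) \<partial>M) \<partial>M)"
    by (rule iid_present_future[OF _ h]) simp
  also have "\<dots> = (\<integral>\<^sup>+\<omega>. 0 \<partial>M)"
  proof (intro nn_integral_cong)
    fix \<omega>
    obtain v0 where v0: "norm v0 = 1" "\<And>y. degenerate_top (scatter (?Y \<omega>) (t+1+1) (t+w) + outer y y) \<Longrightarrow> v0 \<bullet> y = 0"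
      using degenerate_rank_one_update[OF self_adj_scatter] by metis
    have "(\<integral>\<^sup>+\<omega>'. h (x (t+1) \<omega>', ?Y \<omega>) \<partial>M) \<le> (\<integral>\<^sup>+\<omega>'. indicator {y. v0 \<bullet> y = 0} (x (t+1) \<omega>') \<partial>M)"
      using v0(2) by (intro nn_integral_mono) (auto simp: h_def D_def indicator_def)
    also have "\<dots> = 0" using v0(1) by (intro iid_hyperplane_null) auto
    finally show "(\<integral>\<^sup>+\<omega>'. h (x (t+1) \<omega>', ?Y \<omega>) \<partial>M) = 0" by simp
  qed
  finally have "(\<integral>\<^sup>+\<omega>. indicator D (scatter (\<lambda>i. x i \<omega>) (t+1) (t+w)) \<partial>M) = 0" by simp
  then have "AE \<omega> in M. (indicator D (scatter (\<lambda>i. x i \<omega>) (t+1) (t+w)) :: ennreal) = 0"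
    by (subst (asm) nn_integral_0_iff_AE[OF ind]) auto
  then show ?thesis by eventually_elim (auto simp: D_def indicator_def split: if_splits)
qed

lemma AE_estimator_eq_proj_stat:
  assumes "w > 0" and est: "subspace_estimator M x w uhat"
  shows "AE \<omega> in M. \<forall>t\<ge>1. (uhat t \<omega> \<bullet> x t \<omega>)\<^sup>2 = proj_stat w (\<lambda>i. x i \<omega>) t \<and>
    rayleigh_max (scatter (\<lambda>i. x i \<omega>) (t+1) (t+w)) (uhat t \<omega>)"
  unfolding AE_all_countable
proof
  fix t
  show "AE \<omega> in M. t \<ge> 1 \<longrightarrow> (uhat t \<omega> \<bullet> x t \<omega>)\<^sup>2 = proj_stat w (\<lambda>i. x i \<omega>) t \<and>
    rayleigh_max (scatter (\<lambda>i. x i \<omega>) (t+1) (t+w)) (uhat t \<omega>)"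
    using AE_not_degenerate[OF assms(1), of t] AE_space
  proof eventually_elim
    case (elim \<omega>)
    show ?case
    proof
      assume "t \<ge> 1"
      then have "unit_top_eigenvector (scatter (\<lambda>i. x i \<omega>) (t+1) (t+w)) (uhat t \<omega>)"
        using est elim by (auto simp: subspace_estimator_def window_cov_eq_scatter)
      then have *: "rayleigh_max (scatter (\<lambda>i. x i \<omega>) (t+1) (t+w)) (uhat t \<omega>)"
        by (rule unit_top_eigenvector_imp_rayleigh_max[OF self_adj_scatter])
      then show "(uhat t \<omega> \<bullet> x t \<omega>)\<^sup>2 = proj_stat w (\<lambda>i. x i \<omega>) t \<and>
          rayleigh_max (scatter (\<lambda>i. x i \<omega>) (t+1) (t+w)) (uhat t \<omega>)"
        using rayleigh_max_inner_sq[OF self_adj_scatter elim(1) *] by (simp add: proj_stat_def)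
    qed
  qed
qed

lemma borel_measurable_proj_stat_iid:
  "t \<ge> 1 \<Longrightarrow> (\<lambda>\<omega>. proj_stat w (\<lambda>i. x i \<omega>) t) \<in> borel_measurable M"
  by (intro borel_measurable_proj_stat iid_measurable) auto

end

text \<open>Before the change the projections are exactly independent. Going backwards in time, the
  direction at time \<open>t\<close> depends only on later observations, and for every fixed direction the
  projection of a spherical Gaussian vector has the same law.\<close>

lemma proj_stat_factor:
  fixes x :: "nat \<Rightarrow> 'a \<Rightarrow> real^'k"
  assumes iid: "iid_density M x (gauss s)" and s: "s > 0" and w: "w > 0" and t: "t \<ge> 1" and m: "t + w \<le> m"
    and g[measurable]: "g \<in> borel_measurable borel"
    and F[measurable]: "F \<in> borel_measurable (PiM {t+1..m} (\<lambda>_. borel))"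
  shows "(\<integral>\<^sup>+\<omega>. g (proj_stat w (\<lambda>i. x i \<omega>) t) * F (restrict (\<lambda>i. x i \<omega>) {t+1..m}) \<partial>M)
    = (\<integral>\<^sup>+z. ennreal (normal_density 0 s z) * g (z\<^sup>2) \<partial>lborel) * (\<integral>\<^sup>+\<omega>. F (restrict (\<lambda>i. x i \<omega>) {t+1..m}) \<partial>M)"
proof -
  interpret prob_space M by (rule iid_prob_space[OF iid])
  let ?T = "PiM {t+1..m} (\<lambda>_. borel :: (real^'k) measure)"
  let ?Y = "\<lambda>\<omega>. restrict (\<lambda>i. x i \<omega>) {t+1..m}"
  define \<nu> where "\<nu> = (\<integral>\<^sup>+z. ennreal (normal_density 0 s z) * g (z\<^sup>2) \<partial>lborel)"
  have [measurable]: "(\<lambda>z. scatter z (t+1) (t+w)) \<in> borel_measurable ?T"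
    using m by (intro borel_measurable_scatter measurable_component_singleton) auto
  have [measurable]: "?Y \<in> measurable M ?T"
    using iid_measurable[OF iid] t by (intro measurable_restrict) auto
  define h where "h p = g (top_proj_sq (scatter (snd p) (t+1) (t+w)) (fst p)) * F (snd p)"
    for p :: "(real^'k) \<times> (nat \<Rightarrow> real^'k)"
  have [measurable]: "(\<lambda>p. top_proj_sq (scatter (snd p) (t+1) (t+w)) (fst p)) \<in> borel_measurable (borel \<Otimes>\<^sub>M ?T)"
    by (intro borel_measurable_top_proj_sq) measurable
  have h: "h \<in> borel_measurable (borel \<Otimes>\<^sub>M ?T)" unfolding h_def by measurable
  have sc: "scatter (?Y \<omega>) (t+1) (t+w) = scatter (\<lambda>i. x i \<omega>) (t+1) (t+w)" for \<omega>
    using m by (intro scatter_cong) auto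
  have "(\<integral>\<^sup>+\<omega>. g (proj_stat w (\<lambda>i. x i \<omega>) t) * F (?Y \<omega>) \<partial>M) = (\<integral>\<^sup>+\<omega>. h (x t \<omega>, ?Y \<omega>) \<partial>M)"
    by (simp only: h_def fst_conv snd_conv sc proj_stat_def)
  also have "\<dots> = (\<integral>\<^sup>+\<omega>. (\<integral>\<^sup>+\<omega>'. h (x t \<omega>', ?Y \<omega>) \<partial>M) \<partial>M)"
    by (rule iid_present_future[OF iid t h])
  also have "\<dots> = (\<integral>\<^sup>+\<omega>. \<nu> * F (?Y \<omega>) \<partial>M)"
  proof (rule nn_integral_cong_AE)
    show "AE \<omega> in M. (\<integral>\<^sup>+\<omega>'. h (x t \<omega>', ?Y \<omega>) \<partial>M) = \<nu> * F (?Y \<omega>)"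
      using AE_not_degenerate[OF iid w, of t]
    proof eventually_elim
      case (elim \<omega>)
      obtain v where v: "rayleigh_max (scatter (\<lambda>i. x i \<omega>) (t+1) (t+w)) v"
        using rayleigh_max_exists by blast
      then have nv: "norm v = 1" by (simp add: rayleigh_max_def)
      have "(\<integral>\<^sup>+\<omega>'. h (x t \<omega>', ?Y \<omega>) \<partial>M) = (\<integral>\<^sup>+\<omega>'. g ((v \<bullet> x t \<omega>')\<^sup>2) * F (?Y \<omega>) \<partial>M)"
        by (simp only: h_def fst_conv snd_conv sc rayleigh_max_inner_sq[OF self_adj_scatter elim v])
      also have "\<dots> = (\<integral>\<^sup>+\<omega>'. g ((v \<bullet> x t \<omega>')\<^sup>2) \<partial>M) * F (?Y \<omega>)"
        using iid_measurable[OF iid t] by (intro nn_integral_multc) measurable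
      also have "(\<integral>\<^sup>+\<omega>'. g ((v \<bullet> x t \<omega>')\<^sup>2) \<partial>M) = (\<integral>\<^sup>+y. g ((v \<bullet> y)\<^sup>2) \<partial>gauss_measure s)"
        using iid_nn_integral[OF iid t, of "\<lambda>y. g ((v \<bullet> y)\<^sup>2)"] by (simp add: nn_integral_gauss_measure)
      also have "\<dots> = \<nu>"
        unfolding \<nu>_def by (rule nn_integral_gauss_inner[OF s nv, of "\<lambda>r. g (r\<^sup>2)"]) measurable
      finally show ?case .
    qed
  qed
  also have "\<dots> = \<nu> * (\<integral>\<^sup>+\<omega>. F (?Y \<omega>) \<partial>M)" by (rule nn_integral_cmult) measurable
  finally show ?thesis by (simp add: \<nu>_def)
qed

text \<open>Peeling off the earliest time, all remaining factors are functions of later observations.\<close>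

lemma nn_integral_proj_stat_prod:
  fixes x :: "nat \<Rightarrow> 'a \<Rightarrow> real^'k"
  assumes iid: "iid_density M x (gauss s)" and s: "s > 0" and w: "w > 0" and "finite J" "J \<subseteq> {1..}"
    and g: "\<And>t. t \<in> J \<Longrightarrow> g t \<in> borel_measurable borel"
  shows "(\<integral>\<^sup>+\<omega>. (\<Prod>t\<in>J. g t (proj_stat w (\<lambda>i. x i \<omega>) t)) \<partial>M)
    = (\<Prod>t\<in>J. \<integral>\<^sup>+z. ennreal (normal_density 0 s z) * g t (z\<^sup>2) \<partial>lborel)"
  using assms(4-)
proof (induction J rule: finite_linorder_min_induct)
  case empty
  interpret prob_space M by (rule iid_prob_space[OF iid])
  show ?case using emeasure_space_1 by simp
next
  case (insert t J)
  define m where "m = Max (insert t J) + w"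
  have m: "i + w \<le> m" if "i \<in> insert t J" for i using that insert by (simp add: m_def)
  define F where "F z = (\<Prod>i\<in>J. g i (proj_stat w z i))" for z :: "nat \<Rightarrow> real^'k"
  have F: "F \<in> borel_measurable (PiM {t+1..m} (\<lambda>_. borel))"
    unfolding F_def
  proof (intro borel_measurable_prod_ennreal)
    fix i assume i: "i \<in> J"
    then have "(\<lambda>z. proj_stat w z i) \<in> borel_measurable (PiM {t+1..m} (\<lambda>_. borel))"
      using m[of i] insert.hyps
      by (intro borel_measurable_proj_stat measurable_component_singleton) (auto simp: Suc_le_eq intro: less_le_trans)
    with insert.prems(2)[of i] i show "(\<lambda>z. g i (proj_stat w z i)) \<in> borel_measurable (PiM {t+1..m} (\<lambda>_. borel))"
      by (intro measurable_compose[OF _ insert.prems(2)]) auto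
  qed
  have FY: "F (restrict (\<lambda>i. x i \<omega>) {t+1..m}) = (\<Prod>i\<in>J. g i (proj_stat w (\<lambda>i. x i \<omega>) i))" for \<omega>
    unfolding F_def
  proof (intro prod.cong refl arg_cong[where f="g _"] proj_stat_cong)
    fix i l assume "i \<in> J" "i \<le> l" "l \<le> i + w"
    with m[of i] insert.hyps(2) show "restrict (\<lambda>i. x i \<omega>) {t+1..m} l = x l \<omega>"
      by (auto simp: Suc_le_eq intro: less_le_trans)
  qed
  have "t \<notin> J" using insert.hyps(2) by auto
  then have "(\<integral>\<^sup>+\<omega>. (\<Prod>i\<in>insert t J. g i (proj_stat w (\<lambda>i. x i \<omega>) i)) \<partial>M)
     = (\<integral>\<^sup>+\<omega>. g t (proj_stat w (\<lambda>i. x i \<omega>) t) * F (restrict (\<lambda>i. x i \<omega>) {t+1..m}) \<partial>M)"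
    by (simp only: FY prod.insert[OF insert.hyps(1) \<open>t \<notin> J\<close>])
  also have "\<dots> = (\<integral>\<^sup>+z. ennreal (normal_density 0 s z) * g t (z\<^sup>2) \<partial>lborel) * (\<integral>\<^sup>+\<omega>. F (restrict (\<lambda>i. x i \<omega>) {t+1..m}) \<partial>M)"
    using insert.prems m[of t] by (intro proj_stat_factor[OF iid s w _ _ _ F]) auto
  also have "(\<integral>\<^sup>+\<omega>. F (restrict (\<lambda>i. x i \<omega>) {t+1..m}) \<partial>M) = (\<Prod>i\<in>J. \<integral>\<^sup>+z. ennreal (normal_density 0 s z) * g i (z\<^sup>2) \<partial>lborel)"
    unfolding FY using insert.prems by (intro insert.IH) auto
  finally show ?case using \<open>t \<notin> J\<close> insert.hyps by simp
qed

lemma indep_vars_proj_stat: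
  fixes x :: "nat \<Rightarrow> 'a \<Rightarrow> real^'k"
  assumes iid: "iid_density M x (gauss s)" and s: "s > 0" and w: "w > 0"
  shows "prob_space.indep_vars M (\<lambda>_. borel) (\<lambda>t \<omega>. proj_stat w (\<lambda>i. x i \<omega>) t) {1..}"
proof -
  interpret prob_space M by (rule iid_prob_space[OF iid])
  let ?Y = "\<lambda>t \<omega>. proj_stat w (\<lambda>i. x i \<omega>) t"
  have rv[measurable]: "?Y t \<in> borel_measurable M" if "t \<ge> 1" for t
    using borel_measurable_proj_stat_iid[OF iid that] .
  show ?thesis
    unfolding indep_vars_def2
  proof (intro conjI ballI indep_setsI)
    fix t :: nat assume t: "t \<in> {1..}"
    then show "?Y t \<in> borel_measurable M" by (intro rv) auto
    then show "{?Y t -` A \<inter> space M |A. A \<in> sets borel} \<subseteq> events" by (auto intro: measurable_sets)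
  next
    fix E J assume J: "J \<noteq> {}" "J \<subseteq> {1..}" "finite J"
      and E: "\<forall>j\<in>J. E j \<in> {?Y j -` A \<inter> space M |A. A \<in> sets borel}"
    then obtain A where A: "\<And>j. j \<in> J \<Longrightarrow> A j \<in> sets borel" "\<And>j. j \<in> J \<Longrightarrow> E j = ?Y j -` A j \<inter> space M"
      by simp metis
    have Eev: "E j \<in> events" if "j \<in> J" for j
      using that A J by (auto intro!: measurable_sets[OF rv])
    have int: "(\<integral>\<^sup>+\<omega>. (\<Prod>j\<in>K. indicator (A j) (?Y j \<omega>)) \<partial>M)
       = (\<Prod>j\<in>K. \<integral>\<^sup>+z. ennreal (normal_density 0 s z) * indicator (A j) (z\<^sup>2) \<partial>lborel)" if "K \<subseteq> J" for K
      using that A J by (intro nn_integral_proj_stat_prod[OF iid s w]) (auto intro: finite_subset)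
    have one: "emeasure M (E j) = (\<integral>\<^sup>+z. ennreal (normal_density 0 s z) * indicator (A j) (z\<^sup>2) \<partial>lborel)" if "j \<in> J" for j
    proof -
      have "emeasure M (E j) = (\<integral>\<^sup>+\<omega>. indicator (E j) \<omega> \<partial>M)" using Eev[OF that] by simp
      also have "\<dots> = (\<integral>\<^sup>+\<omega>. indicator (A j) (?Y j \<omega>) \<partial>M)"
        using A(2)[OF that] by (intro nn_integral_cong) (auto simp: indicator_def)
      finally show ?thesis using int[of "{j}"] that by simp
    qed
    have "emeasure M (\<Inter>j\<in>J. E j) = (\<integral>\<^sup>+\<omega>. indicator (\<Inter>j\<in>J. E j) \<omega> \<partial>M)"
      using J Eev by (subst nn_integral_indicator) (auto intro!: sets.finite_INT)
    also have "\<dots> = (\<integral>\<^sup>+\<omega>. (\<Prod>j\<in>J. indicator (A j) (?Y j \<omega>)) \<partial>M)"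
    proof (intro nn_integral_cong)
      fix \<omega> assume "\<omega> \<in> space M"
      then show "(indicator (\<Inter>j\<in>J. E j) \<omega> :: ennreal) = (\<Prod>j\<in>J. indicator (A j) (?Y j \<omega>))"
        using A(2) J(3) by (auto simp: indicator_def intro!: prod_zero[symmetric])
    qed
    also have "\<dots> = (\<Prod>j\<in>J. emeasure M (E j))" using int[of J] one by simp
    finally show "prob (\<Inter>j\<in>J. E j) = (\<Prod>j\<in>J. prob (E j))"
      by (simp add: emeasure_eq_measure prod_ennreal prod_nonneg)
  qed
qed

section \<open>Consistency of the estimated direction after the change\<close>

lemma (in prob_space) sum_indep_centred_second_moment:
  fixes Z :: "'i \<Rightarrow> 'a \<Rightarrow> real"
  assumes "finite I" "indep_vars (\<lambda>_. borel) Z I"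
    and "\<And>i. i \<in> I \<Longrightarrow> integrable M (Z i)" "\<And>i. i \<in> I \<Longrightarrow> expectation (Z i) = 0"
    and "\<And>i. i \<in> I \<Longrightarrow> integrable M (\<lambda>\<omega>. (Z i \<omega>)\<^sup>2)" "\<And>i. i \<in> I \<Longrightarrow> expectation (\<lambda>\<omega>. (Z i \<omega>)\<^sup>2) \<le> V"
  shows "integrable M (\<lambda>\<omega>. (\<Sum>i\<in>I. Z i \<omega>)\<^sup>2) \<and> expectation (\<lambda>\<omega>. (\<Sum>i\<in>I. Z i \<omega>)\<^sup>2) \<le> real (card I) * V"
  using assms
proof (induction I rule: finite_induct)
  case (insert i I)
  let ?S = "\<lambda>\<omega>. \<Sum>i\<in>I. Z i \<omega>"
  have IH: "integrable M (\<lambda>\<omega>. (?S \<omega>)\<^sup>2)" "expectation (\<lambda>\<omega>. (?S \<omega>)\<^sup>2) \<le> real (card I) * V"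
    using insert.IH[OF indep_vars_subset[OF insert.prems(1)]] insert.prems by auto
  have ind: "indep_var borel (Z i) borel ?S"
    by (rule indep_vars_sum[OF insert.hyps insert.prems(1)])
  have iS: "integrable M ?S" using insert.prems by (intro Bochner_Integration.integrable_sum) auto
  have iZ: "integrable M (Z i)" "expectation (Z i) = 0" "integrable M (\<lambda>\<omega>. (Z i \<omega>)\<^sup>2)"
    "expectation (\<lambda>\<omega>. (Z i \<omega>)\<^sup>2) \<le> V"
    using insert.prems by auto
  have cross: "integrable M (\<lambda>\<omega>. Z i \<omega> * ?S \<omega>)" "expectation (\<lambda>\<omega>. Z i \<omega> * ?S \<omega>) = 0"
    using indep_var_integrable[OF ind iZ(1) iS] indep_var_lebesgue_integral[OF ind iZ(1) iS] iZ(2) by auto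
  have eq: "(\<lambda>\<omega>. (\<Sum>i\<in>insert i I. Z i \<omega>)\<^sup>2) = (\<lambda>\<omega>. (Z i \<omega>)\<^sup>2 + 2 * (Z i \<omega> * ?S \<omega>) + (?S \<omega>)\<^sup>2)"
    using insert.hyps by (auto simp: power2_eq_square algebra_simps)
  have "integrable M (\<lambda>\<omega>. (Z i \<omega>)\<^sup>2 + 2 * (Z i \<omega> * ?S \<omega>) + (?S \<omega>)\<^sup>2)"
    using iZ cross IH by (intro Bochner_Integration.integrable_add integrable_mult_right) auto
  moreover have "expectation (\<lambda>\<omega>. (Z i \<omega>)\<^sup>2 + 2 * (Z i \<omega> * ?S \<omega>) + (?S \<omega>)\<^sup>2)
      = expectation (\<lambda>\<omega>. (Z i \<omega>)\<^sup>2) + 2 * expectation (\<lambda>\<omega>. Z i \<omega> * ?S \<omega>) + expectation (\<lambda>\<omega>. (?S \<omega>)\<^sup>2)"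
    using iZ cross IH by simp
  ultimately show ?case
    using iZ(4) cross(2) IH(2) insert.hyps by (simp only: eq) (simp add: algebra_simps)
qed simp

text \<open>The classical perturbation bound: the estimated direction has at least the empirical variance of
  the true one, while its population variance is smaller by \<open>r\<close> times the squared sine of the angle.\<close>

lemma rayleigh_max_angle:
  fixes u v :: "real^'k"
  assumes v: "rayleigh_max (scatter z m n) v" and u: "norm u = 1" and N: "N > 0" "r > 0"
    and dev: "\<And>y. norm y = 1 \<Longrightarrow> \<bar>y \<bullet> (scatter z m n *v y) / N - (a + r * (u \<bullet> y)\<^sup>2)\<bar> \<le> e"
  shows "1 - (u \<bullet> v)\<^sup>2 \<le> 2 * e / r"
proof -
  have nv: "norm v = 1" using v by (simp add: rayleigh_max_def)
  have uu: "u \<bullet> u = 1" using u by (simp add: norm_eq_1)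
  have "u \<bullet> (scatter z m n *v u) \<le> v \<bullet> (scatter z m n *v v)"
    using v uu unfolding rayleigh_max_def by (metis mult.right_neutral)
  then have "u \<bullet> (scatter z m n *v u) / N \<le> v \<bullet> (scatter z m n *v v) / N"
    using N by (simp add: divide_right_mono)
  with dev[OF u] dev[OF nv] have "r * (1 - (u \<bullet> v)\<^sup>2) \<le> 2 * e"
    by (simp add: uu abs_le_iff algebra_simps)
  then show ?thesis using N by (simp add: field_simps)
qed

text \<open>The difference of squares factorises, and \<open>norm (v - u) * norm (v + u)\<close> is twice the sine of the
  angle between the two vectors. The weight \<open>\<kappa>\<close> separates the angle from the size of the observation,
  so that the two can be averaged separately although they are dependent.\<close>

lemma inner_sq_diff_le:
  fixes u v y :: "'a::real_inner"
  assumes "norm u = 1" "norm v = 1" "\<kappa> > 0"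
  shows "\<bar>(v \<bullet> y)\<^sup>2 - (u \<bullet> y)\<^sup>2\<bar> \<le> \<kappa> * norm y ^ 4 + (1 - (u \<bullet> v)\<^sup>2) / \<kappa>"
proof -
  define p where "p = norm (v - u) * norm (v + u)"
  have uv: "u \<bullet> u = 1" "v \<bullet> v = 1" using assms by (auto simp: norm_eq_1)
  have p2: "p\<^sup>2 = 4 * (1 - (u \<bullet> v)\<^sup>2)"
    unfolding p_def power_mult_distrib power2_norm_eq_inner
    by (simp add: inner_diff_left inner_diff_right inner_add_left inner_add_right uv inner_commute[of v u] power2_eq_square
        algebra_simps)
  have "\<bar>(v \<bullet> y)\<^sup>2 - (u \<bullet> y)\<^sup>2\<bar> = \<bar>(v - u) \<bullet> y\<bar> * \<bar>(v + u) \<bullet> y\<bar>"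
    by (simp add: abs_mult[symmetric] inner_diff_left inner_add_left power2_eq_square algebra_simps)
  also have "\<dots> \<le> (norm (v - u) * norm y) * (norm (v + u) * norm y)"
    by (intro mult_mono Cauchy_Schwarz_ineq2) auto
  also have "\<dots> = p * (norm y)\<^sup>2" by (simp add: p_def power2_eq_square mult_ac)
  also have "\<dots> \<le> \<kappa> * norm y ^ 4 + (1 - (u \<bullet> v)\<^sup>2) / \<kappa>"
  proof -
    have "0 \<le> (2 * \<kappa> * (norm y)\<^sup>2 - p)\<^sup>2" by simp
    then have "4 * \<kappa> * (p * (norm y)\<^sup>2) \<le> 4 * \<kappa>\<^sup>2 * norm y ^ 4 + p\<^sup>2"
      by (simp add: power2_diff power_mult_distrib power_mult[symmetric] mult_ac)
    then have "\<kappa> * (p * (norm y)\<^sup>2) \<le> \<kappa>\<^sup>2 * norm y ^ 4 + (1 - (u \<bullet> v)\<^sup>2)"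
      unfolding p2 mult.assoc distrib_left[symmetric] by simp
    also have "\<dots> = \<kappa> * (\<kappa> * norm y ^ 4 + (1 - (u \<bullet> v)\<^sup>2) / \<kappa>)"
      using assms(3) by (simp add: distrib_left power2_eq_square)
    finally have "\<kappa> * (p * (norm y)\<^sup>2) \<le> \<kappa> * (\<kappa> * norm y ^ 4 + (1 - (u \<bullet> v)\<^sup>2) / \<kappa>)" .
    then show ?thesis using assms(3) by simp
  qed
  finally show ?thesis .
qed

context
  fixes M :: "'a measure" and x :: "nat \<Rightarrow> 'a \<Rightarrow> real^'k" and s \<rho> :: real and u :: "real^'k"
  assumes iid: "iid_density M x (spiked s \<rho> u)" and s: "s > 0" and \<rho>: "\<rho> > 0" and u: "norm u = 1"
begin

lemma spiked_second_moment:
  assumes t: "t \<ge> 1"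
  shows "integrable M (\<lambda>\<omega>. (p \<bullet> x t \<omega>) * (q \<bullet> x t \<omega>))"
    and "(\<integral>\<omega>. (p \<bullet> x t \<omega>) * (q \<bullet> x t \<omega>) \<partial>M) = s\<^sup>2 * (p \<bullet> q + \<rho> * (p \<bullet> u) * (q \<bullet> u))"
proof -
  note [measurable] = iid_measurable[OF iid t]
  have sq: "has_bochner_integral M (\<lambda>\<omega>. (p \<bullet> x t \<omega>)\<^sup>2) (s\<^sup>2 * ((norm p)\<^sup>2 + \<rho> * (p \<bullet> u)\<^sup>2))" for p
  proof (rule has_bochner_integral_nn_integral)
    have "(\<integral>\<^sup>+\<omega>. ennreal ((p \<bullet> x t \<omega>)\<^sup>2) \<partial>M) = (\<integral>\<^sup>+y. ennreal (spiked s \<rho> u y) * ennreal ((p \<bullet> y)\<^sup>2) \<partial>lborel)"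
      by (rule iid_nn_integral[OF iid t]) measurable
    then show "(\<integral>\<^sup>+\<omega>. ennreal ((p \<bullet> x t \<omega>)\<^sup>2) \<partial>M) = ennreal (s\<^sup>2 * ((norm p)\<^sup>2 + \<rho> * (p \<bullet> u)\<^sup>2))"
      by (simp add: nn_integral_spiked_inner_moments(1)[OF s \<rho> u])
  qed (use \<rho> in \<open>auto intro!: mult_nonneg_nonneg add_nonneg_nonneg\<close>)
  have "has_bochner_integral M (\<lambda>\<omega>. (((p + q) \<bullet> x t \<omega>)\<^sup>2 - ((p - q) \<bullet> x t \<omega>)\<^sup>2) / 4)
    ((s\<^sup>2 * ((norm (p + q))\<^sup>2 + \<rho> * ((p + q) \<bullet> u)\<^sup>2) - s\<^sup>2 * ((norm (p - q))\<^sup>2 + \<rho> * ((p - q) \<bullet> u)\<^sup>2)) / 4)"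
    by (intro has_bochner_integral_divide has_bochner_integral_diff sq)
  also have "(\<lambda>\<omega>. (((p + q) \<bullet> x t \<omega>)\<^sup>2 - ((p - q) \<bullet> x t \<omega>)\<^sup>2) / 4) = (\<lambda>\<omega>. (p \<bullet> x t \<omega>) * (q \<bullet> x t \<omega>))"
    by (simp add: inner_add_left inner_diff_left power2_eq_square algebra_simps)
  also have "(s\<^sup>2 * ((norm (p + q))\<^sup>2 + \<rho> * ((p + q) \<bullet> u)\<^sup>2) - s\<^sup>2 * ((norm (p - q))\<^sup>2 + \<rho> * ((p - q) \<bullet> u)\<^sup>2)) / 4
      = s\<^sup>2 * (p \<bullet> q + \<rho> * (p \<bullet> u) * (q \<bullet> u))"
    unfolding power2_norm_eq_inner
    by (simp add: inner_add_left inner_diff_left inner_add_right inner_diff_right inner_commute[of q p]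
        power2_eq_square algebra_simps)
  finally show "integrable M (\<lambda>\<omega>. (p \<bullet> x t \<omega>) * (q \<bullet> x t \<omega>))"
    and "(\<integral>\<omega>. (p \<bullet> x t \<omega>) * (q \<bullet> x t \<omega>) \<partial>M) = s\<^sup>2 * (p \<bullet> q + \<rho> * (p \<bullet> u) * (q \<bullet> u))"
    by (auto simp: has_bochner_integral_iff)
qed

lemma spiked_fourth_moment: "\<exists>Q\<ge>0. \<forall>t\<ge>1. (\<integral>\<^sup>+\<omega>. ennreal (norm (x t \<omega>) ^ 4) \<partial>M) \<le> ennreal Q"
proof -
  define Q where "Q = (\<integral>\<^sup>+y. ennreal (spiked s \<rho> u y) * ennreal (norm y ^ 4) \<partial>lborel)"
  have "ennreal (spiked s \<rho> u y) * ennreal (norm y ^ 4) \<le>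
     of_nat (card (Basis::(real^'k) set)) * (\<Sum>b\<in>Basis. ennreal (spiked s \<rho> u y) * ennreal ((b \<bullet> y) ^ 4))" for y
  proof -
    have "norm y ^ 4 = (\<Sum>b\<in>Basis. (b \<bullet> y)\<^sup>2 * 1)\<^sup>2"
      using norm_sq_eq_sum_Basis[of y] by (simp add: power_mult[symmetric] inner_commute numeral_eq_Suc flip: power_mult)
    also have "\<dots> \<le> (\<Sum>b\<in>(Basis::(real^'k) set). ((b \<bullet> y)\<^sup>2)\<^sup>2) * (\<Sum>b\<in>(Basis::(real^'k) set). 1\<^sup>2)"
      by (rule Cauchy_Schwarz_ineq_sum)
    finally have "norm y ^ 4 \<le> real (card (Basis::(real^'k) set)) * (\<Sum>b\<in>Basis. (b \<bullet> y) ^ 4)"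
      by (simp add: mult.commute)
    then have "ennreal (norm y ^ 4) \<le> ennreal (real (card (Basis::(real^'k) set)) * (\<Sum>b\<in>Basis. (b \<bullet> y) ^ 4))"
      by (rule ennreal_leI)
    also have "\<dots> = of_nat (card (Basis::(real^'k) set)) * (\<Sum>b\<in>Basis. ennreal ((b \<bullet> y) ^ 4))"
      by (subst ennreal_mult') (simp_all add: ennreal_of_nat_eq_real_of_nat)
    finally have "ennreal (spiked s \<rho> u y) * ennreal (norm y ^ 4) \<le> ennreal (spiked s \<rho> u y) *
        (of_nat (card (Basis::(real^'k) set)) * (\<Sum>b\<in>Basis. ennreal ((b \<bullet> y) ^ 4)))"
      by (rule mult_left_mono) simp
    then show ?thesis by (simp only: sum_distrib_left mult.left_commute)
  qed
  then have "Q \<le> (\<integral>\<^sup>+y. of_nat (card (Basis::(real^'k) set)) * (\<Sum>b\<in>Basis. ennreal (spiked s \<rho> u y) * ennreal ((b \<bullet> y) ^ 4)) \<partial>lborel)"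
    unfolding Q_def by (intro nn_integral_mono)
  also have "\<dots> = of_nat (card (Basis::(real^'k) set)) * (\<Sum>b\<in>Basis. \<integral>\<^sup>+y. ennreal (spiked s \<rho> u y) * ennreal ((b \<bullet> y) ^ 4) \<partial>lborel)"
    by (subst nn_integral_cmult, measurable) (subst nn_integral_sum, auto)
  also have "\<dots> < \<infinity>"
    using nn_integral_spiked_inner_moments(2)[OF s \<rho> u] by (auto simp: ennreal_mult_less_top of_nat_less_top)
  finally have "Q = ennreal (enn2real Q)" by (simp add: less_top[symmetric])
  moreover have "(\<integral>\<^sup>+\<omega>. ennreal (norm (x t \<omega>) ^ 4) \<partial>M) = Q" if "t \<ge> 1" for t
    unfolding Q_def by (rule iid_nn_integral[OF iid that]) measurable
  ultimately show ?thesis by (intro exI[of _ "enn2real Q"]) auto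
qed

text \<open>Replacing the estimated direction by the true one costs, on average, an amount that vanishes as
  the window grows: the fourth moment controls both the entries of the sample covariance matrix
  (by Chebyshev's argument) and the final projection.\<close>

lemma proj_stat_mean_error:
  "\<exists>K\<ge>0. \<forall>w>0. \<forall>t\<ge>1.
    (\<integral>\<^sup>+\<omega>. ennreal \<bar>proj_stat w (\<lambda>i. x i \<omega>) t - (u \<bullet> x t \<omega>)\<^sup>2\<bar> \<partial>M) \<le> ennreal (K / sqrt (sqrt (real w)))"
proof -
  interpret prob_space M by (rule iid_prob_space[OF iid])
  obtain Q where Q: "Q \<ge> 0" "\<And>t. t \<ge> 1 \<Longrightarrow> (\<integral>\<^sup>+\<omega>. ennreal (norm (x t \<omega>) ^ 4) \<partial>M) \<le> ennreal Q"
    using spiked_fourth_moment by auto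
  define r where "r = s\<^sup>2 * \<rho>"
  have r: "r > 0" using s \<rho> by (simp add: r_def)
  \<comment> \<open>the entries of the covariance matrix and the centred products that estimate them\<close>
  define C where "C a b = s\<^sup>2 * (axis a 1 \<bullet> (axis b 1 :: real^'k) + \<rho> * (axis a 1 \<bullet> u) * (axis b 1 \<bullet> u))" for a b
  define Z where "Z a b i \<omega> = x i \<omega> $ a * x i \<omega> $ b - C a b" for a b i \<omega>
  have comp: "(y::real^'k) $ a = axis a 1 \<bullet> y" for y a by (simp add: inner_axis')
  have Z: "integrable M (Z a b i)" "expectation (Z a b i) = 0" "integrable M (\<lambda>\<omega>. (Z a b i \<omega>)\<^sup>2)"
    "expectation (\<lambda>\<omega>. (Z a b i \<omega>)\<^sup>2) \<le> Q" if i: "i \<ge> 1" for a b i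
  proof -
    note [measurable] = iid_measurable[OF iid i]
    have [measurable]: "(\<lambda>\<omega>. x i \<omega> $ c) \<in> borel_measurable M" for c
      unfolding comp by measurable
    let ?X = "\<lambda>\<omega>. x i \<omega> $ a * x i \<omega> $ b"
    have iX: "integrable M ?X" "expectation ?X = C a b"
      using spiked_second_moment[OF i, of "axis a 1" "axis b 1"] by (simp_all add: comp C_def)
    moreover have "Z a b i = (\<lambda>\<omega>. ?X \<omega> - C a b)" by (simp add: Z_def fun_eq_iff)
    ultimately show "integrable M (Z a b i)" "expectation (Z a b i) = 0"
      by (auto simp: prob_space)
    have le: "(?X \<omega>)\<^sup>2 \<le> norm (x i \<omega>) ^ 4" for \<omega>
    proof -
      have "\<bar>?X \<omega>\<bar> \<le> norm (x i \<omega>) * norm (x i \<omega>)"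
        unfolding abs_mult by (intro mult_mono component_le_norm_cart) auto
      then have "\<bar>?X \<omega>\<bar>\<^sup>2 \<le> (norm (x i \<omega>) * norm (x i \<omega>))\<^sup>2" by (intro power_mono) auto
      then show ?thesis by (simp add: power2_eq_square power4_eq_xxxx mult_ac)
    qed
    have nn: "(\<integral>\<^sup>+\<omega>. ennreal ((?X \<omega>)\<^sup>2) \<partial>M) \<le> ennreal Q"
      by (rule order_trans[OF nn_integral_mono Q(2)[OF i]]) (simp add: le ennreal_leI)
    then have iX2: "integrable M (\<lambda>\<omega>. (?X \<omega>)\<^sup>2)"
      by (intro integrableI_nonneg) (auto intro: le_less_trans)
    have "expectation (\<lambda>\<omega>. (?X \<omega>)\<^sup>2) \<le> Q"
      using nn Q(1) by (subst (asm) nn_integral_eq_integral[OF iX2]) auto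
    moreover have sq: "(\<lambda>\<omega>. (Z a b i \<omega>)\<^sup>2) = (\<lambda>\<omega>. (?X \<omega>)\<^sup>2 - 2 * C a b * ?X \<omega> + (C a b)\<^sup>2)"
      by (auto simp: Z_def power2_diff fun_eq_iff algebra_simps)
    moreover have "integrable M (\<lambda>\<omega>. (?X \<omega>)\<^sup>2 - 2 * C a b * ?X \<omega> + (C a b)\<^sup>2)"
      using iX iX2 by (intro Bochner_Integration.integrable_add Bochner_Integration.integrable_diff integrable_mult_right) auto
    moreover have "expectation (\<lambda>\<omega>. (?X \<omega>)\<^sup>2 - 2 * C a b * ?X \<omega> + (C a b)\<^sup>2)
        = expectation (\<lambda>\<omega>. (?X \<omega>)\<^sup>2) - 2 * C a b * C a b + (C a b)\<^sup>2"
      using iX iX2 by (simp add: prob_space mult.assoc)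
    ultimately show "integrable M (\<lambda>\<omega>. (Z a b i \<omega>)\<^sup>2)" "expectation (\<lambda>\<omega>. (Z a b i \<omega>)\<^sup>2) \<le> Q"
      by (auto simp: power2_eq_square) (smt (verit) zero_le_square)
  qed
  have Zind: "indep_vars (\<lambda>_. borel) (Z a b) {t+1..t+w}" for a b t w
    unfolding Z_def
    by (rule indep_vars_compose2[OF indep_vars_subset[OF iid_indep[OF iid]], where Y="\<lambda>_ y. y $ a * y $ b - C a b"]) auto
  define e where "e w t a b \<omega> = \<bar>\<Sum>i=t+1..t+w. Z a b i \<omega>\<bar> / real w" for w t a b \<omega>
  have e_int: "(\<integral>\<^sup>+\<omega>. ennreal (e w t a b \<omega>) \<partial>M) \<le> ennreal ((Q + 1) / sqrt (real w))" if w: "w > 0" for w t a b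
  proof -
    let ?S = "\<lambda>\<omega>. \<Sum>i=t+1..t+w. Z a b i \<omega>"
    have S: "integrable M (\<lambda>\<omega>. (?S \<omega>)\<^sup>2)" "expectation (\<lambda>\<omega>. (?S \<omega>)\<^sup>2) \<le> real w * Q"
      using sum_indep_centred_second_moment[OF _ Zind[of a b t w], of Q] Z by auto
    define v where "v = sqrt (real w)"
    have v: "v > 0" "real w = v\<^sup>2" using w by (auto simp: v_def)
    have "e w t a b \<omega> \<le> (?S \<omega>)\<^sup>2 * (1 / (v\<^sup>2 * v)) + 1 / v" for \<omega>
    proof -
      define z where "z = \<bar>?S \<omega>\<bar>"
      have "0 \<le> (z - v)\<^sup>2 + z * v" using v by (intro add_nonneg_nonneg mult_nonneg_nonneg) (auto simp: z_def)
      then have "z * v \<le> z\<^sup>2 + v\<^sup>2" by (simp add: power2_diff mult.commute)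
      then have "z * v / (v\<^sup>2 * v) \<le> (z\<^sup>2 + v\<^sup>2) / (v\<^sup>2 * v)" using v by (intro divide_right_mono) auto
      then have "z / v\<^sup>2 \<le> z\<^sup>2 * (1 / (v\<^sup>2 * v)) + 1 / v" using v by (simp add: add_divide_distrib)
      then show ?thesis by (simp add: e_def v z_def)
    qed
    then have "(\<integral>\<^sup>+\<omega>. ennreal (e w t a b \<omega>) \<partial>M) \<le> (\<integral>\<^sup>+\<omega>. ennreal ((?S \<omega>)\<^sup>2 * (1 / (v\<^sup>2 * v)) + 1 / v) \<partial>M)"
      by (intro nn_integral_mono ennreal_leI)
    also have "\<dots> = ennreal (expectation (\<lambda>\<omega>. (?S \<omega>)\<^sup>2) * (1 / (v\<^sup>2 * v)) + 1 / v)"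
      using v S(1) by (subst nn_integral_eq_integral) (auto simp: prob_space)
    also have "\<dots> \<le> ennreal (v\<^sup>2 * Q * (1 / (v\<^sup>2 * v)) + 1 / v)"
      using S(2) v by (intro ennreal_leI add_mono mult_right_mono) auto
    also have "v\<^sup>2 * Q * (1 / (v\<^sup>2 * v)) + 1 / v = (Q + 1) / v"
      using v by (simp add: add_divide_distrib)
    finally show ?thesis by (simp add: v_def)
  qed
  \<comment> \<open>the sum of the entrywise errors bounds the error of every quadratic form on the unit sphere\<close>
  define E where "E w t \<omega> = (\<Sum>a\<in>UNIV. \<Sum>b\<in>UNIV. e w t a b \<omega>)" for w t \<omega>
  have e_meas[measurable]: "e w t a b \<in> borel_measurable M" for w t a b
  proof -
    have "(\<lambda>\<omega>. \<Sum>i=t+1..t+w. Z a b i \<omega>) \<in> borel_measurable M"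
      using Z(1) by (intro borel_measurable_sum) (auto dest: borel_measurable_integrable)
    then show ?thesis unfolding e_def by measurable
  qed
  have E_nn: "E w t \<omega> \<ge> 0" for w t \<omega> unfolding E_def e_def by (intro sum_nonneg) auto
  define k where "k = real CARD('k)"
  have E_int: "(\<integral>\<^sup>+\<omega>. ennreal (E w t \<omega>) \<partial>M) \<le> ennreal (k\<^sup>2 * ((Q + 1) / sqrt (real w)))" if w: "w > 0" for w t
  proof -
    have "(\<integral>\<^sup>+\<omega>. ennreal (E w t \<omega>) \<partial>M) = (\<integral>\<^sup>+\<omega>. (\<Sum>a\<in>UNIV. \<Sum>b\<in>UNIV. ennreal (e w t a b \<omega>)) \<partial>M)"
      unfolding E_def by (intro nn_integral_cong) (simp add: e_def sum_nonneg)
    also have "\<dots> = (\<Sum>a\<in>UNIV. \<Sum>b\<in>UNIV. \<integral>\<^sup>+\<omega>. ennreal (e w t a b \<omega>) \<partial>M)"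
      by (simp add: nn_integral_sum)
    also have "\<dots> \<le> (\<Sum>a\<in>(UNIV::'k set). \<Sum>b\<in>(UNIV::'k set). ennreal ((Q + 1) / sqrt (real w)))"
      by (intro sum_mono e_int w)
    also have "\<dots> = ennreal (k\<^sup>2 * ((Q + 1) / sqrt (real w)))"
      by (simp only: sum_constant ennreal_of_nat_eq_real_of_nat k_def power2_eq_square mult.assoc ennreal_mult'
          of_nat_0_le_iff)
    finally show ?thesis .
  qed
  have dev: "\<bar>y \<bullet> (scatter (\<lambda>i. x i \<omega>) (t+1) (t+w) *v y) / real w - (s\<^sup>2 + r * (u \<bullet> y)\<^sup>2)\<bar> \<le> E w t \<omega>"
    if y: "norm y = 1" and w: "w > 0" for y w t \<omega>
  proof -
    have exp: "(z \<bullet> y)\<^sup>2 = (\<Sum>a\<in>UNIV. \<Sum>b\<in>UNIV. y $ a * y $ b * (z $ a * z $ b))" for z :: "real^'k"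
      by (simp add: inner_vec_def power2_eq_square sum_product mult_ac)
    have Cy: "(\<Sum>a\<in>UNIV. \<Sum>b\<in>UNIV. y $ a * y $ b * C a b) = s\<^sup>2 + r * (u \<bullet> y)\<^sup>2"
    proof -
      have C: "C a b = s\<^sup>2 * (if a = b then 1 else 0) + r * (u $ a * u $ b)" for a b
      proof -
        have "axis a 1 \<bullet> (axis b 1 :: real^'k) = (if a = b then 1 else 0)" by (simp add: inner_axis_axis)
        then show ?thesis unfolding C_def r_def comp[of u] by (simp add: algebra_simps)
      qed
      have "(\<Sum>a\<in>UNIV. \<Sum>b\<in>UNIV. y $ a * y $ b * C a b)
        = s\<^sup>2 * (\<Sum>a\<in>UNIV. \<Sum>b\<in>UNIV. if a = b then y $ a * y $ b else 0) + r * (\<Sum>a\<in>UNIV. \<Sum>b\<in>UNIV. y $ a * y $ b * (u $ a * u $ b))"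
        unfolding C sum_distrib_left sum.distrib[symmetric] by (intro sum.cong refl) (auto simp: algebra_simps)
      also have "(\<Sum>a\<in>UNIV. \<Sum>b\<in>UNIV. if a = b then y $ a * y $ b else 0) = y \<bullet> y"
        by (simp add: inner_vec_def)
      also have "y \<bullet> y = 1" using y by (simp add: norm_eq_1)
      finally show ?thesis by (simp add: exp)
    qed
    have "y \<bullet> (scatter (\<lambda>i. x i \<omega>) (t+1) (t+w) *v y) - real w * (s\<^sup>2 + r * (u \<bullet> y)\<^sup>2)
       = (\<Sum>i=t+1..t+w. (x i \<omega> \<bullet> y)\<^sup>2 - (s\<^sup>2 + r * (u \<bullet> y)\<^sup>2))"
      by (simp add: inner_scatter_mult power2_eq_square sum_subtractf)
    also have "\<dots> = (\<Sum>i=t+1..t+w. \<Sum>a\<in>UNIV. \<Sum>b\<in>UNIV. y $ a * y $ b * Z a b i \<omega>)"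
      unfolding exp[of "x _ \<omega>"] Cy[symmetric] Z_def by (simp add: sum_subtractf[symmetric] right_diff_distrib)
    also have "\<dots> = (\<Sum>a\<in>UNIV. \<Sum>i=t+1..t+w. \<Sum>b\<in>UNIV. y $ a * y $ b * Z a b i \<omega>)"
      by (rule sum.swap)
    also have "\<dots> = (\<Sum>a\<in>UNIV. \<Sum>b\<in>UNIV. \<Sum>i=t+1..t+w. y $ a * y $ b * Z a b i \<omega>)"
      by (intro sum.cong refl sum.swap)
    also have "\<dots> = (\<Sum>a\<in>UNIV. \<Sum>b\<in>UNIV. y $ a * y $ b * (\<Sum>i=t+1..t+w. Z a b i \<omega>))"
      by (simp add: sum_distrib_left)
    finally have "\<bar>y \<bullet> (scatter (\<lambda>i. x i \<omega>) (t+1) (t+w) *v y) - real w * (s\<^sup>2 + r * (u \<bullet> y)\<^sup>2)\<bar>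
       \<le> (\<Sum>a\<in>UNIV. \<Sum>b\<in>UNIV. \<bar>y $ a * y $ b * (\<Sum>i=t+1..t+w. Z a b i \<omega>)\<bar>)"
      by (simp only:) (intro order_trans[OF sum_abs] sum_mono sum_abs)
    also have "\<dots> \<le> (\<Sum>a\<in>UNIV. \<Sum>b\<in>UNIV. real w * e w t a b \<omega>)"
    proof (intro sum_mono)
      fix a b
      have "\<bar>y $ a\<bar> * \<bar>y $ b\<bar> \<le> 1 * 1"
        using y component_le_norm_cart[of y a] component_le_norm_cart[of y b] by (intro mult_mono) auto
      then have "\<bar>y $ a\<bar> * \<bar>y $ b\<bar> * \<bar>\<Sum>i=t+1..t+w. Z a b i \<omega>\<bar> \<le> 1 * \<bar>\<Sum>i=t+1..t+w. Z a b i \<omega>\<bar>"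
        by (intro mult_right_mono) auto
      then show "\<bar>y $ a * y $ b * (\<Sum>i=t+1..t+w. Z a b i \<omega>)\<bar> \<le> real w * e w t a b \<omega>"
        using w by (simp add: e_def abs_mult)
    qed
    also have "\<dots> = real w * E w t \<omega>" by (simp add: E_def sum_distrib_left)
    finally have "\<bar>y \<bullet> (scatter (\<lambda>i. x i \<omega>) (t+1) (t+w) *v y) - real w * (s\<^sup>2 + r * (u \<bullet> y)\<^sup>2)\<bar> / real w \<le> real w * E w t \<omega> / real w"
      by (intro divide_right_mono) auto
    also have "\<bar>y \<bullet> (scatter (\<lambda>i. x i \<omega>) (t+1) (t+w) *v y) - real w * (s\<^sup>2 + r * (u \<bullet> y)\<^sup>2)\<bar> / real w
       = \<bar>(y \<bullet> (scatter (\<lambda>i. x i \<omega>) (t+1) (t+w) *v y) - real w * (s\<^sup>2 + r * (u \<bullet> y)\<^sup>2)) / real w\<bar>"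
      by (simp add: abs_divide)
    finally show ?thesis using w by (simp add: diff_divide_distrib)
  qed
  have pw: "\<bar>proj_stat w (\<lambda>i. x i \<omega>) t - (u \<bullet> x t \<omega>)\<^sup>2\<bar> \<le> \<kappa> * norm (x t \<omega>) ^ 4 + 2 / (r * \<kappa>) * E w t \<omega>"
    if w: "w > 0" and \<kappa>: "\<kappa> > 0" for w t \<omega> \<kappa>
  proof -
    obtain v where v: "rayleigh_max (scatter (\<lambda>i. x i \<omega>) (t+1) (t+w)) v"
      "proj_stat w (\<lambda>i. x i \<omega>) t = (v \<bullet> x t \<omega>)\<^sup>2"
      using top_proj_sq_attained unfolding proj_stat_def by blast
    have nv: "norm v = 1" using v by (simp add: rayleigh_max_def)
    have "1 - (u \<bullet> v)\<^sup>2 \<le> 2 * E w t \<omega> / r"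
      using w by (intro rayleigh_max_angle[OF v(1) u _ r, of "real w" "s\<^sup>2"] dev) auto
    then have "(1 - (u \<bullet> v)\<^sup>2) / \<kappa> \<le> 2 * E w t \<omega> / r / \<kappa>" using \<kappa> by (intro divide_right_mono) auto
    also have "\<dots> = 2 / (r * \<kappa>) * E w t \<omega>" by simp
    finally show ?thesis using inner_sq_diff_le[OF u nv \<kappa>, of "x t \<omega>"] v(2) by linarith
  qed
  define K where "K = Q + 2 / r * (k\<^sup>2 * (Q + 1))"
  show ?thesis
  proof (intro exI[of _ K] conjI allI impI)
    show "K \<ge> 0" using Q(1) r by (simp add: K_def)
    fix w t :: nat assume w: "0 < w" and t: "1 \<le> t"
    note [measurable] = iid_measurable[OF iid t]
    have [measurable]: "E w t \<in> borel_measurable M" unfolding E_def by measurable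
    \<comment> \<open>the weight \<open>1 / v\<close> balances the fourth moment term against the covariance error of order \<open>1 / v\<^sup>2\<close>\<close>
    define v where "v = sqrt (sqrt (real w))"
    have v: "v > 0" "sqrt (real w) = v\<^sup>2" using w by (auto simp: v_def)
    have c: "2 / (r * (1 / v)) \<ge> 0" using r v by simp
    have "(\<integral>\<^sup>+\<omega>. ennreal \<bar>proj_stat w (\<lambda>i. x i \<omega>) t - (u \<bullet> x t \<omega>)\<^sup>2\<bar> \<partial>M)
       \<le> (\<integral>\<^sup>+\<omega>. ennreal (1 / v) * ennreal (norm (x t \<omega>) ^ 4) + ennreal (2 / (r * (1 / v))) * ennreal (E w t \<omega>) \<partial>M)"
    proof (intro nn_integral_mono)
      fix \<omega>
      have "ennreal \<bar>proj_stat w (\<lambda>i. x i \<omega>) t - (u \<bullet> x t \<omega>)\<^sup>2\<bar>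
          \<le> ennreal (1 / v * norm (x t \<omega>) ^ 4 + 2 / (r * (1 / v)) * E w t \<omega>)"
        using pw[OF w, of "1 / v"] v by (intro ennreal_leI) auto
      also have "\<dots> = ennreal (1 / v * norm (x t \<omega>) ^ 4) + ennreal (2 / (r * (1 / v)) * E w t \<omega>)"
        using v c E_nn by (intro ennreal_plus mult_nonneg_nonneg) auto
      also have "\<dots> = ennreal (1 / v) * ennreal (norm (x t \<omega>) ^ 4) + ennreal (2 / (r * (1 / v))) * ennreal (E w t \<omega>)"
        using v c E_nn by (intro arg_cong2[where f="(+)"] ennreal_mult) auto
      finally show "ennreal \<bar>proj_stat w (\<lambda>i. x i \<omega>) t - (u \<bullet> x t \<omega>)\<^sup>2\<bar>
          \<le> ennreal (1 / v) * ennreal (norm (x t \<omega>) ^ 4) + ennreal (2 / (r * (1 / v))) * ennreal (E w t \<omega>)" .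
    qed
    also have "\<dots> = ennreal (1 / v) * (\<integral>\<^sup>+\<omega>. ennreal (norm (x t \<omega>) ^ 4) \<partial>M)
        + ennreal (2 / (r * (1 / v))) * (\<integral>\<^sup>+\<omega>. ennreal (E w t \<omega>) \<partial>M)"
      by (subst nn_integral_add, measurable) (subst (1 2) nn_integral_cmult, measurable)
    also have "\<dots> \<le> ennreal (1 / v) * ennreal Q + ennreal (2 / (r * (1 / v))) * ennreal (k\<^sup>2 * ((Q + 1) / v\<^sup>2))"
      using E_int[OF w, of t] Q(2)[OF t] v by (intro add_mono mult_left_mono) auto
    also have "\<dots> = ennreal (1 / v * Q + 2 / (r * (1 / v)) * (k\<^sup>2 * ((Q + 1) / v\<^sup>2)))"
      using v c Q(1) by (simp only: ennreal_plus ennreal_mult mult_nonneg_nonneg divide_nonneg_nonneg zero_le_power2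
          zero_le_one less_imp_le add_nonneg_nonneg)
    also have "1 / v * Q + 2 / (r * (1 / v)) * (k\<^sup>2 * ((Q + 1) / v\<^sup>2)) = K / v"
      using v r by (simp add: K_def field_simps power2_eq_square)
    finally show "(\<integral>\<^sup>+\<omega>. ennreal \<bar>proj_stat w (\<lambda>i. x i \<omega>) t - (u \<bullet> x t \<omega>)\<^sup>2\<bar> \<partial>M) \<le> ennreal (K / sqrt (sqrt (real w)))"
      by (simp add: v_def)
  qed
qed

end

section \<open>Exponential moments of the log-likelihood ratio\<close>

text \<open>For the log-likelihood ratio \<open>L\<close> of two centred normal laws with variance ratio \<open>a\<close>, this is the mean of
  \<open>exp ((1 + c) * L)\<close> under the smaller variance and the mean of \<open>exp (c * L)\<close> under the larger one. The
  two forms serve before and after the change.\<close>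

definition llr_mgf :: "real \<Rightarrow> real \<Rightarrow> real"
  where "llr_mgf a c = exp (- (c / 2) * ln a) / sqrt (1 - c * (a - 1))"

text \<open>The Kullback-Leibler divergence of the two laws, which is the mean of \<open>L\<close> after the change.\<close>

definition kl :: "real \<Rightarrow> real"
  where "kl a = (a - 1 - ln a) / 2"

lemma kl_pos: "a > 1 \<Longrightarrow> kl a > 0"
  using ln_le_minus_one[of a] ln_eq_minus_one[of a] unfolding kl_def by fastforce

lemma llr_mgf_nonneg: "c * (a - 1) \<le> 1 \<Longrightarrow> llr_mgf a c \<ge> 0"
  by (simp add: llr_mgf_def)

lemma minus_ln_one_minus_le:
  fixes y :: real
  assumes "\<bar>y\<bar> \<le> 1 / 2"
  shows "- ln (1 - y) \<le> y + 2 * y\<^sup>2"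
proof (cases "y \<ge> 0")
  case True
  then show ?thesis using ln_one_minus_pos_lower_bound[of y] assms by simp
next
  case False
  then have "- y - (- y)\<^sup>2 \<le> ln (1 + - y)" using assms by (intro ln_one_plus_pos_lower_bound) auto
  then have "- y - y\<^sup>2 \<le> ln (1 - y)" by simp
  then show ?thesis using zero_le_power2[of y] by linarith
qed

text \<open>The slope of the cumulant generating function at zero is the divergence. The explicit quadratic
  remainder makes all later exponential bounds uniform in the variance ratio, which varies with the
  window.\<close>

lemma llr_mgf_le:
  assumes a: "a > 1" and c: "\<bar>c\<bar> * (a - 1) \<le> 1 / 2"
  shows "llr_mgf a c \<le> exp (c * kl a + c\<^sup>2 * (a - 1)\<^sup>2)"
proof -
  define y where "y = c * (a - 1)"
  have y: "\<bar>y\<bar> \<le> 1 / 2" using a c by (simp add: y_def abs_mult)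
  have pos: "1 - y > 0" using y by linarith
  have "exp (- (ln (1 - y) / 2)) = 1 / sqrt (1 - y)"
    unfolding exp_minus ln_sqrt[OF less_imp_le[OF pos], symmetric] using pos by (simp add: inverse_eq_divide)
  then have "llr_mgf a c = exp (- (c / 2) * ln a) * exp (- (ln (1 - y) / 2))"
    unfolding llr_mgf_def y_def[symmetric] by (simp only: times_divide_eq_right mult_1_right)
  also have "\<dots> = exp (- (c / 2) * ln a + - (ln (1 - y) / 2))" by (simp only: exp_add)
  also have "\<dots> \<le> exp (- (c / 2) * ln a + (y + 2 * y\<^sup>2) / 2)"
  proof -
    have "- (ln (1 - y) / 2) \<le> (y + 2 * y\<^sup>2) / 2"
      using divide_right_mono[OF minus_ln_one_minus_le[OF y], of 2] by simp
    then show ?thesis by (simp only: exp_le_cancel_iff add_le_cancel_left)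
  qed
  also have "- (c / 2) * ln a + (y + 2 * y\<^sup>2) / 2 = c * kl a + c\<^sup>2 * (a - 1)\<^sup>2"
  proof -
    have "- (c / 2) * L + (y + 2 * y\<^sup>2) / 2 = c * ((a - 1 - L) / 2) + c\<^sup>2 * (a - 1)\<^sup>2" for L
      by (simp add: y_def power2_eq_square algebra_simps add_divide_distrib diff_divide_distrib)
    then show ?thesis by (simp only: kl_def)
  qed
  finally show ?thesis .
qed

text \<open>The scale and the drift that turn the squares of centred normal variables into log-likelihood ratios
  of two normal laws with variance ratio \<open>a\<close>.\<close>

definition llr_scale :: "real \<Rightarrow> real \<Rightarrow> real"
  where "llr_scale s a = (a - 1) / (2 * s\<^sup>2 * a)"

definition llr_drift :: "real \<Rightarrow> real \<Rightarrow> real"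
  where "llr_drift s a = s\<^sup>2 * a / (a - 1) * ln a"

lemma llr_scale_pos: "s > 0 \<Longrightarrow> a > 1 \<Longrightarrow> llr_scale s a > 0"
  by (simp add: llr_scale_def)

lemma llr_scale_drift:
  assumes "s > 0" "a > 1"
  shows "llr_scale s a * llr_drift s a = ln a / 2"
proof -
  define b where "b = a - 1"
  have "b \<noteq> 0" using assms by (simp add: b_def)
  then show ?thesis
    using assms unfolding llr_scale_def llr_drift_def b_def[symmetric] by simp
qed

lemma nn_integral_normal_llr:
  assumes s: "s > 0" and a: "a > 1" and c: "c * (a - 1) < 1"
  shows "(\<integral>\<^sup>+z. ennreal (normal_density 0 s z) * ennreal (exp ((1 + c) * (llr_scale s a * (z\<^sup>2 - llr_drift s a)))) \<partial>lborel)
    = ennreal (llr_mgf a c)"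
proof -
  define l where "l = (1 + c) * llr_scale s a"
  have l: "1 - 2 * l * s\<^sup>2 = (1 - c * (a - 1)) / a"
    using s a by (simp add: l_def llr_scale_def field_simps)
  have "(1 - c * (a - 1)) / a > 0" using a c by simp
  then have l1: "2 * l * s\<^sup>2 < 1" using l by linarith
  have "(\<integral>\<^sup>+z. ennreal (normal_density 0 s z) * ennreal (exp ((1 + c) * (llr_scale s a * (z\<^sup>2 - llr_drift s a)))) \<partial>lborel)
    = (\<integral>\<^sup>+z. ennreal (exp (- ((1 + c) * (ln a / 2)))) * (ennreal (normal_density 0 s z) * ennreal (exp (l * z\<^sup>2))) \<partial>lborel)"
  proof (intro nn_integral_cong)
    fix z
    have "(1 + c) * (llr_scale s a * (z\<^sup>2 - llr_drift s a)) = - ((1 + c) * (ln a / 2)) + l * z\<^sup>2"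
      unfolding llr_scale_drift[OF s a, symmetric] l_def by (simp add: algebra_simps)
    then have "ennreal (exp ((1 + c) * (llr_scale s a * (z\<^sup>2 - llr_drift s a))))
      = ennreal (exp (- ((1 + c) * (ln a / 2)))) * ennreal (exp (l * z\<^sup>2))"
      by (simp only: exp_add ennreal_mult' exp_ge_zero)
    then show "ennreal (normal_density 0 s z) * ennreal (exp ((1 + c) * (llr_scale s a * (z\<^sup>2 - llr_drift s a))))
      = ennreal (exp (- ((1 + c) * (ln a / 2)))) * (ennreal (normal_density 0 s z) * ennreal (exp (l * z\<^sup>2)))"
      by (simp only: mult.left_commute)
  qed
  also have "\<dots> = ennreal (exp (- ((1 + c) * (ln a / 2)))) * ennreal (1 / sqrt (1 - 2 * l * s\<^sup>2))"
    by (simp add: nn_integral_cmult nn_integral_normal_exp_sq[OF s l1])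
  also have "\<dots> = ennreal (exp (- ((1 + c) * (ln a / 2))) * (1 / sqrt ((1 - c * (a - 1)) / a)))"
    unfolding l by (rule ennreal_mult'[symmetric]) simp
  also have "exp (- ((1 + c) * (ln a / 2))) * (1 / sqrt ((1 - c * (a - 1)) / a)) = llr_mgf a c"
  proof -
    have "exp (- ((1 + c) * (ln a / 2))) = exp (- (c / 2) * ln a) * exp (- (ln a / 2))"
      unfolding exp_add[symmetric] by (simp add: algebra_simps add_divide_distrib)
    moreover have "exp (ln a / 2) = sqrt a"
      using a by (simp add: ln_sqrt[symmetric])
    ultimately show ?thesis
      using a by (simp add: llr_mgf_def real_sqrt_divide exp_minus field_simps)
  qed
  finally show ?thesis .
qed

lemma llr_mgf_0: "llr_mgf a 0 = 1"
  by (simp add: llr_mgf_def)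

section \<open>Average run length\<close>

text \<open>The increments of a CUSUM procedure that looks \<open>w\<close> steps ahead. Blocks of increments that are
  separated by gaps of length \<open>w\<close> are functions of disjoint sets of observations.\<close>

definition window_stat :: "nat \<Rightarrow> ((nat \<Rightarrow> real^'k) \<Rightarrow> nat \<Rightarrow> real) \<Rightarrow> bool"
  where "window_stat w g \<longleftrightarrow>
    (\<forall>z z' t. (\<forall>i\<in>{t..t+w}. z i = z' i) \<longrightarrow> g z t = g z' t) \<and>
    (\<forall>K t. {t..t+w} \<subseteq> K \<longrightarrow> (\<lambda>z. g z t) \<in> borel_measurable (PiM K (\<lambda>_. borel)))"

lemma window_stat_cong:
  assumes "window_stat w g" "\<And>i. i \<in> {t..t+w} \<Longrightarrow> z i = z' i"
  shows "g z t = g z' t"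
proof -
  have "\<forall>z z' t. (\<forall>i\<in>{t..t+w}. z i = z' i) \<longrightarrow> g z t = g z' t"
    using assms(1) unfolding window_stat_def by (rule conjunct1)
  from this[rule_format, of t z z'] assms(2) show ?thesis by blast
qed

lemma window_stat_PiM:
  assumes "window_stat w g" "{t..t+w} \<subseteq> K"
  shows "(\<lambda>z. g z t) \<in> borel_measurable (PiM K (\<lambda>_. borel))"
proof -
  have "\<forall>K t. {t..t+w} \<subseteq> K \<longrightarrow> (\<lambda>z. g z t) \<in> borel_measurable (PiM K (\<lambda>_. borel))"
    using assms(1) unfolding window_stat_def by (rule conjunct2)
  from this[rule_format, OF assms(2)] show ?thesis .
qed

lemma window_stat_proj_stat: "window_stat w (\<lambda>z t. c * (proj_stat w z t - d))"
  unfolding window_stat_def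
proof (intro conjI allI impI)
  fix z z' :: "nat \<Rightarrow> real^'n" and t
  assume "\<forall>i\<in>{t..t+w}. z i = z' i"
  then have "proj_stat w z t = proj_stat w z' t" by (intro proj_stat_cong) auto
  then show "c * (proj_stat w z t - d) = c * (proj_stat w z' t - d)" by simp
next
  fix K :: "nat set" and t assume "{t..t+w} \<subseteq> K"
  then have [measurable]: "(\<lambda>z. proj_stat w z t) \<in> borel_measurable (PiM K (\<lambda>_. borel))"
    by (intro borel_measurable_proj_stat measurable_component_singleton) auto
  show "(\<lambda>z. c * (proj_stat w z t - d)) \<in> borel_measurable (PiM K (\<lambda>_. borel))" by measurable
qed

lemma window_stat_inner: "window_stat 0 (\<lambda>z t. c * ((u \<bullet> z t)\<^sup>2 - d))"
  unfolding window_stat_def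
proof (intro conjI allI impI)
  fix K :: "nat set" and t assume "{t..t+0} \<subseteq> K"
  then have [measurable]: "(\<lambda>z. z t) \<in> borel_measurable (PiM K (\<lambda>_. borel))"
    by (intro measurable_component_singleton) auto
  show "(\<lambda>z. c * ((u \<bullet> z t)\<^sup>2 - d)) \<in> borel_measurable (PiM K (\<lambda>_. borel))" by measurable
qed auto

lemma window_stat_measurable:
  assumes iid: "iid_density M x f" and g: "window_stat w g" and t: "t \<ge> 1"
  shows "(\<lambda>\<omega>. g (\<lambda>i. x i \<omega>) t) \<in> borel_measurable M"
proof -
  have X: "(\<lambda>\<omega>. restrict (\<lambda>i. x i \<omega>) {t..t+w}) \<in> measurable M (PiM {t..t+w} (\<lambda>_. borel))"
    using t by (intro measurable_restrict iid_measurable[OF iid]) auto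
  have "(\<lambda>z. g z t) \<in> borel_measurable (PiM {t..t+w} (\<lambda>_. borel))"
    by (rule window_stat_PiM[OF g]) simp
  from measurable_compose[OF X this]
  have "(\<lambda>\<omega>. g (restrict (\<lambda>i. x i \<omega>) {t..t+w}) t) \<in> borel_measurable M" .
  moreover have "g (restrict (\<lambda>i. x i \<omega>) {t..t+w}) t = g (\<lambda>i. x i \<omega>) t" for \<omega>
    by (rule window_stat_cong[OF g]) simp
  ultimately show ?thesis by simp
qed

text \<open>Each period of length \<open>m + w\<close> uses \<open>m\<close> increments and leaves a gap of \<open>w\<close>, so that the periods are
  independent; a sum of at least \<open>B\<close> inside one block forces an alarm.\<close>

lemma window_cusum_time_blocks_le:
  assumes iid: "iid_density M x f" and g: "window_stat w g" and m: "m > 0" and q: "0 \<le> q" "q < 1"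
    and miss: "\<And>j. measure M {\<omega>\<in>space M. (\<Sum>t=j+1..j+m. g (\<lambda>i. x i \<omega>) t) < B} \<le> q"
  shows "expected_time M (\<lambda>\<omega>. cusum_time (g (\<lambda>i. x i \<omega>)) B) \<le> ennreal (real (m + w) / (1 - q))"
proof (rule expected_time_blocks_le[where x=x and S=borel and W="\<lambda>j z. B \<le> (\<Sum>t=j*(m+w)+1..j*(m+w)+m. g z t)"])
  let ?N = "m + w"
  show "prob_space M" by (rule iid_prob_space[OF iid])
  show "prob_space.indep_vars M (\<lambda>_. borel) x {1..}" by (rule iid_indep[OF iid])
  show "(\<lambda>\<omega>. cusum_time (g (\<lambda>i. x i \<omega>)) B) \<in> measurable M (count_space UNIV)"
    by (rule measurable_cusum_time) (rule window_stat_measurable[OF iid g])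
  show "0 < m + w" using m by simp
  show "Measurable.pred (PiM {j*?N+1..j*?N+?N} (\<lambda>_. borel)) (\<lambda>z. B \<le> (\<Sum>t=j*?N+1..j*?N+m. g z t))" for j
  proof -
    have "(\<lambda>z. g z t) \<in> borel_measurable (PiM {j*?N+1..j*?N+?N} (\<lambda>_. borel))" if "t \<in> {j*?N+1..j*?N+m}" for t
    proof -
      have "{t..t+w} \<subseteq> {j*?N+1..j*?N+?N}" using that by auto
      then show ?thesis by (rule window_stat_PiM[OF g])
    qed
    then have [measurable]: "(\<lambda>z. \<Sum>t=j*?N+1..j*?N+m. g z t) \<in> borel_measurable (PiM {j*?N+1..j*?N+?N} (\<lambda>_. borel))"
      by (rule borel_measurable_sum)
    show ?thesis by measurable
  qed
  have sum_eq: "(\<Sum>t=j*?N+1..j*?N+m. g (restrict (\<lambda>i. x i \<omega>) {j*?N+1..j*?N+?N}) t)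
      = (\<Sum>t=j*?N+1..j*?N+m. g (\<lambda>i. x i \<omega>) t)" for j \<omega>
  proof (intro sum.cong refl)
    fix t assume "t \<in> {j*?N+1..j*?N+m}"
    then show "g (restrict (\<lambda>i. x i \<omega>) {j*?N+1..j*?N+?N}) t = g (\<lambda>i. x i \<omega>) t"
      by (intro window_stat_cong[OF g]) auto
  qed
  show "measure M {\<omega>\<in>space M. \<not> B \<le> (\<Sum>t=j*?N+1..j*?N+m. g (restrict (\<lambda>i. x i \<omega>) {j*?N+1..j*?N+?N}) t)} \<le> q" for j
    unfolding sum_eq not_le by (rule miss)
  show "cusum_time (g (\<lambda>i. x i \<omega>)) B \<le> enat (j*?N+?N)"
    if "B \<le> (\<Sum>t=j*?N+1..j*?N+m. g (restrict (\<lambda>i. x i \<omega>) {j*?N+1..j*?N+?N}) t)" for j \<omega>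
    using that m unfolding sum_eq cusum_time_le_iff_segment
    by (intro exI[of _ "j*?N+1"] exI[of _ "j*?N+m"]) auto
qed (use q in auto)

lemma (in prob_space) arl_ge:
  assumes ind: "indep_vars (\<lambda>_. borel) L {1..}"
    and one: "\<And>t. t \<ge> 1 \<Longrightarrow> (\<integral>\<^sup>+\<omega>. ennreal (exp (L t \<omega>)) \<partial>M) = 1"
  shows "ennreal (exp B / 4 - 1 / 2) \<le> expected_time M (\<lambda>\<omega>. cusum_time (\<lambda>t. L t \<omega>) B)"
proof -
  \<comment> \<open>up to this time the false alarm probability is at most one half\<close>
  define n where "n = nat \<lfloor>exp B / 2\<rfloor>"
  have "0 \<le> \<lfloor>exp B / 2\<rfloor>" by simp
  then have "real n = of_int \<lfloor>exp B / 2\<rfloor>" by (simp add: n_def)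
  then have n: "real n \<le> exp B / 2" "exp B / 2 - 1 \<le> real n" by linarith+
  have "real n * exp (- B) \<le> exp B / 2 * exp (- B)" using n by (intro mult_right_mono) auto
  also have "\<dots> = 1 / 2" by (simp add: exp_minus)
  finally have "prob {\<omega>\<in>space M. cusum_time (\<lambda>t. L t \<omega>) B \<le> enat n} \<le> 1 / 2"
    using cusum_false_alarm[OF ind one, of B n] by linarith
  then have "ennreal (real n * (1 - 1 / 2)) \<le> expected_time M (\<lambda>\<omega>. cusum_time (\<lambda>t. L t \<omega>) B)"
    using ind by (intro expected_time_ge measurable_cusum_time) (auto simp: indep_vars_def intro: prob_space_axioms)
  moreover have "exp B / 4 - 1 / 2 \<le> real n * (1 - 1 / 2)" using n by simp
  ultimately show ?thesis by (meson ennreal_leI order_trans)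
qed

text \<open>A block of length \<open>m\<close> whose drift after the change would reach \<open>B\<close> causes a false alarm with
  probability at least \<open>exp (- m * (I + \<eta>)) / 2\<close>: tilting by the likelihood ratio of the block turns the
  false alarm into a typical event.\<close>

lemma arl_le:
  fixes x :: "nat \<Rightarrow> 'a \<Rightarrow> real^'k"
  assumes iid: "iid_density M x f" and g: "window_stat w g" and m: "m > 0"
    and ind: "prob_space.indep_vars M (\<lambda>_. borel) (\<lambda>t \<omega>. g (\<lambda>i. x i \<omega>) t) {1..}"
    and mgf: "\<And>t c. t \<ge> 1 \<Longrightarrow> c * (a - 1) < 1 \<Longrightarrow>
      (\<integral>\<^sup>+\<omega>. ennreal (exp ((1 + c) * g (\<lambda>i. x i \<omega>) t)) \<partial>M) = ennreal (llr_mgf a c)"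
    and a: "a > 1" and s: "s > 0" "s * (a - 1) \<le> 1 / 2"
    and up: "llr_mgf a s \<le> exp (s * (I + \<eta> / 2))" and lo: "llr_mgf a (- s) \<le> exp (- s * (I - \<eta> / 2))"
    and \<eta>: "\<eta> > 0" and large: "exp (- (real m * s * \<eta> / 2)) \<le> 1 / 4" and B: "B \<le> real m * (I - \<eta>)"
    and I: "I > 0"
  shows "expected_time M (\<lambda>\<omega>. cusum_time (g (\<lambda>i. x i \<omega>)) B) \<le> ennreal (2 * real (m + w) * exp (real m * (I + \<eta>)))"
proof -
  interpret prob_space M by (rule iid_prob_space[OF iid])
  define p where "p = exp (- (real m * (I + \<eta>))) / 2"
  have "exp (- (real m * (I + \<eta>))) \<le> 1" using I \<eta> by simp
  then have p1: "p \<le> 1" unfolding p_def by linarith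
  have p0: "0 < p" unfolding p_def by simp
  have "prob {\<omega>\<in>space M. (\<Sum>t=j+1..j+m. g (\<lambda>i. x i \<omega>) t) < B} \<le> 1 - p" for j
  proof -
    let ?S = "\<lambda>\<omega>. \<Sum>t\<in>{j+1..j+m}. g (\<lambda>i. x i \<omega>) t"
    have S: "?S \<in> borel_measurable M"
      using window_stat_measurable[OF iid g] by (intro borel_measurable_sum) auto
    have pow: "(\<integral>\<^sup>+\<omega>. ennreal (exp ((1 + c) * ?S \<omega>)) \<partial>M) = ennreal (llr_mgf a c ^ m)"
      if "c * (a - 1) < 1" for c
      using nn_integral_exp_sum_indep[OF ind, of "{j+1..j+m}" "1 + c" "llr_mgf a c"] mgf[OF _ that] that
      by (auto simp: llr_mgf_nonneg)
    have "0 < s * (a - 1)" using s a by simp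
    then have sneg: "- s * (a - 1) < 1" unfolding mult_minus_left by linarith
    have "exp (- (real m * (I + \<eta>))) * (1 - exp (real m * s * (I + \<eta> / 2)) * exp (- s * (real m * (I + \<eta>)))
        - exp (- (real m * s * (I - \<eta> / 2))) * exp (s * (real m * (I - \<eta>))))
      \<le> prob {\<omega>\<in>space M. real m * (I - \<eta>) \<le> ?S \<omega>}"
    proof (rule tail_lower_bound_by_tilting)
      show "?S \<in> borel_measurable M" by (rule S)
      show "(\<integral>\<^sup>+\<omega>. ennreal (exp (?S \<omega>)) \<partial>M) = 1" using pow[of 0] by (simp add: llr_mgf_0)
      have "llr_mgf a s ^ m \<le> exp (s * (I + \<eta> / 2)) ^ m"
        using up s by (intro power_mono llr_mgf_nonneg) auto
      also have "\<dots> = exp (real m * s * (I + \<eta> / 2))"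
        by (metis exp_of_nat_mult mult.assoc)
      finally have "ennreal (llr_mgf a s ^ m) \<le> ennreal (exp (real m * s * (I + \<eta> / 2)))" by (rule ennreal_leI)
      moreover have "s * (a - 1) < 1" using s by linarith
      ultimately show "(\<integral>\<^sup>+\<omega>. ennreal (exp ((1 + s) * ?S \<omega>)) \<partial>M) \<le> ennreal (exp (real m * s * (I + \<eta> / 2)))"
        by (simp only: pow)
      have "llr_mgf a (- s) ^ m \<le> exp (- s * (I - \<eta> / 2)) ^ m"
        using lo sneg by (intro power_mono llr_mgf_nonneg) auto
      also have "\<dots> = exp (real m * (- s * (I - \<eta> / 2)))"
        by (metis exp_of_nat_mult)
      also have "real m * (- s * (I - \<eta> / 2)) = - (real m * s * (I - \<eta> / 2))" by simp
      finally have "ennreal (llr_mgf a (- s) ^ m) \<le> ennreal (exp (- (real m * s * (I - \<eta> / 2))))" by (rule ennreal_leI)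
      then have "(\<integral>\<^sup>+\<omega>. ennreal (exp ((1 + - s) * ?S \<omega>)) \<partial>M) \<le> ennreal (exp (- (real m * s * (I - \<eta> / 2))))"
        by (simp only: pow[OF sneg])
      then show "(\<integral>\<^sup>+\<omega>. ennreal (exp ((1 - s) * ?S \<omega>)) \<partial>M) \<le> ennreal (exp (- (real m * s * (I - \<eta> / 2))))"
        by (simp only: add_uminus_conv_diff)
    qed (use s in auto)
    moreover have "exp (real m * s * (I + \<eta> / 2)) * exp (- s * (real m * (I + \<eta>))) = exp (- (real m * s * \<eta> / 2))"
      unfolding exp_add[symmetric] by (simp add: algebra_simps)
    moreover have "exp (- (real m * s * (I - \<eta> / 2))) * exp (s * (real m * (I - \<eta>))) = exp (- (real m * s * \<eta> / 2))"
      unfolding exp_add[symmetric] by (simp add: algebra_simps)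
    ultimately have "exp (- (real m * (I + \<eta>))) * (1 - exp (- (real m * s * \<eta> / 2)) - exp (- (real m * s * \<eta> / 2)))
      \<le> prob {\<omega>\<in>space M. real m * (I - \<eta>) \<le> ?S \<omega>}" by simp
    moreover have "exp (- (real m * (I + \<eta>))) * (1 / 2)
        \<le> exp (- (real m * (I + \<eta>))) * (1 - exp (- (real m * s * \<eta> / 2)) - exp (- (real m * s * \<eta> / 2)))"
      using large by (intro mult_left_mono) auto
    moreover have "prob {\<omega>\<in>space M. real m * (I - \<eta>) \<le> ?S \<omega>} \<le> prob {\<omega>\<in>space M. B \<le> ?S \<omega>}"
      using B borel_measurable_le[OF borel_measurable_const[of B] S] by (intro finite_measure_mono) auto
    ultimately have "p \<le> prob {\<omega>\<in>space M. B \<le> ?S \<omega>}" unfolding p_def by linarith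
    moreover have "{\<omega>\<in>space M. ?S \<omega> < B} = space M - {\<omega>\<in>space M. B \<le> ?S \<omega>}" by auto
    then have "prob {\<omega>\<in>space M. ?S \<omega> < B} = 1 - prob {\<omega>\<in>space M. B \<le> ?S \<omega>}"
      using prob_compl[OF borel_measurable_le[OF borel_measurable_const[of B] S]] by simp
    ultimately show ?thesis by simp
  qed
  then have "expected_time M (\<lambda>\<omega>. cusum_time (g (\<lambda>i. x i \<omega>)) B) \<le> ennreal (real (m + w) / (1 - (1 - p)))"
    by (rule window_cusum_time_blocks_le[OF iid g m, rotated -1]) (use p0 p1 in auto)
  also have "real (m + w) / (1 - (1 - p)) = 2 * real (m + w) * exp (real m * (I + \<eta>))"
  proof -
    have "real (m + w) / (1 - (1 - p)) = 2 * real (m + w) / exp (- (real m * (I + \<eta>)))"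
      unfolding p_def by simp
    also have "\<dots> = 2 * real (m + w) * exp (real m * (I + \<eta>))"
      unfolding exp_minus by (simp only: divide_inverse inverse_inverse_eq)
    finally show ?thesis .
  qed
  finally show ?thesis .
qed

section \<open>Detection delay\<close>

context
  fixes M :: "'a measure" and x :: "nat \<Rightarrow> 'a \<Rightarrow> real^'k" and f :: "real^'k \<Rightarrow> real"
    and g :: "(nat \<Rightarrow> real^'k) \<Rightarrow> nat \<Rightarrow> real" and w :: nat and \<Lambda> :: "nat \<Rightarrow> 'a \<Rightarrow> real"
    and a s I \<eta> \<epsilon> :: real
  assumes iid: "iid_density M x f" and g: "window_stat w g"
    and ind: "prob_space.indep_vars M (\<lambda>_. borel) \<Lambda> {1..}"
    and mgf: "\<And>t c. t \<ge> 1 \<Longrightarrow> c * (a - 1) < 1 \<Longrightarrow>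
      (\<integral>\<^sup>+\<omega>. ennreal (exp (c * \<Lambda> t \<omega>)) \<partial>M) = ennreal (llr_mgf a c)"
    and close: "\<And>t. t \<ge> 1 \<Longrightarrow> (\<integral>\<^sup>+\<omega>. ennreal \<bar>g (\<lambda>i. x i \<omega>) t - \<Lambda> t \<omega>\<bar> \<partial>M) \<le> ennreal \<epsilon>"
    and a: "a > 1" and s: "s > 0" "s * (a - 1) \<le> 1 / 2" and I: "I > 0" and \<eta>: "\<eta> > 0" and \<epsilon>: "\<epsilon> \<ge> 0"
begin

interpretation prob_space M by (rule iid_prob_space[OF iid])

lemma stat_measurable: "t \<ge> 1 \<Longrightarrow> (\<lambda>\<omega>. g (\<lambda>i. x i \<omega>) t) \<in> borel_measurable M"
  by (rule window_stat_measurable[OF iid g])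

lemma llr_measurable: "t \<ge> 1 \<Longrightarrow> \<Lambda> t \<in> borel_measurable M"
  using ind by (auto simp: indep_vars_def)

lemma error_sum_tail:
  assumes n: "n > 0" and j: "j \<ge> 1"
  shows "prob {\<omega>\<in>space M. real n * \<eta> \<le> (\<Sum>t=j..<j+n. \<bar>g (\<lambda>i. x i \<omega>) t - \<Lambda> t \<omega>\<bar>)} \<le> \<epsilon> / \<eta>"
proof -
  let ?R = "\<lambda>t \<omega>. \<bar>g (\<lambda>i. x i \<omega>) t - \<Lambda> t \<omega>\<bar>"
  have R: "?R t \<in> borel_measurable M" if "t \<ge> 1" for t
    using stat_measurable[OF that] llr_measurable[OF that] by measurable
  have S: "(\<lambda>\<omega>. \<Sum>t=j..<j+n. ?R t \<omega>) \<in> borel_measurable M"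
    using R j by (intro borel_measurable_sum) auto
  note [measurable] = S
  define c where "c = 1 / (real n * \<eta>)"
  have c: "c \<ge> 0" using n \<eta> by (simp add: c_def)
  have "emeasure M {\<omega>\<in>space M. real n * \<eta> \<le> (\<Sum>t=j..<j+n. ?R t \<omega>)}
     = (\<integral>\<^sup>+\<omega>. indicator {\<omega>\<in>space M. real n * \<eta> \<le> (\<Sum>t=j..<j+n. ?R t \<omega>)} \<omega> \<partial>M)"
    by (subst nn_integral_indicator) auto
  also have "\<dots> \<le> (\<integral>\<^sup>+\<omega>. ennreal c * (\<Sum>t=j..<j+n. ennreal (?R t \<omega>)) \<partial>M)"
  proof (intro nn_integral_mono)
    fix \<omega>
    have "1 \<le> c * (\<Sum>t=j..<j+n. ?R t \<omega>)" if "real n * \<eta> \<le> (\<Sum>t=j..<j+n. ?R t \<omega>)"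
      using that n \<eta> by (simp add: c_def divide_simps)
    then show "indicator {\<omega>\<in>space M. real n * \<eta> \<le> (\<Sum>t=j..<j+n. ?R t \<omega>)} \<omega> \<le> ennreal c * (\<Sum>t=j..<j+n. ennreal (?R t \<omega>))"
      using c by (auto simp: indicator_def sum_nonneg ennreal_mult[symmetric])
  qed
  also have "\<dots> = ennreal c * (\<Sum>t=j..<j+n. \<integral>\<^sup>+\<omega>. ennreal (?R t \<omega>) \<partial>M)"
  proof (subst nn_integral_cmult)
    have m: "(\<lambda>\<omega>. ennreal (?R t \<omega>)) \<in> borel_measurable M" if "t \<in> {j..<j+n}" for t
      using R[of t] that j by simp
    then show "(\<lambda>\<omega>. \<Sum>t=j..<j+n. ennreal (?R t \<omega>)) \<in> borel_measurable M"
      by (rule borel_measurable_sum)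
    show "ennreal c * (\<integral>\<^sup>+\<omega>. (\<Sum>t=j..<j+n. ennreal (?R t \<omega>)) \<partial>M)
        = ennreal c * (\<Sum>t=j..<j+n. \<integral>\<^sup>+\<omega>. ennreal (?R t \<omega>) \<partial>M)"
      using m by (subst nn_integral_sum) auto
  qed
  also have "\<dots> \<le> ennreal c * (\<Sum>t=j..<j+n. ennreal \<epsilon>)"
    using close j by (intro mult_left_mono sum_mono) auto
  also have "\<dots> = ennreal (c * (real n * \<epsilon>))"
    using c \<epsilon> by (simp add: ennreal_mult ennreal_of_nat_eq_real_of_nat)
  also have "c * (real n * \<epsilon>) = \<epsilon> / \<eta>" using n \<eta> by (simp add: c_def)
  finally show ?thesis using \<epsilon> \<eta> by (simp add: emeasure_eq_measure)
qed

text \<open>The block sums of the true log-likelihood ratio grow like \<open>m * I\<close> up to an exponentially small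
  probability, and Markov's inequality transfers this to the statistic.\<close>

lemma delay_le:
  assumes lo: "llr_mgf a (- s) \<le> exp (- s * (I - \<eta> / 2))" and m: "m > 0"
    and B: "B \<le> real m * (I - 2 * \<eta>)"
    and q: "exp (- (real m * s * \<eta> / 2)) + \<epsilon> / \<eta> \<le> q" "q < 1"
  shows "expected_time M (\<lambda>\<omega>. cusum_time (g (\<lambda>i. x i \<omega>)) B) \<le> ennreal (real (m + w) / (1 - q))"
proof -
  have "0 \<le> exp (- (real m * s * \<eta> / 2)) + \<epsilon> / \<eta>" using \<epsilon> \<eta> by (intro add_nonneg_nonneg) auto
  then have q0: "0 \<le> q" using q(1) by linarith
  have "prob {\<omega>\<in>space M. (\<Sum>t=j+1..j+m. g (\<lambda>i. x i \<omega>) t) < B} \<le> q" for j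
  proof -
    have iv: "{j+1..<j+1+m} = {j+1..j+m}" by auto
    let ?R = "\<lambda>\<omega>. \<Sum>t=j+1..<j+1+m. \<bar>g (\<lambda>i. x i \<omega>) t - \<Lambda> t \<omega>\<bar>"
    let ?N = "\<lambda>\<omega>. \<Sum>t\<in>{j+1..j+m}. \<Lambda> t \<omega>"
    have Rm: "?R \<in> borel_measurable M"
      using stat_measurable llr_measurable
      by (intro borel_measurable_sum borel_measurable_abs borel_measurable_diff) auto
    have Nm: "?N \<in> borel_measurable M"
      using llr_measurable by (intro borel_measurable_sum) auto
    have e1: "{\<omega>\<in>space M. real m * \<eta> \<le> ?R \<omega>} \<in> events"
      by (rule borel_measurable_le[OF borel_measurable_const Rm])
    have e2: "{\<omega>\<in>space M. - (real m * (I - \<eta>)) \<le> - ?N \<omega>} \<in> events"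
      by (rule borel_measurable_le[OF borel_measurable_const borel_measurable_uminus[OF Nm]])
    have sneg: "- s * (a - 1) < 1"
    proof -
      have "0 < s * (a - 1)" using s a by simp
      then show ?thesis unfolding mult_minus_left by linarith
    qed
    have "prob {\<omega>\<in>space M. - (real m * (I - \<eta>)) \<le> - ?N \<omega>} \<le> exp (- s * (I - \<eta> / 2)) ^ m * exp (- s * - (real m * (I - \<eta>)))"
    proof (rule chernoff_upper)
      have "(\<integral>\<^sup>+\<omega>. ennreal (exp (- s * ?N \<omega>)) \<partial>M) = ennreal (llr_mgf a (- s) ^ card {j+1..j+m})"
        using mgf[OF _ sneg] sneg by (intro nn_integral_exp_sum_indep[OF ind]) (auto simp: llr_mgf_nonneg)
      also have "\<dots> \<le> ennreal (exp (- s * (I - \<eta> / 2)) ^ m)"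
        using lo sneg by (simp, intro ennreal_leI power_mono llr_mgf_nonneg) auto
      finally show "(\<integral>\<^sup>+\<omega>. ennreal (exp (s * - ?N \<omega>)) \<partial>M) \<le> ennreal (exp (- s * (I - \<eta> / 2)) ^ m)"
        by (simp only: mult_minus_left mult_minus_right)
      show "(\<lambda>\<omega>. - ?N \<omega>) \<in> borel_measurable M" by (rule borel_measurable_uminus[OF Nm])
    qed (use s in auto)
    also have "\<dots> = exp (- (real m * s * \<eta> / 2))"
    proof -
      have "exp (- s * (I - \<eta> / 2)) ^ m = exp (real m * (- s * (I - \<eta> / 2)))" by (metis exp_of_nat_mult)
      moreover have "real m * (- s * (I - \<eta> / 2)) + - s * - (real m * (I - \<eta>)) = - (real m * s * \<eta> / 2)"
        by (simp add: algebra_simps)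
      ultimately show ?thesis by (simp only: exp_add[symmetric])
    qed
    finally have p2: "prob {\<omega>\<in>space M. - (real m * (I - \<eta>)) \<le> - ?N \<omega>} \<le> exp (- (real m * s * \<eta> / 2))" .
    have p1: "prob {\<omega>\<in>space M. real m * \<eta> \<le> ?R \<omega>} \<le> \<epsilon> / \<eta>"
      by (rule error_sum_tail[OF m]) simp
    have "{\<omega>\<in>space M. (\<Sum>t=j+1..j+m. g (\<lambda>i. x i \<omega>) t) < B}
      \<subseteq> {\<omega>\<in>space M. - (real m * (I - \<eta>)) \<le> - ?N \<omega>} \<union> {\<omega>\<in>space M. real m * \<eta> \<le> ?R \<omega>}"
    proof
      fix \<omega> assume *: "\<omega> \<in> {\<omega>\<in>space M. (\<Sum>t=j+1..j+m. g (\<lambda>i. x i \<omega>) t) < B}"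
      have "?N \<omega> - (\<Sum>t=j+1..j+m. g (\<lambda>i. x i \<omega>) t) = (\<Sum>t=j+1..j+m. \<Lambda> t \<omega> - g (\<lambda>i. x i \<omega>) t)"
        by (rule sum_subtractf[symmetric])
      also have "\<dots> \<le> ?R \<omega>" unfolding iv by (intro sum_mono) auto
      finally have "?N \<omega> - ?R \<omega> < B" using * by simp
      moreover have "real m * (I - 2 * \<eta>) = real m * (I - \<eta>) - real m * \<eta>" by (simp add: algebra_simps)
      ultimately have "?N \<omega> \<le> real m * (I - \<eta>) \<or> real m * \<eta> \<le> ?R \<omega>" using B by linarith
      then show "\<omega> \<in> {\<omega>\<in>space M. - (real m * (I - \<eta>)) \<le> - ?N \<omega>} \<union> {\<omega>\<in>space M. real m * \<eta> \<le> ?R \<omega>}"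
        using * by simp
    qed
    then have "prob {\<omega>\<in>space M. (\<Sum>t=j+1..j+m. g (\<lambda>i. x i \<omega>) t) < B}
      \<le> prob ({\<omega>\<in>space M. - (real m * (I - \<eta>)) \<le> - ?N \<omega>} \<union> {\<omega>\<in>space M. real m * \<eta> \<le> ?R \<omega>})"
      by (rule finite_measure_mono[OF _ sets.Un[OF e2 e1]])
    also have "\<dots> \<le> prob {\<omega>\<in>space M. - (real m * (I - \<eta>)) \<le> - ?N \<omega>} + prob {\<omega>\<in>space M. real m * \<eta> \<le> ?R \<omega>}"
      by (rule measure_Un_le[OF e2 e1])
    also have "\<dots> \<le> q" using p1 p2 q(1) by linarith
    finally show ?thesis .
  qed
  then show ?thesis by (rule window_cusum_time_blocks_le[OF iid g m q0 q(2)])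
qed

text \<open>An early alarm needs a segment of length at most \<open>n\<close> whose true log-likelihood ratio reaches
  the threshold up to the total error; a union bound over the segments excludes this.\<close>

lemma delay_ge:
  assumes up: "llr_mgf a s \<le> exp (s * (I + \<eta> / 2))" and n: "n > 0"
  shows "ennreal (real n * (1 - (\<epsilon> / \<eta> + (real n)\<^sup>2 * exp (s * (real n * (I + 2 * \<eta>) - B)))))
    \<le> expected_time M (\<lambda>\<omega>. cusum_time (g (\<lambda>i. x i \<omega>)) B)"
proof (rule expected_time_ge)
  show "prob_space M" by (rule prob_space_axioms)
  show "(\<lambda>\<omega>. cusum_time (g (\<lambda>i. x i \<omega>)) B) \<in> M \<rightarrow>\<^sub>M count_space UNIV"
    by (rule measurable_cusum_time) (rule stat_measurable)
  define c where "c = B - real n * \<eta>"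
  let ?R = "\<lambda>\<omega>. \<Sum>t=1..<1+n. \<bar>g (\<lambda>i. x i \<omega>) t - \<Lambda> t \<omega>\<bar>"
  let ?N = "\<lambda>j t \<omega>. \<Sum>i\<in>{j..t}. \<Lambda> i \<omega>"
  let ?J = "{(j, t). 1 \<le> j \<and> j \<le> t \<and> t \<le> n}"
  let ?A = "\<lambda>p. {\<omega>\<in>space M. c \<le> ?N (fst p) (snd p) \<omega>}"
  have Rm: "?R \<in> borel_measurable M"
    using stat_measurable llr_measurable
    by (intro borel_measurable_sum borel_measurable_abs borel_measurable_diff) auto
  have Nm: "?N j t \<in> borel_measurable M" if "1 \<le> j" for j t
    using llr_measurable that by (intro borel_measurable_sum) auto
  have e1: "{\<omega>\<in>space M. real n * \<eta> \<le> ?R \<omega>} \<in> events"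
    by (rule borel_measurable_le[OF borel_measurable_const Rm])
  have e2: "?A p \<in> events" if "p \<in> ?J" for p
    using that by (intro borel_measurable_le[OF borel_measurable_const Nm]) auto
  have fin: "finite ?J" by (rule finite_subset[of _ "{1..n} \<times> {1..n}"]) auto
  have eU: "(\<Union>p\<in>?J. ?A p) \<in> events" by (rule sets.finite_UN[OF fin e2])
  have cardJ: "real (card ?J) \<le> (real n)\<^sup>2"
  proof -
    have "card ?J \<le> card ({1..n} \<times> {1..n})" by (intro card_mono) auto
    then have "card ?J \<le> n * n" by simp
    then have "real (card ?J) \<le> real (n * n)" by (rule of_nat_mono)
    then show ?thesis by (simp add: power2_eq_square)
  qed
  have seg: "prob (?A p) \<le> exp (s * (real n * (I + 2 * \<eta>) - B))" if p: "p \<in> ?J" for p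
  proof -
    obtain j t where jt: "p = (j, t)" "1 \<le> j" "j \<le> t" "t \<le> n" using p by auto
    have s1: "s * (a - 1) < 1" using s by linarith
    have "prob {\<omega>\<in>space M. c \<le> ?N j t \<omega>} \<le> exp (s * (I + \<eta> / 2)) ^ card {j..t} * exp (- s * c)"
    proof (rule chernoff_upper)
      show "?N j t \<in> borel_measurable M" by (rule Nm[OF jt(2)])
      have "(\<integral>\<^sup>+\<omega>. ennreal (exp (s * ?N j t \<omega>)) \<partial>M) = ennreal (llr_mgf a s ^ card {j..t})"
        using mgf[OF _ s1] s1 jt by (intro nn_integral_exp_sum_indep[OF ind]) (auto simp: llr_mgf_nonneg)
      also have "\<dots> \<le> ennreal (exp (s * (I + \<eta> / 2)) ^ card {j..t})"
        using up s1 by (intro ennreal_leI power_mono llr_mgf_nonneg) auto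
      finally show "(\<integral>\<^sup>+\<omega>. ennreal (exp (s * ?N j t \<omega>)) \<partial>M) \<le> ennreal (exp (s * (I + \<eta> / 2)) ^ card {j..t})" .
    qed (use s in auto)
    also have "\<dots> = exp (real (card {j..t}) * (s * (I + \<eta> / 2)) + - s * c)"
      unfolding exp_of_nat_mult exp_add ..
    also have "\<dots> \<le> exp (s * (real n * (I + 2 * \<eta>) - B))"
    proof -
      have "card {j..t} \<le> n" using jt by simp
      then have "real (card {j..t}) * (s * (I + \<eta> / 2)) \<le> real n * (s * (I + \<eta> / 2))"
        using s I \<eta> by (intro mult_right_mono) auto
      also have "\<dots> \<le> real n * (s * (I + \<eta>))" using s \<eta> by (intro mult_left_mono) auto
      finally have "real (card {j..t}) * (s * (I + \<eta> / 2)) + - s * c \<le> real n * (s * (I + \<eta>)) + - s * c" by simp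
      also have "\<dots> = s * (real n * (I + 2 * \<eta>) - B)" by (simp add: c_def algebra_simps)
      finally show ?thesis by (simp only: exp_le_cancel_iff)
    qed
    finally show ?thesis by (simp add: jt(1))
  qed
  have "{\<omega>\<in>space M. cusum_time (g (\<lambda>i. x i \<omega>)) B \<le> enat n}
    \<subseteq> {\<omega>\<in>space M. real n * \<eta> \<le> ?R \<omega>} \<union> (\<Union>p\<in>?J. ?A p)"
  proof
    fix \<omega> assume *: "\<omega> \<in> {\<omega>\<in>space M. cusum_time (g (\<lambda>i. x i \<omega>)) B \<le> enat n}"
    then obtain j t where jt: "1 \<le> j" "j \<le> t" "t \<le> n" "B \<le> (\<Sum>i=j..t. g (\<lambda>i. x i \<omega>) i)"
      unfolding cusum_time_le_iff_segment by auto
    have "(\<Sum>i=j..t. g (\<lambda>i. x i \<omega>) i) - ?N j t \<omega> = (\<Sum>i=j..t. g (\<lambda>i. x i \<omega>) i - \<Lambda> i \<omega>)"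
      by (rule sum_subtractf[symmetric])
    also have "\<dots> \<le> (\<Sum>i=j..t. \<bar>g (\<lambda>i. x i \<omega>) i - \<Lambda> i \<omega>\<bar>)" by (intro sum_mono) auto
    also have "\<dots> \<le> ?R \<omega>" using jt by (intro sum_mono2) auto
    finally have "c \<le> ?N j t \<omega> \<or> real n * \<eta> \<le> ?R \<omega>" using jt(4) by (simp only: c_def) linarith
    then show "\<omega> \<in> {\<omega>\<in>space M. real n * \<eta> \<le> ?R \<omega>} \<union> (\<Union>p\<in>?J. ?A p)"
    proof
      assume "c \<le> ?N j t \<omega>"
      then have "\<omega> \<in> ?A (j, t)" using * by simp
      moreover have "(j, t) \<in> ?J" using jt by simp
      ultimately show ?thesis by blast
    qed (use * in simp)
  qed
  then have "prob {\<omega>\<in>space M. cusum_time (g (\<lambda>i. x i \<omega>)) B \<le> enat n}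
    \<le> prob ({\<omega>\<in>space M. real n * \<eta> \<le> ?R \<omega>} \<union> (\<Union>p\<in>?J. ?A p))"
    by (rule finite_measure_mono[OF _ sets.Un[OF e1 eU]])
  also have "\<dots> \<le> prob {\<omega>\<in>space M. real n * \<eta> \<le> ?R \<omega>} + prob (\<Union>p\<in>?J. ?A p)"
    by (rule measure_Un_le[OF e1 eU])
  also have "prob (\<Union>p\<in>?J. ?A p) \<le> (\<Sum>p\<in>?J. prob (?A p))"
    by (rule finite_measure_subadditive_finite[OF fin image_subsetI[OF e2]])
  also have "\<dots> \<le> (\<Sum>p\<in>?J. exp (s * (real n * (I + 2 * \<eta>) - B)))" by (intro sum_mono seg)
  also have "\<dots> = real (card ?J) * exp (s * (real n * (I + 2 * \<eta>) - B))" by simp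
  also have "\<dots> \<le> (real n)\<^sup>2 * exp (s * (real n * (I + 2 * \<eta>) - B))"
    by (intro mult_right_mono cardJ) simp
  also have "prob {\<omega>\<in>space M. real n * \<eta> \<le> ?R \<omega>} \<le> \<epsilon> / \<eta>"
    by (rule error_sum_tail[OF n]) simp
  finally show "prob {\<omega>\<in>space M. cusum_time (g (\<lambda>i. x i \<omega>)) B \<le> enat n}
      \<le> \<epsilon> / \<eta> + (real n)\<^sup>2 * exp (s * (real n * (I + 2 * \<eta>) - B))"
    by simp
qed

end

section \<open>First-order asymptotics of a family of CUSUM procedures\<close>

text \<open>A tilt that works for all variance ratios near \<open>a0\<close>: its quadratic cost is dominated by the
  slack \<open>\<eta>\<close> in the drift.\<close>

lemma uniform_tilt:
  assumes a0: "a0 > 1" and \<eta>: "\<eta> > 0"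
  shows "\<exists>s>0. \<forall>a. 1 < a \<and> a - 1 \<le> a0 \<and> \<bar>kl a - kl a0\<bar> \<le> \<eta> / 4 \<longrightarrow>
    s * (a - 1) \<le> 1 / 2 \<and> llr_mgf a s \<le> exp (s * (kl a0 + \<eta> / 2)) \<and>
    llr_mgf a (- s) \<le> exp (- s * (kl a0 - \<eta> / 2))"
proof -
  \<comment> \<open>the first bound keeps the generating function finite, the second one absorbs the quadratic remainder\<close>
  define s where "s = min (1 / (2 * a0)) (\<eta> / (4 * a0\<^sup>2))"
  have s: "s > 0" "s \<le> 1 / (2 * a0)" "s \<le> \<eta> / (4 * a0\<^sup>2)" using a0 \<eta> by (auto simp: s_def)
  have "s * (a - 1) \<le> 1 / 2 \<and> llr_mgf a s \<le> exp (s * (kl a0 + \<eta> / 2)) \<and>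
    llr_mgf a (- s) \<le> exp (- s * (kl a0 - \<eta> / 2))"
    if a: "1 < a" "a - 1 \<le> a0" "\<bar>kl a - kl a0\<bar> \<le> \<eta> / 4" for a
  proof -
    have "s * (a - 1) \<le> 1 / (2 * a0) * a0" using s a a0 by (intro mult_mono) auto
    also have "\<dots> = 1 / 2" using a0 by simp
    finally have half: "s * (a - 1) \<le> 1 / 2" .
    have "(a - 1)\<^sup>2 \<le> a0\<^sup>2" using a by (intro power_mono) auto
    then have "s * (a - 1)\<^sup>2 \<le> \<eta> / (4 * a0\<^sup>2) * a0\<^sup>2" using s \<eta> by (intro mult_mono) auto
    also have "\<dots> = \<eta> / 4" using a0 by simp
    finally have "s * (s * (a - 1)\<^sup>2) \<le> s * (\<eta> / 4)" using s by (intro mult_left_mono) auto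
    then have sq: "s\<^sup>2 * (a - 1)\<^sup>2 \<le> s * (\<eta> / 4)" by (simp add: power2_eq_square mult.assoc)
    have "\<bar>s\<bar> * (a - 1) \<le> 1 / 2" "\<bar>- s\<bar> * (a - 1) \<le> 1 / 2" using half s by auto
    note b1 = llr_mgf_le[OF a(1) this(1)] and b2 = llr_mgf_le[OF a(1) this(2)]
    have "kl a \<le> kl a0 + \<eta> / 4" using a(3) by linarith
    moreover have "kl a0 - \<eta> / 4 \<le> kl a" using a(3) by linarith
    ultimately have "s * kl a \<le> s * (kl a0 + \<eta> / 4)" "s * (kl a0 - \<eta> / 4) \<le> s * kl a"
      using s by (auto intro!: mult_left_mono)
    then have "s * kl a + s\<^sup>2 * (a - 1)\<^sup>2 \<le> s * (kl a0 + \<eta> / 2)"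
      and "- s * kl a + (- s)\<^sup>2 * (a - 1)\<^sup>2 \<le> - s * (kl a0 - \<eta> / 2)"
      using sq by (auto simp: algebra_simps)
    with b1 b2 half show ?thesis by (meson exp_le_cancel_iff order_trans)
  qed
  with s show ?thesis by blast
qed

lemma tendsto_kl:
  assumes "(a \<longlongrightarrow> a0) F" "a0 > 1"
  shows "((\<lambda>\<gamma>. kl (a \<gamma>)) \<longlongrightarrow> kl a0) F"
  unfolding kl_def using assms by (intro tendsto_intros) auto

lemma eventually_near_variance_ratio:
  fixes a :: "real \<Rightarrow> real"
  assumes "(a \<longlongrightarrow> a0) at_top" and a0: "a0 > 1" and \<eta>: "\<eta> > 0"
  shows "\<forall>\<^sub>F \<gamma> in at_top. 1 < a \<gamma> \<and> a \<gamma> - 1 \<le> a0 \<and> \<bar>kl (a \<gamma>) - kl a0\<bar> \<le> \<eta> / 4"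
proof -
  have "\<forall>\<^sub>F \<gamma> in at_top. 1 < a \<gamma>" using assms by (intro order_tendstoD(1))
  moreover have "\<forall>\<^sub>F \<gamma> in at_top. a \<gamma> < a0 + 1" using assms by (intro order_tendstoD(2)) auto
  moreover have "\<forall>\<^sub>F \<gamma> in at_top. dist (kl (a \<gamma>)) (kl a0) < \<eta> / 4"
    using tendsto_kl[OF assms(1) a0] \<eta> by (intro tendstoD) auto
  ultimately show ?thesis by eventually_elim (auto simp: dist_real_def)
qed

lemma eventually_ln: "(\<forall>\<^sub>F G in at_top. P G) \<Longrightarrow> \<forall>\<^sub>F \<gamma> in at_top. P (ln (\<gamma>::real))"
  by (rule eventually_compose_filterlim[OF _ ln_at_top])

lemma nat_ceiling_bounds:
  assumes "0 < (r::real)"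
  shows "nat \<lceil>r\<rceil> > 0" "r \<le> real (nat \<lceil>r\<rceil>)" "real (nat \<lceil>r\<rceil>) \<le> r + 1"
  using assms by linarith+

text \<open>The threshold is asymptotic to the logarithm of the average run length: it cannot be larger
  because false alarms have probability at most \<open>exp (- B)\<close> per step, and it cannot be smaller
  because a block of about \<open>B / I\<close> observations raises an alarm with probability \<open>exp (- B)\<close> up to
  subexponential factors.\<close>

lemma arl_threshold_asymptotics:
  fixes x :: "nat \<Rightarrow> 'a \<Rightarrow> real^'k" and a B :: "real \<Rightarrow> real" and w :: "real \<Rightarrow> nat"
  assumes iid: "iid_density M x f" and a: "(a \<longlongrightarrow> a0) at_top" and a0: "a0 > 1"
    and w: "((\<lambda>\<gamma>. real (w \<gamma>) / ln \<gamma>) \<longlongrightarrow> 0) at_top"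
    and g: "\<forall>\<^sub>F \<gamma> in at_top. window_stat (w \<gamma>) (g \<gamma>)"
    and ind: "\<forall>\<^sub>F \<gamma> in at_top. prob_space.indep_vars M (\<lambda>_. borel) (\<lambda>t \<omega>. g \<gamma> (\<lambda>i. x i \<omega>) t) {1..}"
    and mgf: "\<forall>\<^sub>F \<gamma> in at_top. \<forall>t c. t \<ge> 1 \<longrightarrow> c * (a \<gamma> - 1) < 1 \<longrightarrow>
      (\<integral>\<^sup>+\<omega>. ennreal (exp ((1 + c) * g \<gamma> (\<lambda>i. x i \<omega>) t)) \<partial>M) = ennreal (llr_mgf (a \<gamma>) c)"
    and arl: "\<forall>\<^sub>F \<gamma> in at_top. expected_time M (\<lambda>\<omega>. cusum_time (g \<gamma> (\<lambda>i. x i \<omega>)) (B \<gamma>)) = ennreal \<gamma>"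
    and \<kappa>: "0 < \<kappa>" "\<kappa> < 1"
  shows "\<forall>\<^sub>F \<gamma> in at_top. (1 - \<kappa>) * ln \<gamma> \<le> B \<gamma> \<and> B \<gamma> \<le> (1 + \<kappa>) * ln \<gamma>"
proof -
  define I where "I = kl a0"
  have I: "I > 0" using a0 by (simp add: I_def kl_pos)
  \<comment> \<open>small enough for \<open>(1 - \<kappa>) * (I + \<eta>) / (I - \<eta>) \<le> 1 - \<kappa> / 2\<close>\<close>
  define \<eta> where "\<eta> = \<kappa> * I / 8"
  have \<eta>: "\<eta> > 0" using \<kappa> I by (simp add: \<eta>_def)
  have \<eta>I: "I - \<eta> > I / 2" "I + \<eta> \<le> 2 * I"
    using \<kappa> I mult_strict_right_mono[OF \<kappa>(2) I] by (auto simp: \<eta>_def)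
  obtain s where s: "s > 0" "\<And>a. 1 < a \<Longrightarrow> a - 1 \<le> a0 \<Longrightarrow> \<bar>kl a - kl a0\<bar> \<le> \<eta> / 4 \<Longrightarrow>
    s * (a - 1) \<le> 1 / 2 \<and> llr_mgf a s \<le> exp (s * (I + \<eta> / 2)) \<and>
    llr_mgf a (- s) \<le> exp (- s * (I - \<eta> / 2))"
    using uniform_tilt[OF a0 \<eta>] unfolding I_def by blast
  have "\<forall>\<^sub>F \<gamma>::real in at_top. ln (4 * \<gamma> + 2) \<le> (1 + \<kappa>) * ln \<gamma>"
    using \<kappa> by real_asymp
  moreover have "\<forall>\<^sub>F \<gamma>::real in at_top. 2 * ((2 / I + 1) * ln \<gamma> + 1) * exp (2 * I) < exp (\<kappa> / 2 * ln \<gamma>)"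
  proof -
    define c where "c = 2 / I + 1"
    define e where "e = exp (2 * I)"
    have c: "c > 0" "e > 0" using I by (auto simp: c_def e_def add_pos_pos)
    have "\<forall>\<^sub>F G::real in at_top. 2 * (c * G + 1) * e < exp (\<kappa> / 2 * G)"
      using c \<kappa> by real_asymp
    from eventually_ln[OF this] show ?thesis by (simp only: c_def e_def)
  qed
  moreover have "\<forall>\<^sub>F \<gamma>::real in at_top. exp (- ((1 - \<kappa>) / I * ln \<gamma> * (s * \<eta> / 2))) \<le> 1 / 4"
  proof -
    define k where "k = (1 - \<kappa>) / I * (s * \<eta> / 2)"
    have k: "k > 0" using \<kappa> I s \<eta> by (simp add: k_def)
    have "\<forall>\<^sub>F G::real in at_top. exp (- (k * G)) \<le> 1 / 4" using k by real_asymp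
    from eventually_ln[OF this] show ?thesis by (simp add: k_def mult_ac)
  qed
  moreover have "\<forall>\<^sub>F \<gamma> in at_top. real (w \<gamma>) / ln \<gamma> < 1" using w by (rule order_tendstoD) simp
  moreover have "\<forall>\<^sub>F \<gamma>::real in at_top. \<gamma> > 1" by (rule eventually_gt_at_top)
  ultimately show ?thesis
    using g ind mgf arl eventually_near_variance_ratio[OF a a0 \<eta>]
  proof eventually_elim
    case (elim \<gamma>)
    interpret prob_space M by (rule iid_prob_space[OF iid])
    have G: "ln \<gamma> > 0" using elim(5) by simp
    have one: "(\<integral>\<^sup>+\<omega>. ennreal (exp (g \<gamma> (\<lambda>i. x i \<omega>) t)) \<partial>M) = 1" if "t \<ge> 1" for t
      using elim(8)[rule_format, OF that, of 0] by (simp add: llr_mgf_0)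
    have "ennreal (exp (B \<gamma>) / 4 - 1 / 2) \<le> ennreal \<gamma>"
      using arl_ge[OF elim(7) one, of "B \<gamma>"] elim(9) by simp
    then have "exp (B \<gamma>) \<le> 4 * \<gamma> + 2" using elim(5) by (simp add: ennreal_le_iff)
    then have "B \<gamma> \<le> ln (4 * \<gamma> + 2)"
      using elim(5) by (subst ln_ge_iff) auto
    then have up: "B \<gamma> \<le> (1 + \<kappa>) * ln \<gamma>" using elim(1) by linarith
    have lo: "(1 - \<kappa>) * ln \<gamma> \<le> B \<gamma>"
    proof (rule ccontr)
      assume "\<not> (1 - \<kappa>) * ln \<gamma> \<le> B \<gamma>"
      then have less: "B \<gamma> \<le> (1 - \<kappa>) * ln \<gamma>" by simp
      define B1 where "B1 = (1 - \<kappa>) * ln \<gamma>"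
      define m where "m = nat \<lceil>B1 / (I - \<eta>)\<rceil>"
      have B1: "B1 > 0" using G \<kappa> by (simp add: B1_def)
      have "B1 / (I - \<eta>) > 0" using B1 \<eta>I I by (intro divide_pos_pos) linarith+
      note m = nat_ceiling_bounds[OF this, folded m_def]
      have Ipos: "I - \<eta> > 0" using \<eta>I I by linarith
      have mB: "B1 \<le> real m * (I - \<eta>)" using m(2) Ipos by (simp add: field_simps)
      have "B1 / I \<le> B1 / (I - \<eta>)" using B1 Ipos \<eta> I by (intro divide_left_mono) auto
      then have "B1 / I \<le> real m" using m(2) by linarith
      then have "(1 - \<kappa>) / I * ln \<gamma> * (s * \<eta> / 2) \<le> real m * (s * \<eta> / 2)"
        using s \<eta> by (intro mult_right_mono) (auto simp: B1_def)
      then have "exp (- (real m * s * \<eta> / 2)) \<le> exp (- ((1 - \<kappa>) / I * ln \<gamma> * (s * \<eta> / 2)))"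
        by (simp add: mult.assoc)
      also have "\<dots> \<le> 1 / 4" by (rule elim(3))
      finally have large: "exp (- (real m * s * \<eta> / 2)) \<le> 1 / 4" .
      have tilt: "s * (a \<gamma> - 1) \<le> 1 / 2" "llr_mgf (a \<gamma>) s \<le> exp (s * (I + \<eta> / 2))"
        "llr_mgf (a \<gamma>) (- s) \<le> exp (- s * (I - \<eta> / 2))"
        using s(2)[of "a \<gamma>"] elim(10) by auto
      have "ennreal \<gamma> \<le> expected_time M (\<lambda>\<omega>. cusum_time (g \<gamma> (\<lambda>i. x i \<omega>)) B1)"
        unfolding elim(9)[symmetric] using less by (intro expected_time_mono cusum_time_mono) (simp add: B1_def)
      also have "\<dots> \<le> ennreal (2 * real (m + w \<gamma>) * exp (real m * (I + \<eta>)))"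
        using elim(10) elim(8)[rule_format]
        by (intro arl_le[OF iid elim(6) m(1) elim(7) _ _ s(1) tilt \<eta> large mB I]) auto
      finally have "\<gamma> \<le> 2 * real (m + w \<gamma>) * exp (real m * (I + \<eta>))"
        by (simp add: ennreal_le_iff)
      also have "\<dots> \<le> 2 * ((2 / I + 1) * ln \<gamma> + 1) * exp (2 * I + (1 - \<kappa> / 2) * ln \<gamma>)"
      proof (intro mult_mono mult_left_mono)
        have "B1 \<le> ln \<gamma>" using \<kappa> G by (simp add: B1_def mult_le_cancel_right1)
        then have "B1 / (I - \<eta>) \<le> ln \<gamma> / (I / 2)" using \<eta>I I B1 by (intro frac_le) auto
        moreover have "real (w \<gamma>) \<le> ln \<gamma>" using elim(4) G by (simp add: divide_simps)
        ultimately show "real (m + w \<gamma>) \<le> (2 / I + 1) * ln \<gamma> + 1"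
          using m(3) by (simp add: algebra_simps)
        have "(I + \<eta>) * (1 - \<kappa>) \<le> (1 - \<kappa> / 2) * (I - \<eta>)"
        proof -
          have "(1 - \<kappa> / 2) * (I - \<eta>) - (I + \<eta>) * (1 - \<kappa>) = I * (\<kappa> / 4 + 3 * \<kappa>\<^sup>2 / 16)"
            by (simp add: \<eta>_def power2_eq_square field_simps)
          also have "\<dots> \<ge> 0" using I \<kappa> by (intro mult_nonneg_nonneg add_nonneg_nonneg) auto
          finally show ?thesis by (simp only: diff_ge_0_iff_ge)
        qed
        then have "(I + \<eta>) * (1 - \<kappa>) / (I - \<eta>) \<le> 1 - \<kappa> / 2" using Ipos by (simp add: divide_le_eq)
        then have "(I + \<eta>) * (1 - \<kappa>) / (I - \<eta>) * ln \<gamma> \<le> (1 - \<kappa> / 2) * ln \<gamma>"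
          using G by (intro mult_right_mono) auto
        moreover have "real m * (I + \<eta>) \<le> (B1 / (I - \<eta>) + 1) * (I + \<eta>)"
          using m(3) I \<eta> by (intro mult_right_mono) auto
        moreover have "(B1 / (I - \<eta>) + 1) * (I + \<eta>) = (I + \<eta>) * (1 - \<kappa>) / (I - \<eta>) * ln \<gamma> + (I + \<eta>)"
          by (simp add: B1_def algebra_simps)
        ultimately show "exp (real m * (I + \<eta>)) \<le> exp (2 * I + (1 - \<kappa> / 2) * ln \<gamma>)"
          using \<eta>I by simp
        show "0 \<le> 2 * ((2 / I + 1) * ln \<gamma> + 1)" using I G by (simp add: add_nonneg_nonneg)
      qed auto
      also have "\<dots> = 2 * ((2 / I + 1) * ln \<gamma> + 1) * exp (2 * I) * exp ((1 - \<kappa> / 2) * ln \<gamma>)"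
        by (simp only: exp_add mult.assoc)
      also have "\<dots> < exp (\<kappa> / 2 * ln \<gamma>) * exp ((1 - \<kappa> / 2) * ln \<gamma>)"
        using elim(2) by (intro mult_strict_right_mono) auto
      also have "\<dots> = exp (ln \<gamma>)" unfolding exp_add[symmetric] by (simp add: algebra_simps)
      also have "\<dots> = \<gamma>" using elim(5) by simp
      finally show False by simp
    qed
    show ?case using up lo by simp
  qed
qed

text \<open>The delay bounds are applied to blocks slightly longer, and to a horizon slightly shorter, than
  \<open>ln \<gamma> / I\<close>. Gaps of window length are negligible against such blocks, and the mean error is negligible
  against the drift per step.\<close>

lemma delay_asymptotics:
  fixes x :: "nat \<Rightarrow> 'a \<Rightarrow> real^'k" and B \<epsilon> :: "real \<Rightarrow> real" and w :: "real \<Rightarrow> nat"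
  assumes iid: "iid_density M x f" and a0: "a0 > 1"
    and w: "((\<lambda>\<gamma>. real (w \<gamma>) / ln \<gamma>) \<longlongrightarrow> 0) at_top"
    and g: "\<forall>\<^sub>F \<gamma> in at_top. window_stat (w \<gamma>) (g \<gamma>)"
    and ind: "prob_space.indep_vars M (\<lambda>_. borel) \<Lambda> {1..}"
    and mgf: "\<And>t c. t \<ge> 1 \<Longrightarrow> c * (a0 - 1) < 1 \<Longrightarrow>
      (\<integral>\<^sup>+\<omega>. ennreal (exp (c * \<Lambda> t \<omega>)) \<partial>M) = ennreal (llr_mgf a0 c)"
    and close: "\<forall>\<^sub>F \<gamma> in at_top. \<forall>t\<ge>1. (\<integral>\<^sup>+\<omega>. ennreal \<bar>g \<gamma> (\<lambda>i. x i \<omega>) t - \<Lambda> t \<omega>\<bar> \<partial>M) \<le> ennreal (\<epsilon> \<gamma>)"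
    and \<epsilon>0: "\<And>\<gamma>. \<epsilon> \<gamma> \<ge> 0" and \<epsilon>: "(\<epsilon> \<longlongrightarrow> 0) at_top"
    and B: "\<And>\<kappa>. 0 < \<kappa> \<Longrightarrow> \<kappa> < 1 \<Longrightarrow> \<forall>\<^sub>F \<gamma> in at_top. (1 - \<kappa>) * ln \<gamma> \<le> B \<gamma> \<and> B \<gamma> \<le> (1 + \<kappa>) * ln \<gamma>"
    and \<kappa>: "0 < \<kappa>" "\<kappa> < 1"
  shows "\<forall>\<^sub>F \<gamma> in at_top.
    ennreal ((1 - \<kappa>) * (ln \<gamma> / kl a0)) \<le> expected_time M (\<lambda>\<omega>. cusum_time (g \<gamma> (\<lambda>i. x i \<omega>)) (B \<gamma>)) \<and>
    expected_time M (\<lambda>\<omega>. cusum_time (g \<gamma> (\<lambda>i. x i \<omega>)) (B \<gamma>)) \<le> ennreal ((1 + \<kappa>) * (ln \<gamma> / kl a0))"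
proof -
  define I where "I = kl a0"
  have I: "I > 0" using a0 by (simp add: I_def kl_pos)
  \<comment> \<open>each of the finitely many relative errors below is a small multiple of \<open>k\<close>\<close>
  define k where "k = \<kappa> / 16"
  have k: "0 < k" "k < 1 / 16" using \<kappa> by (auto simp: k_def)
  then have k1: "k < 1" by simp
  define \<eta> where "\<eta> = k * I / 2"
  have \<eta>: "\<eta> > 0" using k I by (simp add: \<eta>_def)
  obtain s where s: "s > 0" and "s * (a0 - 1) \<le> 1 / 2 \<and> llr_mgf a0 s \<le> exp (s * (I + \<eta> / 2)) \<and>
    llr_mgf a0 (- s) \<le> exp (- s * (I - \<eta> / 2))"
    using uniform_tilt[OF a0 \<eta>] a0 \<eta> unfolding I_def by force
  then have tilt: "s * (a0 - 1) \<le> 1 / 2" "llr_mgf a0 s \<le> exp (s * (I + \<eta> / 2))"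
    "llr_mgf a0 (- s) \<le> exp (- s * (I - \<eta> / 2))" by auto
  have "\<forall>\<^sub>F \<gamma>::real in at_top. exp (- (ln \<gamma> / I * (s * \<eta> / 2))) \<le> k / 2"
  proof -
    define c where "c = 1 / I * (s * \<eta> / 2)"
    have c: "c > 0" using I s \<eta> by (simp add: c_def)
    have "\<forall>\<^sub>F G::real in at_top. exp (- (c * G)) \<le> k / 2" using c k by real_asymp
    from eventually_ln[OF this] show ?thesis by (simp add: c_def mult_ac)
  qed
  moreover have "\<forall>\<^sub>F \<gamma>::real in at_top. (ln \<gamma> / I)\<^sup>2 * exp (- (s * k * ln \<gamma>)) \<le> k / 2"
  proof -
    define c where "c = s * k"
    have c: "c > 0" using s k by (simp add: c_def)
    have "\<forall>\<^sub>F G::real in at_top. (G / I)\<^sup>2 * exp (- (c * G)) \<le> k / 2" using c k I by real_asymp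
    from eventually_ln[OF this] show ?thesis by (simp only: c_def)
  qed
  moreover have "\<forall>\<^sub>F \<gamma> in at_top. \<epsilon> \<gamma> < \<eta> * (k / 2)"
    using \<epsilon> \<eta> k by (intro order_tendstoD(2)) auto
  moreover have "\<forall>\<^sub>F \<gamma> in at_top. real (w \<gamma>) / ln \<gamma> < k / I" using w k I by (intro order_tendstoD(2)) auto
  moreover have "\<forall>\<^sub>F \<gamma>::real in at_top. I / k < ln \<gamma>"
    by (intro eventually_ln eventually_gt_at_top)
  ultimately show ?thesis
    using g close B[OF k(1) k1]
  proof eventually_elim
    case (elim \<gamma>)
    have G: "ln \<gamma> > 0" using elim(5) I k by (smt (verit) divide_pos_pos)
    define H where "H = ln \<gamma> / I"
    have H: "H > 0" "1 \<le> k * H" "ln \<gamma> = I * H"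
      using G I elim(5) k by (auto simp: H_def field_simps)
    have BB: "(1 - k) * ln \<gamma> \<le> B \<gamma>" "B \<gamma> \<le> (1 + k) * ln \<gamma>" using elim(8) k by auto
    have \<epsilon>\<eta>: "\<epsilon> \<gamma> / \<eta> \<le> k / 2" using elim(3) \<eta> by (simp add: field_simps)
    have cl: "\<And>t. t \<ge> 1 \<Longrightarrow> (\<integral>\<^sup>+\<omega>. ennreal \<bar>g \<gamma> (\<lambda>i. x i \<omega>) t - \<Lambda> t \<omega>\<bar> \<partial>M) \<le> ennreal (\<epsilon> \<gamma>)"
      using elim(7) by auto
    have up: "expected_time M (\<lambda>\<omega>. cusum_time (g \<gamma> (\<lambda>i. x i \<omega>)) (B \<gamma>)) \<le> ennreal ((1 + \<kappa>) * H)"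
    proof -
      define r where "r = (1 + k) * H / (1 - k)"
      define m where "m = nat \<lceil>r\<rceil>"
      have "r > 0" using H k by (simp add: r_def)
      note m = nat_ceiling_bounds[OF this, folded m_def]
      have "I - 2 * \<eta> = I * (1 - k)" by (simp add: \<eta>_def algebra_simps)
      then have "r * (I - 2 * \<eta>) = (1 + k) * ln \<gamma>" using k by (simp add: r_def H(3))
      moreover have "r * (I - 2 * \<eta>) \<le> real m * (I - 2 * \<eta>)"
        using m(2) I k by (intro mult_right_mono) (auto simp: \<eta>_def)
      ultimately have mB: "B \<gamma> \<le> real m * (I - 2 * \<eta>)" using BB(2) by linarith
      have "H \<le> r" using H k by (simp add: r_def field_simps)
      then have "H * (s * \<eta> / 2) \<le> real m * (s * \<eta> / 2)" using m(2) s \<eta> by (intro mult_right_mono) auto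
      then have "exp (- (real m * s * \<eta> / 2)) \<le> exp (- (ln \<gamma> / I * (s * \<eta> / 2)))"
        by (simp add: H_def mult.assoc)
      then have q: "exp (- (real m * s * \<eta> / 2)) + \<epsilon> \<gamma> / \<eta> \<le> k" using elim(1) \<epsilon>\<eta> by linarith
      have "expected_time M (\<lambda>\<omega>. cusum_time (g \<gamma> (\<lambda>i. x i \<omega>)) (B \<gamma>)) \<le> ennreal (real (m + w \<gamma>) / (1 - k))"
        using k by (intro delay_le[OF iid elim(6) ind mgf cl a0 s tilt(1) I \<eta> \<epsilon>0 tilt(3) m(1) mB q]) auto
      also have "\<dots> \<le> ennreal ((1 + \<kappa>) * H)"
      proof (rule ennreal_leI)
        have "real (w \<gamma>) < k / I * ln \<gamma>" using elim(4) G by (simp only: pos_divide_less_eq)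
        then have "real (w \<gamma>) \<le> k * H" by (simp add: H_def)
        then have "real (m + w \<gamma>) \<le> r + 2 * k * H" using m(3) H(2) by simp
        moreover have "r \<le> (1 + 3 * k) * H"
        proof -
          have "(1 + k) * H \<le> (1 + 3 * k) * (1 - k) * H"
          proof (rule mult_right_mono)
            have "k * k \<le> k * (1 / 16)" using k by (intro mult_left_mono) auto
            then show "1 + k \<le> (1 + 3 * k) * (1 - k)" using k by (simp add: algebra_simps)
          qed (use H in auto)
          then show ?thesis using k by (simp add: r_def pos_divide_le_eq mult_ac)
        qed
        ultimately have "real (m + w \<gamma>) \<le> (1 + 5 * k) * H" by (simp add: algebra_simps)
        also have "\<dots> \<le> (1 + 16 * k) * (1 - k) * H"
        proof (rule mult_right_mono)
          have "k * k \<le> k * (1 / 16)" using k by (intro mult_left_mono) auto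
          then show "1 + 5 * k \<le> (1 + 16 * k) * (1 - k)" using k by (simp add: algebra_simps)
        qed (use H in auto)
        finally show "real (m + w \<gamma>) / (1 - k) \<le> (1 + \<kappa>) * H"
          using k by (simp add: k_def pos_divide_le_eq mult_ac)
      qed
      finally show ?thesis .
    qed
    have lo: "ennreal ((1 - \<kappa>) * H) \<le> expected_time M (\<lambda>\<omega>. cusum_time (g \<gamma> (\<lambda>i. x i \<omega>)) (B \<gamma>))"
    proof -
      define n where "n = nat \<lfloor>(1 - 3 * k) * H\<rfloor>"
      have "1 \<le> (1 - 3 * k) * H"
      proof -
        have "16 * k \<le> 1" using k by simp
        then have "k * H \<le> (1 - 3 * k) * H" using H k by (intro mult_right_mono) auto
        then show ?thesis using H(2) by linarith
      qed
      then have n: "n > 0" "real n \<le> (1 - 3 * k) * H" "(1 - 3 * k) * H - 1 \<le> real n"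
        unfolding n_def by linarith+
      have "real n * (I + 2 * \<eta>) \<le> (1 - 3 * k) * H * (I + 2 * \<eta>)"
        using n(2) I \<eta> by (intro mult_right_mono) auto
      also have "\<dots> = (1 - 3 * k) * (1 + k) * ln \<gamma>" by (simp add: \<eta>_def H(3) algebra_simps)
      also have "\<dots> \<le> (1 - 2 * k) * ln \<gamma>"
        using G k by (intro mult_right_mono) (auto simp: algebra_simps)
      finally have "real n * (I + 2 * \<eta>) - B \<gamma> \<le> - (k * ln \<gamma>)"
        using BB(1) by (simp add: algebra_simps)
      then have "s * (real n * (I + 2 * \<eta>) - B \<gamma>) \<le> s * - (k * ln \<gamma>)"
        using s by (intro mult_left_mono) auto
      moreover have "real n \<le> H"
      proof -
        have "(1 - 3 * k) * H \<le> 1 * H" using H k by (intro mult_right_mono) auto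
        then show ?thesis using n(2) by linarith
      qed
      ultimately have "(real n)\<^sup>2 * exp (s * (real n * (I + 2 * \<eta>) - B \<gamma>)) \<le> H\<^sup>2 * exp (- (s * k * ln \<gamma>))"
        by (intro mult_mono power_mono) (auto simp: mult.assoc)
      also have "\<dots> \<le> k / 2" using elim(2) by (simp add: H_def)
      finally have r: "\<epsilon> \<gamma> / \<eta> + (real n)\<^sup>2 * exp (s * (real n * (I + 2 * \<eta>) - B \<gamma>)) \<le> k"
        using \<epsilon>\<eta> by linarith
      have "(1 - \<kappa>) * H \<le> real n * (1 - k)"
      proof -
        have "(1 - 4 * k) * H \<le> real n" using n(3) H(2) by (simp add: algebra_simps)
        then have "(1 - 4 * k) * H * (1 - k) \<le> real n * (1 - k)" using k by (intro mult_right_mono) auto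
        moreover have "(1 - \<kappa>) * H \<le> (1 - 4 * k) * (1 - k) * H"
          using H k by (intro mult_right_mono) (auto simp: k_def algebra_simps)
        ultimately show ?thesis by (simp add: mult_ac)
      qed
      also have "\<dots> \<le> real n * (1 - (\<epsilon> \<gamma> / \<eta> + (real n)\<^sup>2 * exp (s * (real n * (I + 2 * \<eta>) - B \<gamma>))))"
        using r by (intro mult_left_mono) auto
      finally have "ennreal ((1 - \<kappa>) * H)
        \<le> ennreal (real n * (1 - (\<epsilon> \<gamma> / \<eta> + (real n)\<^sup>2 * exp (s * (real n * (I + 2 * \<eta>) - B \<gamma>)))))"
        by (rule ennreal_leI)
      also have "\<dots> \<le> expected_time M (\<lambda>\<omega>. cusum_time (g \<gamma> (\<lambda>i. x i \<omega>)) (B \<gamma>))"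
        by (rule delay_ge[OF iid elim(6) ind mgf cl a0 s tilt(1) I \<eta> \<epsilon>0 tilt(2) n(1)])
      finally show ?thesis .
    qed
    show ?case using up lo by (simp add: H_def I_def)
  qed
qed

lemma tendsto_one_of_relative_bounds:
  fixes E :: "real \<Rightarrow> ennreal" and c :: "real \<Rightarrow> real"
  assumes c: "\<forall>\<^sub>F \<gamma> in at_top. c \<gamma> > 0"
    and bounds: "\<And>\<kappa>. 0 < \<kappa> \<Longrightarrow> \<kappa> < 1 \<Longrightarrow>
      \<forall>\<^sub>F \<gamma> in at_top. ennreal ((1 - \<kappa>) * c \<gamma>) \<le> E \<gamma> \<and> E \<gamma> \<le> ennreal ((1 + \<kappa>) * c \<gamma>)"
  shows "((\<lambda>\<gamma>. enn2real (E \<gamma>) / c \<gamma>) \<longlongrightarrow> 1) at_top"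
    and "\<forall>\<^sub>F \<gamma> in at_top. E \<gamma> = ennreal (enn2real (E \<gamma>))"
proof -
  show "\<forall>\<^sub>F \<gamma> in at_top. E \<gamma> = ennreal (enn2real (E \<gamma>))"
  proof -
    have "\<forall>\<^sub>F \<gamma> in at_top. ennreal ((1 - 1/2) * c \<gamma>) \<le> E \<gamma> \<and> E \<gamma> \<le> ennreal ((1 + 1/2) * c \<gamma>)"
      by (rule bounds) auto
    then show ?thesis
    proof eventually_elim
      case (elim \<gamma>)
      then have "E \<gamma> < \<top>" by (auto intro: le_less_trans)
      then show ?case by simp
    qed
  qed
  show "((\<lambda>\<gamma>. enn2real (E \<gamma>) / c \<gamma>) \<longlongrightarrow> 1) at_top"
  proof (rule tendstoI)
    fix e :: real assume "e > 0"
    define \<kappa> where "\<kappa> = min (e / 2) (1 / 2)"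
    have \<kappa>: "0 < \<kappa>" "\<kappa> < 1" "\<kappa> < e" using \<open>e > 0\<close> by (auto simp: \<kappa>_def)
    show "\<forall>\<^sub>F \<gamma> in at_top. dist (enn2real (E \<gamma>) / c \<gamma>) 1 < e"
      using bounds[OF \<kappa>(1,2)] c
    proof eventually_elim
      case (elim \<gamma>)
      have "E \<gamma> \<noteq> \<top>" using elim(1) by (auto simp: top_unique)
      then have E: "E \<gamma> = ennreal (enn2real (E \<gamma>))" by (simp add: less_top)
      have "(1 + \<kappa>) * c \<gamma> \<ge> 0" using elim(2) \<kappa> by simp
      with elim(1) E have "(1 - \<kappa>) * c \<gamma> \<le> enn2real (E \<gamma>)" "enn2real (E \<gamma>) \<le> (1 + \<kappa>) * c \<gamma>"
        by (metis ennreal_le_iff enn2real_nonneg, metis ennreal_le_iff)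
      then have "1 - \<kappa> \<le> enn2real (E \<gamma>) / c \<gamma>" "enn2real (E \<gamma>) / c \<gamma> \<le> 1 + \<kappa>"
        using elim(2) by (auto simp: field_simps)
      then show ?case using \<kappa>(3) by (simp add: dist_real_def abs_less_iff)
    qed
  qed
qed

section \<open>The exact and the estimated procedure\<close>

lemma emerging_subspace_no_change:
  fixes x :: "nat \<Rightarrow> 'a \<Rightarrow> real^'k"
  assumes "emerging_subspace \<sigma> \<theta> u \<infinity> M x" "s > 0" "s\<^sup>2 = \<sigma>\<^sup>2"
  shows "iid_density M x (gauss s)"
proof -
  have "f_inf \<sigma> = (gauss s :: real^'k \<Rightarrow> real)" using f_inf_eq_gauss[OF assms(2,3)] by auto
  then show ?thesis using assms(1) by (simp add: emerging_subspace_def iid_density_def)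
qed

lemma emerging_subspace_change_at_0:
  fixes u :: "real^'k"
  assumes em: "emerging_subspace \<sigma> \<theta> u 0 M x" and s: "s > 0" "s\<^sup>2 = \<sigma>\<^sup>2"
    and \<theta>: "\<theta> > 0" and u: "norm u = 1" and \<rho>: "\<rho> = \<theta> / \<sigma>\<^sup>2"
  shows "iid_density M x (spiked s \<rho> u)" and "f_zero \<sigma> \<theta> u = spiked s \<rho> u"
proof -
  interpret prob_space M using em by (simp add: emerging_subspace_def)
  have pos: "\<not> enat t \<le> 0" if "t \<ge> 1" for t using that by (simp add: zero_enat_def)
  have dist: "distributed M lborel (x t) (\<lambda>y. ennreal (f_zero \<sigma> \<theta> u y))" if "t \<ge> 1" for t
  proof -
    have "distributed M lborel (x t) (\<lambda>y. ennreal (if enat t \<le> 0 then f_inf \<sigma> y else f_zero \<sigma> \<theta> u y))"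
      using em that by (simp add: emerging_subspace_def)
    then show ?thesis using pos[OF that] by simp
  qed
  have "(\<integral>\<^sup>+y. ennreal (f_zero \<sigma> \<theta> u y) \<partial>lborel) = 1"
    using distributed_nn_integral[OF dist[of 1], of "\<lambda>_. 1"] emeasure_space_1 by simp
  then show eq: "f_zero \<sigma> \<theta> u = spiked s \<rho> u"
    by (rule f_zero_eq_spiked[OF s \<theta> u \<rho>])
  show "iid_density M x (spiked s \<rho> u)"
    using em dist unfolding iid_density_def eq[symmetric] by (simp add: emerging_subspace_def)
qed

definition exact_llr :: "real \<Rightarrow> real \<Rightarrow> real^'k \<Rightarrow> real^'k \<Rightarrow> real"
  where "exact_llr s \<rho> u y = llr_scale s (1 + \<rho>) * ((u \<bullet> y)\<^sup>2 - llr_drift s (1 + \<rho>))"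

lemma exact_llr_eq:
  assumes s: "s > 0" and \<rho>: "\<rho> > 0"
  shows "ln (spiked s \<rho> u y / gauss s y) = exact_llr s \<rho> u y"
  using llr_scale_drift[OF s, of "1 + \<rho>"] \<rho>
  unfolding llr_eq[OF s \<rho>] exact_llr_def right_diff_distrib by (simp add: llr_scale_def)

lemma spiked_eq_tilt:
  assumes s: "s > 0" and \<rho>: "\<rho> > 0"
  shows "spiked s \<rho> u y = gauss s y * exp (exact_llr s \<rho> u y)"
proof -
  have "spiked s \<rho> u y / gauss s y > 0"
    using gauss_pos[OF s, of y] \<rho> by (simp add: spiked_def)
  then have "exp (exact_llr s \<rho> u y) = spiked s \<rho> u y / gauss s y"
    unfolding exact_llr_eq[OF s \<rho>, symmetric] by simp
  then show ?thesis using gauss_pos[OF s, of y] by simp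
qed

lemma borel_measurable_exact_llr[measurable]: "exact_llr s \<rho> u \<in> borel_measurable borel"
  unfolding exact_llr_def by measurable

lemma exact_llr_mgf:
  fixes u :: "real^'k"
  assumes s: "s > 0" and \<rho>: "\<rho> > 0" and u: "norm u = 1" and c: "c * \<rho> < 1"
  shows "(\<integral>\<^sup>+y. ennreal (exp ((1 + c) * exact_llr s \<rho> u y)) \<partial>gauss_measure s) = ennreal (llr_mgf (1 + \<rho>) c)"
  unfolding exact_llr_def
  using nn_integral_gauss_inner[OF s u, of "\<lambda>r. ennreal (exp ((1 + c) * (llr_scale s (1 + \<rho>) * (r\<^sup>2 - llr_drift s (1 + \<rho>)))))"]
    nn_integral_normal_llr[OF s, of "1 + \<rho>" c] \<rho> c by simp

lemma exact_llr_mgf_before: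
  fixes u :: "real^'k"
  assumes iid: "iid_density M x (gauss s)" and s: "s > 0" and \<rho>: "\<rho> > 0" and u: "norm u = 1"
    and c: "c * \<rho> < 1" and t: "t \<ge> 1"
  shows "(\<integral>\<^sup>+\<omega>. ennreal (exp ((1 + c) * exact_llr s \<rho> u (x t \<omega>))) \<partial>M) = ennreal (llr_mgf (1 + \<rho>) c)"
  unfolding exact_llr_mgf[OF s \<rho> u c, symmetric]
  using iid_nn_integral[OF iid t, of "\<lambda>y. ennreal (exp ((1 + c) * exact_llr s \<rho> u y))"]
  by (simp add: nn_integral_gauss_measure)

lemma exact_llr_mgf_after:
  fixes u :: "real^'k"
  assumes iid: "iid_density M x (spiked s \<rho> u)" and s: "s > 0" and \<rho>: "\<rho> > 0" and u: "norm u = 1"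
    and c: "c * \<rho> < 1" and t: "t \<ge> 1"
  shows "(\<integral>\<^sup>+\<omega>. ennreal (exp (c * exact_llr s \<rho> u (x t \<omega>))) \<partial>M) = ennreal (llr_mgf (1 + \<rho>) c)"
proof -
  have "(\<integral>\<^sup>+\<omega>. ennreal (exp (c * exact_llr s \<rho> u (x t \<omega>))) \<partial>M)
    = (\<integral>\<^sup>+y. ennreal (spiked s \<rho> u y) * ennreal (exp (c * exact_llr s \<rho> u y)) \<partial>lborel)"
    by (rule iid_nn_integral[OF iid t]) measurable
  also have "\<dots> = (\<integral>\<^sup>+y. ennreal (gauss s y) * ennreal (exp ((1 + c) * exact_llr s \<rho> u y)) \<partial>lborel)"
  proof (intro nn_integral_cong)
    fix y
    have "spiked s \<rho> u y * exp (c * exact_llr s \<rho> u y) = gauss s y * exp ((1 + c) * exact_llr s \<rho> u y)"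
      by (simp add: spiked_eq_tilt[OF s \<rho>] distrib_right exp_add)
    then show "ennreal (spiked s \<rho> u y) * ennreal (exp (c * exact_llr s \<rho> u y))
        = ennreal (gauss s y) * ennreal (exp ((1 + c) * exact_llr s \<rho> u y))"
      by (simp add: ennreal_mult'[symmetric] ennreal_mult''[symmetric])
  qed
  also have "\<dots> = (\<integral>\<^sup>+y. ennreal (exp ((1 + c) * exact_llr s \<rho> u y)) \<partial>gauss_measure s)"
    by (subst nn_integral_gauss_measure) auto
  finally show ?thesis by (simp only: exact_llr_mgf[OF s \<rho> u c])
qed

lemma indep_vars_exact_llr:
  assumes iid: "iid_density M x f"
  shows "prob_space.indep_vars M (\<lambda>_. borel) (\<lambda>t \<omega>. exact_llr s \<rho> u (x t \<omega>)) {1..}"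
  by (rule prob_space.indep_vars_compose2[OF iid_prob_space[OF iid] iid_indep[OF iid], where Y="\<lambda>_. exact_llr s \<rho> u"])
    measurable

text \<open>Scaled in this way the increment of the subspace procedure has, before the change, exactly the law
  of a log-likelihood ratio with variance ratio \<open>a\<close>.\<close>

definition subspace_llr :: "real \<Rightarrow> nat \<Rightarrow> real \<Rightarrow> (nat \<Rightarrow> real^'k) \<Rightarrow> nat \<Rightarrow> real"
  where "subspace_llr s w a z t = llr_scale s a * (proj_stat w z t - llr_drift s a)"

lemma window_stat_subspace_llr: "window_stat w (subspace_llr s w a)"
  using window_stat_proj_stat[of w "llr_scale s a" "llr_drift s a"]
  by (simp add: subspace_llr_def[abs_def])

lemma subspace_llr_before:
  fixes x :: "nat \<Rightarrow> 'a \<Rightarrow> real^'k"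
  assumes iid: "iid_density M x (gauss s)" and s: "s > 0" and w: "w > 0" and a: "a > 1"
  shows "prob_space.indep_vars M (\<lambda>_. borel) (\<lambda>t \<omega>. subspace_llr s w a (\<lambda>i. x i \<omega>) t) {1..}"
    and "t \<ge> 1 \<Longrightarrow> c * (a - 1) < 1 \<Longrightarrow>
      (\<integral>\<^sup>+\<omega>. ennreal (exp ((1 + c) * subspace_llr s w a (\<lambda>i. x i \<omega>) t)) \<partial>M) = ennreal (llr_mgf a c)"
proof -
  show "prob_space.indep_vars M (\<lambda>_. borel) (\<lambda>t \<omega>. subspace_llr s w a (\<lambda>i. x i \<omega>) t) {1..}"
    unfolding subspace_llr_def
    by (rule prob_space.indep_vars_compose2[OF iid_prob_space[OF iid] indep_vars_proj_stat[OF iid s w],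
          where Y="\<lambda>_ r. llr_scale s a * (r - llr_drift s a)"]) measurable
  assume t: "t \<ge> 1" and c: "c * (a - 1) < 1"
  show "(\<integral>\<^sup>+\<omega>. ennreal (exp ((1 + c) * subspace_llr s w a (\<lambda>i. x i \<omega>) t)) \<partial>M) = ennreal (llr_mgf a c)"
    unfolding subspace_llr_def nn_integral_normal_llr[OF s a c, symmetric]
    using nn_integral_proj_stat_prod[OF iid s w, of "{t}"
        "\<lambda>_ r. ennreal (exp ((1 + c) * (llr_scale s a * (r - llr_drift s a))))"] t by simp
qed

text \<open>After the change the statistic differs in mean from the exact log-likelihood ratio by the error of
  the estimated direction and by the errors of the two normalising constants.\<close>

lemma subspace_llr_error:
  fixes x :: "nat \<Rightarrow> 'a \<Rightarrow> real^'k"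
  assumes iid: "iid_density M x (spiked s \<rho> u)" and s: "s > 0" and \<rho>: "\<rho> > 0" and u: "norm u = 1"
  shows "\<exists>K\<ge>0. \<forall>w>0. \<forall>a>1. \<forall>t\<ge>1.
    (\<integral>\<^sup>+\<omega>. ennreal \<bar>subspace_llr s w a (\<lambda>i. x i \<omega>) t - exact_llr s \<rho> u (x t \<omega>)\<bar> \<partial>M)
    \<le> ennreal (llr_scale s a * (K / sqrt (sqrt (real w)))
        + \<bar>llr_scale s a - llr_scale s (1 + \<rho>)\<bar> * (s\<^sup>2 * (1 + \<rho>)) + \<bar>ln a - ln (1 + \<rho>)\<bar> / 2)"
proof -
  interpret prob_space M by (rule iid_prob_space[OF iid])
  obtain K where K: "K \<ge> 0" "\<And>w t. w > 0 \<Longrightarrow> t \<ge> 1 \<Longrightarrow>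
    (\<integral>\<^sup>+\<omega>. ennreal \<bar>proj_stat w (\<lambda>i. x i \<omega>) t - (u \<bullet> x t \<omega>)\<^sup>2\<bar> \<partial>M) \<le> ennreal (K / sqrt (sqrt (real w)))"
    using proj_stat_mean_error[OF iid s \<rho> u] by blast
  show ?thesis
  proof (intro exI[of _ K] conjI allI impI)
    show "K \<ge> 0" by fact
    fix w t :: nat and a :: real assume w: "w > 0" and a: "a > 1" and t: "t \<ge> 1"
    note [measurable] = iid_measurable[OF iid t] borel_measurable_proj_stat_iid[OF iid t]
    define p where "p = llr_scale s a"
    define q where "q = \<bar>llr_scale s a - llr_scale s (1 + \<rho>)\<bar>"
    define r where "r = \<bar>ln a - ln (1 + \<rho>)\<bar> / 2"
    have pqr: "p \<ge> 0" "q \<ge> 0" "r \<ge> 0" using llr_scale_pos[OF s a] by (auto simp: p_def q_def r_def)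
    let ?Y = "\<lambda>\<omega>. proj_stat w (\<lambda>i. x i \<omega>) t" and ?V = "\<lambda>\<omega>. (u \<bullet> x t \<omega>)\<^sup>2"
    have V: "(\<integral>\<^sup>+\<omega>. ennreal (?V \<omega>) \<partial>M) = ennreal (s\<^sup>2 * (1 + \<rho>))"
      using iid_nn_integral[OF iid t, of "\<lambda>y. ennreal ((u \<bullet> y)\<^sup>2)"]
        nn_integral_spiked_inner_moments(1)[OF s \<rho> u, of u] u by (simp add: norm_eq_1)
    have "(\<integral>\<^sup>+\<omega>. ennreal \<bar>subspace_llr s w a (\<lambda>i. x i \<omega>) t - exact_llr s \<rho> u (x t \<omega>)\<bar> \<partial>M)
      \<le> (\<integral>\<^sup>+\<omega>. ennreal p * ennreal \<bar>?Y \<omega> - ?V \<omega>\<bar> + (ennreal q * ennreal (?V \<omega>) + ennreal r) \<partial>M)"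
    proof (intro nn_integral_mono)
      fix \<omega>
      have "subspace_llr s w a (\<lambda>i. x i \<omega>) t - exact_llr s \<rho> u (x t \<omega>)
        = p * (?Y \<omega> - ?V \<omega>) + (llr_scale s a - llr_scale s (1 + \<rho>)) * ?V \<omega>
          - (llr_scale s a * llr_drift s a - llr_scale s (1 + \<rho>) * llr_drift s (1 + \<rho>))"
        by (simp add: subspace_llr_def exact_llr_def p_def algebra_simps)
      also have "llr_scale s a * llr_drift s a - llr_scale s (1 + \<rho>) * llr_drift s (1 + \<rho>) = (ln a - ln (1 + \<rho>)) / 2"
        using llr_scale_drift[OF s a] llr_scale_drift[OF s, of "1 + \<rho>"] \<rho> by (simp add: diff_divide_distrib)
      finally have "\<bar>subspace_llr s w a (\<lambda>i. x i \<omega>) t - exact_llr s \<rho> u (x t \<omega>)\<bar>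
        \<le> \<bar>p * (?Y \<omega> - ?V \<omega>)\<bar> + \<bar>(llr_scale s a - llr_scale s (1 + \<rho>)) * ?V \<omega>\<bar> + \<bar>(ln a - ln (1 + \<rho>)) / 2\<bar>"
        by (simp only:)
      also have "\<dots> = p * \<bar>?Y \<omega> - ?V \<omega>\<bar> + (q * ?V \<omega> + r)"
        using pqr by (simp add: abs_mult q_def r_def)
      finally have "ennreal \<bar>subspace_llr s w a (\<lambda>i. x i \<omega>) t - exact_llr s \<rho> u (x t \<omega>)\<bar>
        \<le> ennreal (p * \<bar>?Y \<omega> - ?V \<omega>\<bar> + (q * ?V \<omega> + r))" by (rule ennreal_leI)
      also have "\<dots> = ennreal p * ennreal \<bar>?Y \<omega> - ?V \<omega>\<bar> + (ennreal q * ennreal (?V \<omega>) + ennreal r)"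
        using pqr by (simp add: ennreal_mult)
      finally show "ennreal \<bar>subspace_llr s w a (\<lambda>i. x i \<omega>) t - exact_llr s \<rho> u (x t \<omega>)\<bar>
        \<le> ennreal p * ennreal \<bar>?Y \<omega> - ?V \<omega>\<bar> + (ennreal q * ennreal (?V \<omega>) + ennreal r)" .
    qed
    also have "\<dots> = ennreal p * (\<integral>\<^sup>+\<omega>. ennreal \<bar>?Y \<omega> - ?V \<omega>\<bar> \<partial>M) + (ennreal q * (\<integral>\<^sup>+\<omega>. ennreal (?V \<omega>) \<partial>M) + ennreal r)"
      by (simp add: nn_integral_add nn_integral_cmult emeasure_space_1)
    also have "\<dots> \<le> ennreal p * ennreal (K / sqrt (sqrt (real w))) + (ennreal q * ennreal (s\<^sup>2 * (1 + \<rho>)) + ennreal r)"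
      unfolding V by (intro add_mono mult_left_mono K(2) w t) auto
    also have "\<dots> = ennreal (p * (K / sqrt (sqrt (real w))) + (q * (s\<^sup>2 * (1 + \<rho>)) + r))"
    proof -
      have "0 \<le> K / sqrt (sqrt (real w))" "0 \<le> s\<^sup>2 * (1 + \<rho>)" using K(1) \<rho> by auto
      with pqr show ?thesis by (simp only: ennreal_plus ennreal_mult mult_nonneg_nonneg add_nonneg_nonneg)
    qed
    finally show "(\<integral>\<^sup>+\<omega>. ennreal \<bar>subspace_llr s w a (\<lambda>i. x i \<omega>) t - exact_llr s \<rho> u (x t \<omega>)\<bar> \<partial>M)
      \<le> ennreal (llr_scale s a * (K / sqrt (sqrt (real w)))
        + \<bar>llr_scale s a - llr_scale s (1 + \<rho>)\<bar> * (s\<^sup>2 * (1 + \<rho>)) + \<bar>ln a - ln (1 + \<rho>)\<bar> / 2)"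
      by (simp add: p_def q_def r_def add.assoc)
  qed
qed

text \<open>Scaling increments and threshold together does not change the alarm time, and the chosen top
  eigenvectors matter only on a null set.\<close>

lemma expected_subspace_cusum_time:
  fixes x :: "nat \<Rightarrow> 'a \<Rightarrow> real^'k"
  assumes iid: "iid_density M x f" and est: "subspace_estimator M x w uhat" and w: "w > 0"
    and s: "s > 0" and a: "a > 1"
  shows "expected_time M (subspace_cusum_time x uhat (llr_drift s a) b)
    = expected_time M (\<lambda>\<omega>. cusum_time (subspace_llr s w a (\<lambda>i. x i \<omega>)) (llr_scale s a * b))"
  unfolding expected_time_def
proof (rule nn_integral_cong_AE)
  show "AE \<omega> in M. ennreal_of_enat (subspace_cusum_time x uhat (llr_drift s a) b \<omega>)
    = ennreal_of_enat (cusum_time (subspace_llr s w a (\<lambda>i. x i \<omega>)) (llr_scale s a * b))"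
    using AE_estimator_eq_proj_stat[OF iid w est]
  proof eventually_elim
    case (elim \<omega>)
    have "cusum_time (subspace_llr s w a (\<lambda>i. x i \<omega>)) (llr_scale s a * b)
      = cusum_time (\<lambda>t. proj_stat w (\<lambda>i. x i \<omega>) t - llr_drift s a) b"
      using cusum_time_scale[OF llr_scale_pos[OF s a]] by (simp add: subspace_llr_def[abs_def])
    also have "\<dots> = subspace_cusum_time x uhat (llr_drift s a) b \<omega>"
      unfolding subspace_cusum_time_def using elim by (intro cusum_time_cong) auto
    finally show ?case by simp
  qed
qed

text \<open>The optimised drift is the one for which the increments become log-likelihood ratios with the
  variance ratio \<open>a\<close>, which discounts the true ratio \<open>1 + \<rho>\<close> for the error of a direction estimated from
  \<open>w\<close> observations.\<close>

lemma opt_drift_eq: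
  assumes "s\<^sup>2 = \<sigma>\<^sup>2" and "a = (1 + \<rho>) * (1 - (k - 1) / (w * \<rho>))"
  shows "opt_drift \<sigma> \<rho> k w = llr_drift s a"
  unfolding opt_drift_def llr_drift_def assms by (simp add: mult.assoc)

theorem theorem1:
  fixes \<sigma> \<theta> \<rho> :: real and u :: "real^'k"
    and P_inf P_zero :: "'a measure" and x :: "nat \<Rightarrow> 'a \<Rightarrow> real^'k"
    and w :: "real \<Rightarrow> nat" and \<epsilon> :: "real \<Rightarrow> real" and d :: "real \<Rightarrow> real"
    and uhat :: "real \<Rightarrow> nat \<Rightarrow> 'a \<Rightarrow> real^'k"
    and b b' :: "real \<Rightarrow> real"
  assumes dim: "CARD('k) \<ge> 2"
    and sigma: "\<sigma>\<^sup>2 > 0" and theta: "\<theta> > 0" and rho: "\<rho> = \<theta> / \<sigma>\<^sup>2"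
    and u: "norm u = 1"
    and no_change: "emerging_subspace \<sigma> \<theta> u \<infinity> P_inf x"
    and change_at_0: "emerging_subspace \<sigma> \<theta> u 0 P_zero x"
    and window_pos: "\<forall>\<^sub>F \<gamma> in at_top. w \<gamma> > 0"
    and window: "\<forall>\<^sub>F \<gamma> in at_top.
      real (w \<gamma>) = sqrt (ln \<gamma>) * (sqrt (2 * (real CARD('k) - 1)) / (\<rho> - ln (1 + \<rho>))) * (1 + \<epsilon> \<gamma>)"
    and eps: "(\<epsilon> \<longlongrightarrow> 0) at_top"
    and drift: "\<forall>\<^sub>F \<gamma> in at_top. d \<gamma> = opt_drift \<sigma> \<rho> (real CARD('k)) (real (w \<gamma>))"
    and estimator: "\<forall>\<^sub>F \<gamma> in at_top.
      subspace_estimator P_inf x (w \<gamma>) (uhat \<gamma>) \<and> subspace_estimator P_zero x (w \<gamma>) (uhat \<gamma>)"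
    and ARL_subspace: "\<forall>\<^sub>F \<gamma> in at_top.
      expected_time P_inf (subspace_cusum_time x (uhat \<gamma>) (d \<gamma>) (b' \<gamma>)) = ennreal \<gamma>"
    and ARL_exact: "\<forall>\<^sub>F \<gamma> in at_top.
      expected_time P_inf (exact_cusum_time \<sigma> \<theta> u x (b \<gamma>)) = ennreal \<gamma>"
  shows "((\<lambda>\<gamma>. (expected_time P_zero (subspace_cusum_time x (uhat \<gamma>) (d \<gamma>) (b' \<gamma>)) + of_nat (w \<gamma>))
              / expected_time P_zero (exact_cusum_time \<sigma> \<theta> u x (b \<gamma>))) \<longlongrightarrow> 1) at_top"
proof -
  define s where "s = \<bar>\<sigma>\<bar>"
  have s: "s > 0" "s\<^sup>2 = \<sigma>\<^sup>2" using sigma by (auto simp: s_def)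
  have \<rho>: "\<rho> > 0" using theta sigma by (simp add: rho)
  define a0 where "a0 = 1 + \<rho>"
  have a0: "a0 > 1" using \<rho> by (simp add: a0_def)
  note iid_inf = emerging_subspace_no_change[OF no_change s]
  note iid_zero = emerging_subspace_change_at_0(1)[OF change_at_0 s theta u rho]
    and f_zero = emerging_subspace_change_at_0(2)[OF change_at_0 s theta u rho]
  have f_inf: "f_inf \<sigma> = gauss s" using f_inf_eq_gauss[OF s] by auto

  \<comment> \<open>the window tends to infinity, but more slowly than \<open>ln \<gamma>\<close>\<close>
  define C where "C = sqrt (2 * (real CARD('k) - 1)) / (\<rho> - ln (1 + \<rho>))"
  have C: "C > 0"
    using dim kl_pos[OF a0] by (auto simp: C_def kl_def a0_def intro!: divide_pos_pos)
  have eps1: "((\<lambda>\<gamma>. C * (1 + \<epsilon> \<gamma>)) \<longlongrightarrow> C * (1 + 0)) at_top" by (intro tendsto_intros eps)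
  have w_top: "filterlim (\<lambda>\<gamma>. real (w \<gamma>)) at_top at_top"
  proof -
    have "filterlim (\<lambda>\<gamma>::real. sqrt (ln \<gamma>)) at_top at_top" by real_asymp
    from filterlim_tendsto_pos_mult_at_top[OF eps1 _ this] C
    have "filterlim (\<lambda>\<gamma>. C * (1 + \<epsilon> \<gamma>) * sqrt (ln \<gamma>)) at_top at_top" by simp
    then show ?thesis
      by (rule filterlim_cong[THEN iffD1, rotated 3])
        (use window in \<open>auto simp: C_def mult_ac elim: eventually_mono\<close>)
  qed
  have w_small: "((\<lambda>\<gamma>. real (w \<gamma>) / ln \<gamma>) \<longlongrightarrow> 0) at_top"
  proof -
    have "((\<lambda>\<gamma>::real. sqrt (ln \<gamma>) / ln \<gamma>) \<longlongrightarrow> 0) at_top" by real_asymp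
    from tendsto_mult[OF this eps1]
    have "((\<lambda>\<gamma>. sqrt (ln \<gamma>) / ln \<gamma> * (C * (1 + \<epsilon> \<gamma>))) \<longlongrightarrow> 0) at_top" by simp
    then show ?thesis
      by (rule tendsto_cong[THEN iffD1, rotated])
        (use window in \<open>auto simp: C_def mult_ac elim!: eventually_mono\<close>)
  qed

  \<comment> \<open>the effective variance ratio, which tends to the true one\<close>
  define a where "a \<gamma> = (1 + \<rho>) * (1 - (real CARD('k) - 1) / (real (w \<gamma>) * \<rho>))" for \<gamma>
  have a_lim: "(a \<longlongrightarrow> a0) at_top"
  proof -
    have "filterlim (\<lambda>\<gamma>. real (w \<gamma>) * \<rho>) at_top at_top"
      using filterlim_tendsto_pos_mult_at_top[OF tendsto_const \<rho> w_top] by (simp add: mult.commute)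
    then have "((\<lambda>\<gamma>. (real CARD('k) - 1) / (real (w \<gamma>) * \<rho>)) \<longlongrightarrow> 0) at_top"
      by (intro tendsto_divide_0[OF tendsto_const] filterlim_at_top_imp_at_infinity)
    then have "((\<lambda>\<gamma>. (1 + \<rho>) * (1 - (real CARD('k) - 1) / (real (w \<gamma>) * \<rho>))) \<longlongrightarrow> (1 + \<rho>) * (1 - 0)) at_top"
      by (intro tendsto_intros)
    then show ?thesis by (simp add: a_def[abs_def] a0_def)
  qed
  have a_gt: "\<forall>\<^sub>F \<gamma> in at_top. a \<gamma> > 1" using a_lim a0 by (rule order_tendstoD)
  have d_eq: "\<forall>\<^sub>F \<gamma> in at_top. d \<gamma> = llr_drift s (a \<gamma>)"
    using drift by eventually_elim (simp add: opt_drift_eq[OF s(2) a_def])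

  let ?g = "\<lambda>\<gamma>. subspace_llr s (w \<gamma>) (a \<gamma>) :: (nat \<Rightarrow> real^'k) \<Rightarrow> nat \<Rightarrow> real"
  let ?h = "\<lambda>z t. exact_llr s \<rho> u (z t)"
  let ?B = "\<lambda>\<gamma>. llr_scale s (a \<gamma>) * b' \<gamma>"
  define E where "E M \<gamma> = expected_time M (\<lambda>\<omega>. cusum_time (?g \<gamma> (\<lambda>i. x i \<omega>)) (?B \<gamma>))" for M \<gamma>
  define F where "F M \<gamma> = expected_time M (\<lambda>\<omega>. cusum_time (?h (\<lambda>i. x i \<omega>)) (b \<gamma>))" for M \<gamma>
  have sub: "\<forall>\<^sub>F \<gamma> in at_top. expected_time P_inf (subspace_cusum_time x (uhat \<gamma>) (d \<gamma>) (b' \<gamma>)) = E P_inf \<gamma> \<and>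
     expected_time P_zero (subspace_cusum_time x (uhat \<gamma>) (d \<gamma>) (b' \<gamma>)) = E P_zero \<gamma>"
    using d_eq estimator window_pos a_gt
    by eventually_elim
      (simp add: E_def expected_subspace_cusum_time[OF iid_inf _ _ s(1)] expected_subspace_cusum_time[OF iid_zero _ _ s(1)])
  have exact: "expected_time M (exact_cusum_time \<sigma> \<theta> u x (b \<gamma>)) = F M \<gamma>" for M \<gamma>
    by (simp add: F_def exact_cusum_time_def[abs_def] f_zero f_inf exact_llr_eq[OF s(1) \<rho>])
  have win_exact: "window_stat 0 ?h"
    unfolding exact_llr_def by (rule window_stat_inner)
  note mgf_zero = exact_llr_mgf_after[OF iid_zero s(1) \<rho> u]
  have a0_\<rho>: "a0 - 1 = \<rho>" by (simp add: a0_def)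

  \<comment> \<open>the subspace procedure\<close>
  have B: "\<forall>\<^sub>F \<gamma> in at_top. (1 - \<kappa>) * ln \<gamma> \<le> ?B \<gamma> \<and> ?B \<gamma> \<le> (1 + \<kappa>) * ln \<gamma>" if "0 < \<kappa>" "\<kappa> < 1" for \<kappa>
  proof (rule arl_threshold_asymptotics[OF iid_inf a_lim a0 w_small _ _ _ _ that, where g="?g"])
    show "\<forall>\<^sub>F \<gamma> in at_top. window_stat (w \<gamma>) (?g \<gamma>)" by (simp add: window_stat_subspace_llr)
    show "\<forall>\<^sub>F \<gamma> in at_top. prob_space.indep_vars P_inf (\<lambda>_. borel) (\<lambda>t \<omega>. ?g \<gamma> (\<lambda>i. x i \<omega>) t) {1..}"
      using window_pos a_gt by eventually_elim (rule subspace_llr_before(1)[OF iid_inf s(1)])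
    show "\<forall>\<^sub>F \<gamma> in at_top. \<forall>t c. t \<ge> 1 \<longrightarrow> c * (a \<gamma> - 1) < 1 \<longrightarrow>
      (\<integral>\<^sup>+\<omega>. ennreal (exp ((1 + c) * ?g \<gamma> (\<lambda>i. x i \<omega>) t)) \<partial>P_inf) = ennreal (llr_mgf (a \<gamma>) c)"
      using window_pos a_gt by eventually_elim (intro allI impI subspace_llr_before(2)[OF iid_inf s(1)])
    show "\<forall>\<^sub>F \<gamma> in at_top. expected_time P_inf (\<lambda>\<omega>. cusum_time (?g \<gamma> (\<lambda>i. x i \<omega>)) (?B \<gamma>)) = ennreal \<gamma>"
      using ARL_subspace sub by eventually_elim (simp add: E_def)
  qed
  from subspace_llr_error[OF iid_zero s(1) \<rho> u] obtain K where "K \<ge> 0 \<and> (\<forall>w>0. \<forall>a>1. \<forall>t\<ge>1.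
    (\<integral>\<^sup>+\<omega>. ennreal \<bar>subspace_llr s w a (\<lambda>i. x i \<omega>) t - exact_llr s \<rho> u (x t \<omega>)\<bar> \<partial>P_zero)
    \<le> ennreal (llr_scale s a * (K / sqrt (sqrt (real w)))
        + \<bar>llr_scale s a - llr_scale s (1 + \<rho>)\<bar> * (s\<^sup>2 * (1 + \<rho>)) + \<bar>ln a - ln (1 + \<rho>)\<bar> / 2))"
    by (rule exE)
  note K = conjunct1[OF this] conjunct2[OF this, rule_format]
  define e where "e \<gamma> = \<bar>llr_scale s (a \<gamma>) * (K / sqrt (sqrt (real (w \<gamma>))))
        + \<bar>llr_scale s (a \<gamma>) - llr_scale s (1 + \<rho>)\<bar> * (s\<^sup>2 * (1 + \<rho>)) + \<bar>ln (a \<gamma>) - ln (1 + \<rho>)\<bar> / 2\<bar>" for \<gamma>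
  have e_lim: "(e \<longlongrightarrow> 0) at_top"
  proof -
    have sc: "((\<lambda>\<gamma>. llr_scale s (a \<gamma>)) \<longlongrightarrow> llr_scale s (1 + \<rho>)) at_top"
      unfolding llr_scale_def using a_lim s(1) \<rho> unfolding a0_def by (intro tendsto_intros) auto
    have ln: "((\<lambda>\<gamma>. ln (a \<gamma>)) \<longlongrightarrow> ln (1 + \<rho>)) at_top"
      using a_lim \<rho> unfolding a0_def by (intro tendsto_intros) auto
    have "filterlim (\<lambda>r::real. sqrt (sqrt r)) at_top at_top" by real_asymp
    from filterlim_compose[OF this w_top]
    have ww: "((\<lambda>\<gamma>. K / sqrt (sqrt (real (w \<gamma>)))) \<longlongrightarrow> 0) at_top"
      by (intro tendsto_divide_0[OF tendsto_const] filterlim_at_top_imp_at_infinity)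
    have "(e \<longlongrightarrow> \<bar>llr_scale s (1 + \<rho>) * 0 + \<bar>llr_scale s (1 + \<rho>) - llr_scale s (1 + \<rho>)\<bar> * (s\<^sup>2 * (1 + \<rho>))
        + \<bar>ln (1 + \<rho>) - ln (1 + \<rho>)\<bar> / 2\<bar>) at_top"
      unfolding e_def by (intro tendsto_intros sc ln ww) auto
    then show ?thesis by simp
  qed
  have sub_bounds: "\<forall>\<^sub>F \<gamma> in at_top. ennreal ((1 - \<kappa>) * (ln \<gamma> / kl a0)) \<le> E P_zero \<gamma> \<and>
    E P_zero \<gamma> \<le> ennreal ((1 + \<kappa>) * (ln \<gamma> / kl a0))" if "0 < \<kappa>" "\<kappa> < 1" for \<kappa>
    unfolding E_def
  proof (rule delay_asymptotics[OF iid_zero a0 w_small _ indep_vars_exact_llr[OF iid_zero] _ _ _ e_lim B that])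
    show "\<forall>\<^sub>F \<gamma> in at_top. window_stat (w \<gamma>) (?g \<gamma>)" by (simp add: window_stat_subspace_llr)
    show "\<forall>\<^sub>F \<gamma> in at_top. \<forall>t\<ge>1. (\<integral>\<^sup>+\<omega>. ennreal \<bar>?g \<gamma> (\<lambda>i. x i \<omega>) t - exact_llr s \<rho> u (x t \<omega>)\<bar> \<partial>P_zero) \<le> ennreal (e \<gamma>)"
      using window_pos a_gt
    proof eventually_elim
      case (elim \<gamma>)
      show ?case
        unfolding e_def by (intro allI impI order_trans[OF K(2)[OF elim]] ennreal_leI abs_ge_self)
    qed
  qed (use mgf_zero in \<open>auto simp: e_def a0_\<rho> a0_def\<close>)

  \<comment> \<open>the exact procedure is the same argument without window and without error\<close>
  have b: "\<forall>\<^sub>F \<gamma> in at_top. (1 - \<kappa>) * ln \<gamma> \<le> b \<gamma> \<and> b \<gamma> \<le> (1 + \<kappa>) * ln \<gamma>" if "0 < \<kappa>" "\<kappa> < 1" for \<kappa>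
  proof (rule arl_threshold_asymptotics[OF iid_inf tendsto_const a0 _ _ _ _ _ that, where g="\<lambda>_. ?h" and w="\<lambda>_. 0"])
    show "\<forall>\<^sub>F \<gamma>::real in at_top. \<forall>t c. t \<ge> 1 \<longrightarrow> c * (a0 - 1) < 1 \<longrightarrow>
      (\<integral>\<^sup>+\<omega>. ennreal (exp ((1 + c) * exact_llr s \<rho> u (x t \<omega>))) \<partial>P_inf) = ennreal (llr_mgf a0 c)"
      unfolding a0_\<rho> using exact_llr_mgf_before[OF iid_inf s(1) \<rho> u] by (simp add: a0_def)
    show "\<forall>\<^sub>F \<gamma> in at_top. expected_time P_inf (\<lambda>\<omega>. cusum_time (?h (\<lambda>i. x i \<omega>)) (b \<gamma>)) = ennreal \<gamma>"
      using ARL_exact unfolding exact F_def .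
  qed (use win_exact indep_vars_exact_llr[OF iid_inf] in auto)
  have exact_bounds: "\<forall>\<^sub>F \<gamma> in at_top. ennreal ((1 - \<kappa>) * (ln \<gamma> / kl a0)) \<le> F P_zero \<gamma> \<and>
    F P_zero \<gamma> \<le> ennreal ((1 + \<kappa>) * (ln \<gamma> / kl a0))" if "0 < \<kappa>" "\<kappa> < 1" for \<kappa>
    unfolding F_def
  proof (rule delay_asymptotics[OF iid_zero a0 _ _ indep_vars_exact_llr[OF iid_zero] _ _ _ _ b that,
        where w="\<lambda>_. 0" and \<epsilon>="\<lambda>_. 0" and g="\<lambda>_. ?h"])
  qed (use mgf_zero win_exact in \<open>auto simp: a0_\<rho> a0_def\<close>)

  have "\<forall>\<^sub>F \<gamma>::real in at_top. ln \<gamma> > 0" by real_asymp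
  then have pos: "\<forall>\<^sub>F \<gamma> in at_top. ln \<gamma> / kl a0 > 0"
    by eventually_elim (simp add: kl_pos[OF a0])
  have E1: "((\<lambda>\<gamma>. enn2real (E P_zero \<gamma>) / (ln \<gamma> / kl a0)) \<longlongrightarrow> 1) at_top"
    and E_fin: "\<forall>\<^sub>F \<gamma> in at_top. E P_zero \<gamma> = ennreal (enn2real (E P_zero \<gamma>))"
    by (rule tendsto_one_of_relative_bounds[OF pos], rule sub_bounds, assumption+)+
  have F1: "((\<lambda>\<gamma>. enn2real (F P_zero \<gamma>) / (ln \<gamma> / kl a0)) \<longlongrightarrow> 1) at_top"
    and F_fin: "\<forall>\<^sub>F \<gamma> in at_top. F P_zero \<gamma> = ennreal (enn2real (F P_zero \<gamma>))"
    by (rule tendsto_one_of_relative_bounds[OF pos], rule exact_bounds, assumption+)+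
  \<comment> \<open>divided by \<open>ln \<gamma> / kl a0\<close>, both delays tend to one and the window tends to zero\<close>
  have "((\<lambda>\<gamma>. (enn2real (E P_zero \<gamma>) / (ln \<gamma> / kl a0) + kl a0 * (real (w \<gamma>) / ln \<gamma>))
      / (enn2real (F P_zero \<gamma>) / (ln \<gamma> / kl a0))) \<longlongrightarrow> (1 + kl a0 * 0) / 1) at_top"
    by (intro tendsto_intros E1 F1 w_small) auto
  then have "((\<lambda>\<gamma>. ennreal ((enn2real (E P_zero \<gamma>) / (ln \<gamma> / kl a0) + kl a0 * (real (w \<gamma>) / ln \<gamma>))
      / (enn2real (F P_zero \<gamma>) / (ln \<gamma> / kl a0)))) \<longlongrightarrow> ennreal 1) at_top"
    by (intro tendsto_ennrealI) simp
  moreover have "\<forall>\<^sub>F \<gamma> in at_top. ennreal ((enn2real (E P_zero \<gamma>) / (ln \<gamma> / kl a0) + kl a0 * (real (w \<gamma>) / ln \<gamma>))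
      / (enn2real (F P_zero \<gamma>) / (ln \<gamma> / kl a0)))
    = (expected_time P_zero (subspace_cusum_time x (uhat \<gamma>) (d \<gamma>) (b' \<gamma>)) + of_nat (w \<gamma>))
              / expected_time P_zero (exact_cusum_time \<sigma> \<theta> u x (b \<gamma>))"
  proof -
    have "\<forall>\<^sub>F \<gamma> in at_top. enn2real (F P_zero \<gamma>) / (ln \<gamma> / kl a0) > 0"
      by (rule order_tendstoD(1)[OF F1 zero_less_one])
    then show ?thesis
      using E_fin F_fin sub pos
    proof eventually_elim
      case (elim \<gamma>)
      define p where "p = enn2real (E P_zero \<gamma>)"
      define q where "q = enn2real (F P_zero \<gamma>)"
      define H where "H = ln \<gamma> / kl a0"
      have H: "H > 0" using elim(5) by (simp add: H_def)
      have q: "q > 0" using elim(1) H by (simp add: q_def H_def[symmetric] zero_less_divide_iff)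
      have p: "p \<ge> 0" by (simp add: p_def)
      have "(p / H + kl a0 * (real (w \<gamma>) / ln \<gamma>)) / (q / H) = (p + real (w \<gamma>)) / q"
      proof -
        have "kl a0 * (real (w \<gamma>) / ln \<gamma>) = real (w \<gamma>) / H" by (simp add: H_def)
        then show ?thesis using H by (simp add: add_divide_distrib[symmetric])
      qed
      moreover have "ennreal ((p + real (w \<gamma>)) / q) = (ennreal p + of_nat (w \<gamma>)) / ennreal q"
        using p q by (simp add: divide_ennreal[symmetric] ennreal_of_nat_eq_real_of_nat)
      ultimately show ?case
        using elim(2,3,4) by (simp add: exact p_def q_def H_def)
    qed
  qed
  ultimately show ?thesis
    by (simp add: tendsto_cong)
qed

end
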